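(* Given integers $N,d,n\geq 0$ there exists an integer $\beta=\beta(N,d,n)$ with the following property: for every Prüfer domain $R$ and all polynomials $f_1,\dots,f_n\in R[X]=R[X_1,\dots,X_N]$ of total degree $\leq d$, the $R[X]$-submodule of $R[X]^n$ consisting of all solutions $(y_1,\dots,y_n)\in R[X]^n$ to the linear homogeneous equation $$f_1y_1+\cdots+f_ny_n=0$$ can be generated by (finitely many) solutions whose components have degree $\leq\beta$.
   Context: Rings are commutative with unit. A Prüfer domain is an integral domain in which every finitely generated ideal is projective. $X=(X_1,\dots,X_N)$ is a tuple of $N$ distinct indeterminates; degree means total degree, and $\deg(0)=-\infty$. The integer $\beta$ depends only on $N,d,n$, not on $R$ or the $f_j$. *)

theory Defs
  imports "HOL-Algebra.Algebra" "HOL-Library.Extended_Real"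
begin

section \<open>Free modules, generation, projectivity\<close>

text \<open>
  The free \<open>R\<close>-module on \<open>S\<close>: finitely supported functions \<open>S \<rightarrow> R\<close>. The fields \<open>mult\<close> and
  \<open>one\<close> come from the record type \<open>module\<close> extending \<open>ring\<close>; the locales \<open>module\<close> and
  \<open>submodule\<close> do not refer to them.
\<close>

definition free_module :: "('a, 'm) ring_scheme \<Rightarrow> 'i set \<Rightarrow> ('a, 'i \<Rightarrow> 'a) module" where
  "free_module R S =
     \<lparr> carrier = {v \<in> S \<rightarrow>\<^sub>E carrier R. finite {i \<in> S. v i \<noteq> \<zero>\<^bsub>R\<^esub>}},
       monoid.mult = undefined,
       one = undefined,
       ring.zero = (\<lambda>i\<in>S. \<zero>\<^bsub>R\<^esub>),
       ring.add = (\<lambda>u v. \<lambda>i\<in>S. u i \<oplus>\<^bsub>R\<^esub> v i),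
       smult = (\<lambda>a v. \<lambda>i\<in>S. a \<otimes>\<^bsub>R\<^esub> v i) \<rparr>"

definition generated_submodule ::
    "('a, 'm) ring_scheme \<Rightarrow> ('a, 'b, 'k) module_scheme \<Rightarrow> 'b set \<Rightarrow> 'b set" where
  "generated_submodule R M G = (\<lambda>H. submodule H R M) hull G"

definition module_iso ::
    "('a, 'm) ring_scheme \<Rightarrow> ('a, 'b, 'k) module_scheme \<Rightarrow> ('a, 'c, 'l) module_scheme \<Rightarrow> ('b \<Rightarrow> 'c) set"
  where
  "module_iso R M M' =
     {h \<in> iso (add_monoid M) (add_monoid M').
        \<forall>a\<in>carrier R. \<forall>x\<in>carrier M. h (a \<odot>\<^bsub>M\<^esub> x) = a \<odot>\<^bsub>M'\<^esub> h x}"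

text \<open>
  A module is projective if it is isomorphic to a direct summand of a free module. Taking the
  basis \<open>S\<close> in the type of elements of \<open>M\<close> is no restriction: a projective module is a direct
  summand of the free module on any generating set, for instance on its own carrier.
\<close>

definition projective_module :: "('a, 'm) ring_scheme \<Rightarrow> ('a, 'b, 'k) module_scheme \<Rightarrow> bool" where
  "projective_module R M \<longleftrightarrow> module R M \<and>
     (\<exists>(S :: 'b set) H K h.
        submodule H R (free_module R S) \<and> submodule K R (free_module R S) \<and>
        H \<inter> K = {\<zero>\<^bsub>free_module R S\<^esub>} \<and>
        H <+>\<^bsub>free_module R S\<^esub> K = carrier (free_module R S) \<and>
        h \<in> module_iso R M ((free_module R S)\<lparr>carrier := H\<rparr>))"

section \<open>Pruefer domains\<close>

definition ideal_module :: "('a, 'm) ring_scheme \<Rightarrow> 'a set \<Rightarrow> ('a, 'a) module" where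
  "ideal_module R I =
     \<lparr> carrier = I, monoid.mult = monoid.mult R, one = \<one>\<^bsub>R\<^esub>, ring.zero = \<zero>\<^bsub>R\<^esub>, ring.add = ring.add R, smult = monoid.mult R \<rparr>"

definition prufer_domain :: "('a, 'm) ring_scheme \<Rightarrow> bool" where
  "prufer_domain R \<longleftrightarrow> domain R \<and>
     (\<forall>S. finite S \<and> S \<subseteq> carrier R \<longrightarrow> projective_module R (ideal_module R (Idl\<^bsub>R\<^esub> S)))"

section \<open>Polynomials in \<open>N\<close> indeterminates\<close>

text \<open>
  \<open>R[X\<^sub>1, \<dots>, X\<^sub>N]\<close>, built on the indexed polynomials of \<open>HOL-Algebra\<close>: a polynomial maps each
  monomial, given as a multiset of indices of indeterminates, to its coefficient. The library has
  addition but only multiplication by an indeterminate; the product here is the convolution.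
\<close>

definition mpoly_ring :: "('a, 'm) ring_scheme \<Rightarrow> nat \<Rightarrow> (nat multiset \<Rightarrow> 'a) ring" where
  "mpoly_ring R N =
     \<lparr> carrier = ring.indexed_pset R {1..N} (carrier R),
       monoid.mult = (\<lambda>p q m. finsum R (\<lambda>k. p k \<otimes>\<^bsub>R\<^esub> q (m - k)) {k. k \<subseteq># m}),
       one = ring.indexed_const R \<one>\<^bsub>R\<^esub>,
       ring.zero = ring.indexed_const R \<zero>\<^bsub>R\<^esub>,
       ring.add = ring.indexed_padd R \<rparr>"

text \<open>The supremum of the empty set in \<open>ereal\<close> is \<open>-\<infinity>\<close>, the degree of the zero polynomial.\<close>

definition total_degree :: "('a, 'm) ring_scheme \<Rightarrow> (nat multiset \<Rightarrow> 'a) \<Rightarrow> ereal" where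
  "total_degree R p = (SUP m \<in> {m. p m \<noteq> \<zero>\<^bsub>R\<^esub>}. ereal (real (size m)))"

section \<open>Solutions and degree bounds\<close>

definition solutions ::
    "('a, 'm) ring_scheme \<Rightarrow> nat \<Rightarrow> nat \<Rightarrow> (nat \<Rightarrow> nat multiset \<Rightarrow> 'a) \<Rightarrow> (nat \<Rightarrow> nat multiset \<Rightarrow> 'a) set"
  where
  "solutions R N n f =
     {y \<in> carrier (free_module (mpoly_ring R N) {1..n}).
        finsum (mpoly_ring R N) (\<lambda>j. f j \<otimes>\<^bsub>mpoly_ring R N\<^esub> y j) {1..n} = \<zero>\<^bsub>mpoly_ring R N\<^esub>}"

definition generated_in_degree ::
    "('a, 'm) ring_scheme \<Rightarrow> nat \<Rightarrow> nat \<Rightarrow> (nat \<Rightarrow> nat multiset \<Rightarrow> 'a) \<Rightarrow> nat \<Rightarrow> bool" where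
  "generated_in_degree R N n f b \<longleftrightarrow>
     (\<exists>G. finite G \<and> G \<subseteq> solutions R N n f \<and>
        (\<forall>y\<in>G. \<forall>j\<in>{1..n}. total_degree R (y j) \<le> ereal (real b)) \<and>
        generated_submodule (mpoly_ring R N) (free_module (mpoly_ring R N) {1..n}) G
          = solutions R N n f)"

text \<open>
  The bound has to be one number for all Pruefer domains, but HOL cannot quantify over types inside
  a formula: in a statement of the form \<open>\<exists>\<beta>. \<forall>R :: 'a ring. \<dots>\<close> the witness may depend on the type
  \<open>'a\<close>. So \<open>\<beta>\<close> is named by a constant whose type and definition contain no type variable, and the
  theorem asserts that this \<open>\<beta> N d n\<close> is a bound for the Pruefer domains over every type \<open>'a\<close>.
  The constant is the least number that is a bound for the Pruefer domains with carrier a set of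
  natural numbers, that is, up to isomorphism, for the countable ones. If any number is a bound for
  all Pruefer domains then this one is too: by the Loewenheim-Skolem argument, a counterexample to a
  given number over some Pruefer domain yields one over a countable Pruefer subdomain. If there were
  no bound, \<open>LEAST\<close> would be an unspecified number, so the existence of a bound is not built into
  the definition.
\<close>

definition \<beta> :: "nat \<Rightarrow> nat \<Rightarrow> nat \<Rightarrow> nat" where
  "\<beta> N d n =
     (LEAST b. \<forall>(R :: nat ring) f.
        prufer_domain R \<longrightarrow>
        f \<in> {1..n} \<rightarrow> carrier (mpoly_ring R N) \<longrightarrow>
        (\<forall>j\<in>{1..n}. total_degree R (f j) \<le> ereal (real d)) \<longrightarrow>
        generated_in_degree R N n f b)"

end

theory Submission
  imports Defs
    "HOL-Library.Product_Lexorder" "HOL-Library.Multiset_Order"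
    "HOL-Library.Diagonal_Subsequence" "HOL-Library.Countable_Set"
begin

text \<open>
  Let \<open>R\<close> be a Pruefer domain. Homogenize the equation by a variable \<open>x\<^sub>0\<close>; the solutions of
  degree at most \<open>s\<close> then form the part of degree \<open>s\<close> of a graded module of syzygies \<open>S\<close>. Two
  things have to be shown: that each \<open>S\<^sub>s\<close> is a finitely generated \<open>R\<close>-module
  (\<open>saturated_finitely_generated\<close>), and that \<open>S\<^sub>s\<^sub>+\<^sub>1 = \<Sum>\<^sub>i x\<^sub>i S\<^sub>s\<close> for all \<open>s \<ge> D\<close>, where \<open>D\<close>
  depends only on \<open>N\<close>, \<open>d\<close> and \<open>n\<close> (\<open>syz_step\<close>).

  The second statement can be checked at each prime ideal \<open>P\<close>, where \<open>R\<close> becomes a valuation ring.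
  Being the kernel of a matrix, \<open>S\<^sub>s\<close> is saturated, and over a valuation ring this implies that
  its rank does not change when it is reduced modulo \<open>P\<close> (\<open>card_leads_saturated\<close>). By Nakayama's
  lemma (\<open>local_nakayama\<close>) it is enough that the leading monomials modulo \<open>P\<close> of the syzygies of
  degree \<open>s + 1\<close> are multiples of those of degree \<open>s\<close>. So everything is reduced to bounding the
  degrees of the generators of a monomial submodule \<open>U\<close> whose Hilbert function is known: by
  rank-nullity it is the Hilbert function of a free module minus that of the ideal generated by
  the homogenized \<open>f\<^sub>j\<close> over the fraction field, or of the leading monomials \<open>W\<close> of this ideal
  (\<open>lead_set_card\<close>).

  What enters about \<open>W\<close> is a trace of Buchberger's criterion (\<open>leads_gap\<close>): if \<open>W\<close> has no
  generators in the degrees between \<open>D\<close> and \<open>2 * D\<close>, it has none above \<open>D\<close>. By compactness and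
  Dickson's lemma, this property of \<open>W\<close> and the relation between the Hilbert functions bound the
  degrees of the generators of \<open>U\<close> for all such pairs at once (\<open>uniform_generation_bound\<close>). That
  argument is about sets of monomials; it does not see the ring, whence the bound is uniform.

  The constant \<open>\<beta>\<close> refers to Pruefer domains on sets of natural numbers. A general \<open>R\<close> is reduced
  to these: by the dual basis of a projective ideal and its converse, a domain is Pruefer if and
  only if it satisfies an \<open>\<forall>\<exists>\<close>-condition on pairs of elements (\<open>prufer_domain_arithmetical\<close>,
  \<open>arithmetical_prufer\<close>), so \<open>R\<close> has countable Pruefer subdomains that contain any given finite
  set (\<open>countable_prufer_subdomain\<close>).
\<close>

section \<open>Leading positions and rank\<close>

text \<open>
  Submodules of the free module \<open>R\<^sup>Q\<close>. Vectors are functions on the whole index type that vanish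
  outside \<open>Q\<close>, so that the modules for all \<open>Q\<close> live in one type.
\<close>

definition (in ring) coord_submodule :: "'q set \<Rightarrow> ('q \<Rightarrow> 'a) set \<Rightarrow> bool" where
  "coord_submodule Q L \<longleftrightarrow> (\<lambda>_. \<zero>) \<in> L \<and>
     (\<forall>y\<in>L. (\<forall>q. y q \<in> carrier R) \<and> (\<forall>q. q \<notin> Q \<longrightarrow> y q = \<zero>)) \<and>
     (\<forall>y\<in>L. \<forall>z\<in>L. \<forall>a\<in>carrier R. \<forall>b\<in>carrier R. (\<lambda>q. a \<otimes> y q \<oplus> b \<otimes> z q) \<in> L)"

text \<open>
  The positions of the last coordinates that survive reduction modulo \<open>P\<close>. For a prime ideal \<open>P\<close>
  their number is the rank of the image of \<open>L\<close> over the domain \<open>R/P\<close>. With \<open>P = 0\<close> this is linear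
  algebra over the fraction field of a domain \<open>R\<close>, with \<open>P\<close> maximal it is linear algebra over the
  residue field; keeping \<open>P\<close> as a parameter treats both without constructing either field.
\<close>

definition leads :: "'a set \<Rightarrow> ('q::linorder \<Rightarrow> 'a) set \<Rightarrow> 'q set" where
  "leads P L = {q. \<exists>y\<in>L. y q \<notin> P \<and> (\<forall>q'>q. y q' \<in> P)}"

definition (in ring) linear_on :: "('q \<Rightarrow> 'a) set \<Rightarrow> (('q \<Rightarrow> 'a) \<Rightarrow> 'a) \<Rightarrow> bool" where
  "linear_on L \<phi> \<longleftrightarrow> (\<forall>y\<in>L. \<phi> y \<in> carrier R) \<and>
     (\<forall>y\<in>L. \<forall>z\<in>L. \<forall>a\<in>carrier R. \<forall>b\<in>carrier R.
        \<phi> (\<lambda>q. a \<otimes> y q \<oplus> b \<otimes> z q) = a \<otimes> \<phi> y \<oplus> b \<otimes> \<phi> z)"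

lemma leadsI: "y \<in> L \<Longrightarrow> y q \<notin> P \<Longrightarrow> (\<And>q'. q' > q \<Longrightarrow> y q' \<in> P) \<Longrightarrow> q \<in> leads P L"
  unfolding leads_def by auto

lemma leads_mono: "L \<subseteq> L' \<Longrightarrow> leads P L \<subseteq> leads P L'"
  unfolding leads_def by auto

context cring
begin

lemma coord_submoduleD:
  assumes "coord_submodule Q L"
  shows "(\<lambda>_. \<zero>) \<in> L"
    and "y \<in> L \<Longrightarrow> y q \<in> carrier R"
    and "y \<in> L \<Longrightarrow> q \<notin> Q \<Longrightarrow> y q = \<zero>"
    and "y \<in> L \<Longrightarrow> z \<in> L \<Longrightarrow> a \<in> carrier R \<Longrightarrow> b \<in> carrier R \<Longrightarrow> (\<lambda>q. a \<otimes> y q \<oplus> b \<otimes> z q) \<in> L"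
  using assms unfolding coord_submodule_def by auto

lemma coord_submodule_smult:
  assumes "coord_submodule Q L" "y \<in> L" "a \<in> carrier R"
  shows "(\<lambda>q. a \<otimes> y q) \<in> L"
proof -
  have "(\<lambda>q. a \<otimes> y q \<oplus> \<zero> \<otimes> y q) \<in> L"
    using assms by (intro coord_submoduleD(4)) auto
  moreover have "(\<lambda>q. a \<otimes> y q \<oplus> \<zero> \<otimes> y q) = (\<lambda>q. a \<otimes> y q)"
    using coord_submoduleD(2)[OF assms(1,2)] assms(3) by auto
  ultimately show ?thesis by simp
qed

lemma coord_submodule_add:
  assumes "coord_submodule Q L" "y \<in> L" "z \<in> L"
  shows "(\<lambda>q. y q \<oplus> z q) \<in> L"
  using coord_submoduleD(4)[OF assms one_closed one_closed]
    coord_submoduleD(2)[OF assms(1,2)] coord_submoduleD(2)[OF assms(1,3)] by simp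

lemma ideal_by_closure:
  assumes "I \<subseteq> carrier R" "\<zero> \<in> I" "\<And>a b. a \<in> I \<Longrightarrow> b \<in> I \<Longrightarrow> a \<oplus> b \<in> I"
    and mult: "\<And>a x. a \<in> I \<Longrightarrow> x \<in> carrier R \<Longrightarrow> x \<otimes> a \<in> I"
  shows "ideal I R"
proof (rule idealI[OF ring_axioms])
  show "subgroup I (add_monoid R)"
  proof (rule add.subgroupI)
    fix a assume a: "a \<in> I"
    then have "\<ominus> a = (\<ominus> \<one>) \<otimes> a" using subsetD[OF assms(1) a] by (simp add: l_minus)
    then show "\<ominus> a \<in> I" using mult[OF a, of "\<ominus> \<one>"] by simp
  qed (use assms in auto)
  fix a x assume a: "a \<in> I" and x: "x \<in> carrier R"
  show "x \<otimes> a \<in> I" by (rule mult[OF a x])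
  then show "a \<otimes> x \<in> I" unfolding m_comm[OF subsetD[OF assms(1) a] x] .
qed

lemma primeideal_mult_iff:
  assumes "primeideal P R" "a \<in> carrier R" "b \<in> carrier R"
  shows "a \<otimes> b \<in> P \<longleftrightarrow> a \<in> P \<or> b \<in> P"
proof -
  interpret primeideal P R by fact
  show ?thesis using I_prime assms I_l_closed I_r_closed by blast
qed

lemma ideal_add_iff:
  assumes "ideal P R" "a \<in> carrier R" "b \<in> P"
  shows "a \<oplus> b \<in> P \<longleftrightarrow> a \<in> P"
proof -
  interpret ideal P R by fact
  have b: "b \<in> carrier R" using assms(3) a_subset by auto
  have "a = (a \<oplus> b) \<oplus> \<ominus> b" using assms b by algebra
  then show ?thesis using a_closed a_inv_closed assms by metis
qed

lemma leads_subset: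
  assumes "coord_submodule Q L" "ideal P R"
  shows "leads P L \<subseteq> Q"
proof -
  interpret ideal P R by fact
  show ?thesis
    using coord_submoduleD(3)[OF assms(1)] zero_closed
    unfolding leads_def by (force simp: additive_subgroup.zero_closed)
qed

lemma lead_exists:
  fixes y :: "'q::linorder \<Rightarrow> 'a"
  assumes "coord_submodule Q L" "ideal P R" "finite Q" "y \<in> L" "y q \<notin> P"
  shows "\<exists>p. y p \<notin> P \<and> (\<forall>q'>p. y q' \<in> P)"
proof -
  interpret ideal P R by fact
  let ?S = "{q. y q \<notin> P}"
  have "?S \<subseteq> Q"
    using coord_submoduleD(3)[OF assms(1,4)] additive_subgroup.zero_closed[OF additive_subgroup_axioms]
    by force
  then have f: "finite ?S" using assms(3) finite_subset by blast
  have "?S \<noteq> {}" using assms(5) by auto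
  then have "y (Max ?S) \<notin> P" using Max_in[OF f] by blast
  moreover have "\<forall>q'>Max ?S. y q' \<in> P" using Max_ge[OF f] by (metis leD mem_Collect_eq)
  ultimately show ?thesis by blast
qed

lemma linear_onD:
  assumes "linear_on L \<phi>"
  shows "y \<in> L \<Longrightarrow> \<phi> y \<in> carrier R"
    and "y \<in> L \<Longrightarrow> z \<in> L \<Longrightarrow> a \<in> carrier R \<Longrightarrow> b \<in> carrier R \<Longrightarrow>
      \<phi> (\<lambda>q. a \<otimes> y q \<oplus> b \<otimes> z q) = a \<otimes> \<phi> y \<oplus> b \<otimes> \<phi> z"
  using assms unfolding linear_on_def by auto

lemma linear_on_zero:
  assumes "linear_on L \<phi>" "(\<lambda>_. \<zero>) \<in> L"
  shows "\<phi> (\<lambda>_. \<zero>) = \<zero>"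
  using linear_onD(1)[OF assms] linear_onD(2)[OF assms(1) assms(2) assms(2) zero_closed zero_closed]
  by simp

text \<open>
  The identity behind all eliminations below: denominators are avoided by multiplying crosswise.
\<close>

lemma cross_cancel:
  assumes "a \<in> carrier R" "b \<in> carrier R"
  shows "a \<otimes> b \<oplus> (\<ominus> b) \<otimes> a = \<zero>"
  using assms by algebra

lemma coord_submodule_kernel:
  assumes "coord_submodule Q L" "linear_on L \<phi>" "ideal P R"
  shows "coord_submodule Q {y\<in>L. \<phi> y \<in> P}"
proof -
  interpret ideal P R by fact
  note D = coord_submoduleD[OF assms(1)]
  have z: "\<phi> (\<lambda>_. \<zero>) = \<zero>"
    by (rule linear_on_zero[OF assms(2) D(1)])
  show ?thesis
    unfolding coord_submodule_def
  proof (intro conjI ballI)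
    show "(\<lambda>_. \<zero>) \<in> {y \<in> L. \<phi> y \<in> P}"
      using D(1) z additive_subgroup.zero_closed[OF additive_subgroup_axioms] by auto
  next
    fix y assume "y \<in> {y \<in> L. \<phi> y \<in> P}"
    then show "\<forall>q. y q \<in> carrier R" "\<forall>q. q \<notin> Q \<longrightarrow> y q = \<zero>" using D(2,3) by auto
  next
    fix y z a b assume yz: "y \<in> {y \<in> L. \<phi> y \<in> P}" "z \<in> {y \<in> L. \<phi> y \<in> P}"
      and ab: "a \<in> carrier R" "b \<in> carrier R"
    then have "\<phi> (\<lambda>q. a \<otimes> y q \<oplus> b \<otimes> z q) = a \<otimes> \<phi> y \<oplus> b \<otimes> \<phi> z"
      using assms(2) unfolding linear_on_def by auto
    then show "(\<lambda>q. a \<otimes> y q \<oplus> b \<otimes> z q) \<in> {y \<in> L. \<phi> y \<in> P}"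
      using yz ab D(4) I_l_closed a_closed by auto
  qed
qed

lemma linear_on_coordinate:
  assumes "coord_submodule Q L"
  shows "linear_on L (\<lambda>y. y q)"
  using coord_submoduleD(2)[OF assms] unfolding linear_on_def by auto

text \<open>
  A linear condition that is nontrivial modulo \<open>P\<close> lowers the rank by one. The leading position
  that gets lost is the lowest one, \<open>b\<close>, among the elements that violate the condition. If \<open>y\<close>
  violates it with leading position \<open>b\<close>, an element with another leading position is corrected by
  \<open>y\<close> without changing that position, while an element of the kernel with leading position \<open>b\<close>
  could be combined with \<open>y\<close> to violate the condition below \<open>b\<close>. The rank computations below are
  inductions on this lemma.
\<close>

lemma card_leads_kernel:
  fixes L :: "('q::linorder \<Rightarrow> 'a) set"
  assumes P: "primeideal P R" and L: "coord_submodule Q L" and Q: "finite Q"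
    and \<phi>: "linear_on L \<phi>" and resp: "\<And>y. y \<in> L \<Longrightarrow> (\<And>q. y q \<in> P) \<Longrightarrow> \<phi> y \<in> P"
    and y0: "y0 \<in> L" "\<phi> y0 \<notin> P"
  shows "card (leads P L) = Suc (card (leads P {y\<in>L. \<phi> y \<in> P}))"
proof -
  interpret primeideal P R by fact
  note id = is_ideal
  note D = coord_submoduleD[OF L]
  define L' where "L' = {y\<in>L. \<phi> y \<in> P}"
  define B where "B = {q. \<exists>y\<in>L. \<phi> y \<notin> P \<and> y q \<notin> P \<and> (\<forall>q'>q. y q' \<in> P)}"
  have BQ: "B \<subseteq> leads P L" unfolding B_def leads_def by auto
  have finl: "finite (leads P L)" using leads_subset[OF L id] Q finite_subset by blast
  have finB: "finite B" using BQ finl finite_subset by blast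
  obtain q0 where "y0 q0 \<notin> P" using resp y0 by blast
  then have "B \<noteq> {}" using lead_exists[OF L id Q y0(1)] y0 unfolding B_def by blast
  define b where "b = Min B"
  have "b \<in> B" using \<open>B \<noteq> {}\<close> finB b_def by simp
  then obtain y where y: "y \<in> L" "\<phi> y \<notin> P" "y b \<notin> P" "\<And>q'. q' > b \<Longrightarrow> y q' \<in> P"
    unfolding B_def by auto
  have bmin: "b \<le> q" if "z \<in> L" "\<phi> z \<notin> P" "z q \<notin> P" "\<And>q'. q' > q \<Longrightarrow> z q' \<in> P" for z q
    using that finB unfolding b_def B_def by (intro Min_le) auto
  have \<phi>c: "\<phi> z \<in> carrier R" if "z \<in> L" for z using \<phi> that unfolding linear_on_def by auto
  have \<phi>l: "\<phi> (\<lambda>q. a \<otimes> u q \<oplus> c \<otimes> z q) = a \<otimes> \<phi> u \<oplus> c \<otimes> \<phi> z"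
    if "u \<in> L" "z \<in> L" "a \<in> carrier R" "c \<in> carrier R" for u z a c
    using \<phi> that unfolding linear_on_def by auto
  have "leads P L' = leads P L - {b}"
  proof (intro equalityI subsetI)
    fix q assume "q \<in> leads P L'"
    then obtain z where z: "z \<in> L" "\<phi> z \<in> P" "z q \<notin> P" "\<And>q'. q' > q \<Longrightarrow> z q' \<in> P"
      unfolding leads_def L'_def by auto
    have "q \<noteq> b"
    proof
      assume qb: "q = b"
      \<comment> \<open>Cancelling the leading terms would give a witness in \<open>B\<close> below its minimum.\<close>
      define w where "w = (\<lambda>q. z b \<otimes> y q \<oplus> (\<ominus> y b) \<otimes> z q)"
      have wL: "w \<in> L" unfolding w_def using D(2)[OF y(1)] D(2)[OF z(1)] by (intro D(4) y z) auto
      have "\<phi> w = z b \<otimes> \<phi> y \<oplus> (\<ominus> y b) \<otimes> \<phi> z"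
        unfolding w_def using D(2)[OF y(1)] D(2)[OF z(1)] by (intro \<phi>l y z) auto
      moreover have "(\<ominus> y b) \<otimes> \<phi> z \<in> P" using z D(2)[OF y(1)] by (intro I_l_closed) auto
      moreover have "z b \<otimes> \<phi> y \<notin> P"
        using primeideal_mult_iff[OF P] z(3) y(2) qb D(2)[OF z(1)] \<phi>c[OF y(1)] by auto
      ultimately have w\<phi>: "\<phi> w \<notin> P"
        using ideal_add_iff[OF id] D(2)[OF z(1)] \<phi>c[OF y(1)] by auto
      then obtain q1 where "w q1 \<notin> P" using resp[OF wL] by blast
      then obtain p where p: "w p \<notin> P" "\<forall>q'>p. w q' \<in> P"
        using lead_exists[OF L id Q wL] by blast
      have "b \<le> p" using bmin[OF wL w\<phi> p(1)] p(2) by blast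
      moreover have "w b = \<zero>" unfolding w_def
        using D(2)[OF y(1)] D(2)[OF z(1)] by (simp add: cross_cancel)
      moreover have "w q' \<in> P" if "q' > b" for q'
        unfolding w_def using y(4)[OF that] z(4) that qb D(2)[OF y(1)] D(2)[OF z(1)]
        by (intro a_closed I_l_closed) auto
      ultimately show False
        using p(1) additive_subgroup.zero_closed[OF additive_subgroup_axioms] by (metis order_le_less)
    qed
    then show "q \<in> leads P L - {b}" using z unfolding leads_def by auto
  next
    fix q assume "q \<in> leads P L - {b}"
    then obtain z where z: "z \<in> L" "z q \<notin> P" "\<And>q'. q' > q \<Longrightarrow> z q' \<in> P" and qb: "q \<noteq> b"
      unfolding leads_def by auto
    show "q \<in> leads P L'"
    proof (cases "\<phi> z \<in> P")
      case True then show ?thesis using z unfolding leads_def L'_def by auto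
    next
      case False
      then have "b < q" using bmin[OF z(1) False z(2,3)] qb by auto
      define w where "w = (\<lambda>q. \<phi> y \<otimes> z q \<oplus> (\<ominus> \<phi> z) \<otimes> y q)"
      have wL: "w \<in> L" unfolding w_def using \<phi>c y z by (intro D(4) y z) auto
      have "\<phi> w = \<phi> y \<otimes> \<phi> z \<oplus> (\<ominus> \<phi> z) \<otimes> \<phi> y"
        unfolding w_def using \<phi>c y z by (intro \<phi>l y z) auto
      also have "\<dots> = \<zero>" using \<phi>c y z by (simp add: cross_cancel)
      finally have "w \<in> L'" using wL additive_subgroup.zero_closed[OF additive_subgroup_axioms]
        unfolding L'_def by auto
      moreover have "w q \<notin> P"
      proof -
        have "(\<ominus> \<phi> z) \<otimes> y q \<in> P" using y(4)[OF \<open>b < q\<close>] \<phi>c[OF z(1)] by (intro I_l_closed) auto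
        moreover have "\<phi> y \<otimes> z q \<notin> P"
          using primeideal_mult_iff[OF P] y(2) z(2) D(2)[OF z(1)] \<phi>c[OF y(1)] by auto
        ultimately show ?thesis unfolding w_def
          using ideal_add_iff[OF id] D(2)[OF z(1)] \<phi>c[OF y(1)] by auto
      qed
      moreover have "w q' \<in> P" if "q' > q" for q'
        unfolding w_def using y(4)[of q'] z(3) that \<open>b < q\<close> \<phi>c[OF y(1)] \<phi>c[OF z(1)]
        by (intro a_closed I_l_closed) auto
      ultimately show ?thesis by (auto intro: leadsI)
    qed
  qed
  moreover have "b \<in> leads P L" using BQ \<open>b \<in> B\<close> by auto
  ultimately show ?thesis unfolding L'_def[symmetric] using finl card_Suc_Diff1 by metis
qed

lemma card_leads_coordinate:
  fixes L :: "('q::linorder \<Rightarrow> 'a) set"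
  assumes "primeideal P R" "coord_submodule Q L" "finite Q" "y \<in> L" "y q \<notin> P"
  shows "card (leads P L) = Suc (card (leads P {y\<in>L. y q \<in> P}))"
  using card_leads_kernel[OF assms(1-3) linear_on_coordinate[OF assms(2)] _ assms(4,5)] by auto

lemma leads_empty:
  fixes L :: "('q::linorder \<Rightarrow> 'a) set"
  assumes "coord_submodule Q L" "ideal P R" "finite Q" "leads P L = {}" "y \<in> L"
  shows "y q \<in> P"
  using lead_exists[OF assms(1,2,3,5)] assms(4,5) unfolding leads_def by blast

end

text \<open>
  Induction on the rank of the image: requiring one coordinate of \<open>\<phi> y\<close> to vanish lowers the rank
  of \<open>L\<close> and the rank of the image by one and does not affect the kernel.
\<close>

lemma (in domain) card_leads_rank_nullity:
  fixes L :: "('q::linorder \<Rightarrow> 'a) set" and \<phi> :: "('q \<Rightarrow> 'a) \<Rightarrow> ('p::linorder \<Rightarrow> 'a)"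
  assumes "finite Q" "finite Q'" "coord_submodule Q L" "coord_submodule Q' (\<phi> ` L)"
    and "\<And>p. linear_on L (\<lambda>y. \<phi> y p)"
  shows "card (leads {\<zero>} L) = card (leads {\<zero>} {y\<in>L. \<phi> y = (\<lambda>_. \<zero>)}) + card (leads {\<zero>} (\<phi> ` L))"
  using assms(3-5)
proof (induction "card (leads {\<zero>} (\<phi> ` L))" arbitrary: L)
  case 0
  then have "leads {\<zero>} (\<phi> ` L) = {}"
    using leads_subset[OF 0(3)] zeroprimeideal assms(2) finite_subset
    by (metis card_0_eq primeideal.axioms(1))
  then have "\<phi> y p = \<zero>" if "y \<in> L" for y p
    using leads_empty[OF 0(3) _ assms(2)] zeroprimeideal that primeideal.axioms(1) by blast
  then have "{y\<in>L. \<phi> y = (\<lambda>_. \<zero>)} = L" by auto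
  then show ?case using 0 by simp
next
  case (Suc k)
  then obtain p where "p \<in> leads {\<zero>} (\<phi> ` L)" by fastforce
  then obtain y where y: "y \<in> L" "\<phi> y p \<noteq> \<zero>" unfolding leads_def by auto
  define L' where "L' = {y\<in>L. \<phi> y p \<in> {\<zero>}}"
  note zp = zeroprimeideal
  have zi: "ideal {\<zero>} R" using zp primeideal.axioms(1) by blast
  have lin: "\<phi> (\<lambda>_. \<zero>) q = \<zero>" for q
    by (rule linear_on_zero[OF Suc.prems(3) coord_submoduleD(1)[OF Suc.prems(1)]])
  have 1: "card (leads {\<zero>} L) = Suc (card (leads {\<zero>} L'))"
    unfolding L'_def
  proof (rule card_leads_kernel[OF zp Suc.prems(1) assms(1) Suc.prems(3) _ y(1)])
    fix z :: "'q \<Rightarrow> 'a" assume "z \<in> L" "\<And>q. z q \<in> {\<zero>}"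
    then have "z = (\<lambda>_. \<zero>)" by auto
    then show "\<phi> z p \<in> {\<zero>}" using lin by simp
  qed (use y in auto)
  have im: "\<phi> ` L' = {w \<in> \<phi> ` L. w p \<in> {\<zero>}}" unfolding L'_def by auto
  have 2: "card (leads {\<zero>} (\<phi> ` L)) = Suc (card (leads {\<zero>} (\<phi> ` L')))"
    unfolding im by (rule card_leads_coordinate[OF zp Suc.prems(2) assms(2), of "\<phi> y"]) (use y in auto)
  have c1: "coord_submodule Q L'" unfolding L'_def
    by (rule coord_submodule_kernel[OF Suc.prems(1,3) zi])
  have c2: "coord_submodule Q' (\<phi> ` L')" unfolding im
    by (rule coord_submodule_kernel[OF Suc.prems(2) linear_on_coordinate[OF Suc.prems(2)] zi])
  have c3: "linear_on L' (\<lambda>y. \<phi> y q)" for q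
    using Suc.prems(3)[of q] unfolding linear_on_def L'_def by auto
  have "card (leads {\<zero>} L') = card (leads {\<zero>} {y\<in>L'. \<phi> y = (\<lambda>_. \<zero>)}) + card (leads {\<zero>} (\<phi> ` L'))"
    using Suc.hyps(1)[OF _ c1 c2 c3] Suc.hyps(2) 2 by simp
  moreover have "{y\<in>L'. \<phi> y = (\<lambda>_. \<zero>)} = {y\<in>L. \<phi> y = (\<lambda>_. \<zero>)}" unfolding L'_def by auto
  ultimately show ?case using 1 2 by simp
qed

section \<open>Saturated submodules over Pruefer domains\<close>

inductive_set (in ring) lspan :: "('q \<Rightarrow> 'a) set \<Rightarrow> ('q \<Rightarrow> 'a) set" for G where
  zero: "(\<lambda>_. \<zero>) \<in> lspan G"
| add: "y \<in> lspan G \<Longrightarrow> g \<in> G \<Longrightarrow> r \<in> carrier R \<Longrightarrow> (\<lambda>q. y q \<oplus> r \<otimes> g q) \<in> lspan G"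

text \<open>
  Invertibility of the ideals with two generators, in terms of elements: \<open>a\<close> divides \<open>b\<close> where \<open>s\<close>
  is a unit and \<open>b\<close> divides \<open>a\<close> where \<open>t\<close> is a unit. Being a condition of the form
  \<open>\<forall>a b. \<exists>s t u v\<close> it is inherited by suitable countable subrings.
\<close>

definition (in ring) arithmetical :: bool where
  "arithmetical \<longleftrightarrow> (\<forall>a\<in>carrier R. \<forall>b\<in>carrier R. \<exists>s\<in>carrier R. \<exists>t\<in>carrier R. \<exists>u\<in>carrier R. \<exists>v\<in>carrier R.
     s \<oplus> t = \<one> \<and> s \<otimes> b = u \<otimes> a \<and> t \<otimes> a = v \<otimes> b)"

text \<open>
  Divisibility is total in the localization at \<open>P\<close>; the element \<open>u\<close> is the denominator. In a
  domain this says that the localization is a valuation ring.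
\<close>

definition (in ring) valuative :: "'a set \<Rightarrow> bool" where
  "valuative P \<longleftrightarrow> (\<forall>a\<in>carrier R. \<forall>b\<in>carrier R. \<exists>u\<in>carrier R - P. \<exists>c\<in>carrier R.
     u \<otimes> a = c \<otimes> b \<or> u \<otimes> b = c \<otimes> a)"

text \<open>
  The quotient by \<open>L\<close> is torsion-free. Over a domain such a submodule consists of the integral
  points of a subspace over the fraction field; kernels of matrices are the example that matters.
\<close>

definition (in ring) saturated :: "('q \<Rightarrow> 'a) set \<Rightarrow> bool" where
  "saturated L \<longleftrightarrow> (\<forall>y r. (\<forall>q. y q \<in> carrier R) \<longrightarrow> r \<in> carrier R \<longrightarrow> r \<noteq> \<zero> \<longrightarrow>
     (\<lambda>q. r \<otimes> y q) \<in> L \<longrightarrow> y \<in> L)"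

lemma (in ring) saturatedD:
  assumes "saturated L" "\<And>q. y q \<in> carrier R" "r \<in> carrier R" "r \<noteq> \<zero>" "(\<lambda>q. r \<otimes> y q) \<in> L"
  shows "y \<in> L"
  using assms unfolding saturated_def by blast

lemma (in ring) saturated_kernel:
  assumes "domain R" "saturated L"
  shows "saturated {y\<in>L. y q \<in> {\<zero>}}"
  unfolding saturated_def
proof (intro allI impI)
  fix y r assume *: "\<forall>q. y q \<in> carrier R" "r \<in> carrier R" "r \<noteq> \<zero>"
    "(\<lambda>q. r \<otimes> y q) \<in> {y \<in> L. y q \<in> {\<zero>}}"
  then have "y \<in> L" using saturatedD[OF assms(2)] by blast
  moreover have "y q = \<zero>" using * domain.integral[OF assms(1)] by auto
  ultimately show "y \<in> {y \<in> L. y q \<in> {\<zero>}}" by auto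
qed

context cring
begin

lemma lspan_least:
  assumes "coord_submodule Q L" "G \<subseteq> L"
  shows "lspan G \<subseteq> L"
proof
  fix y assume "y \<in> lspan G"
  then show "y \<in> L"
  proof induction
    case zero then show ?case using assms coord_submoduleD(1) by blast
  next
    case (add y g r)
    have "(\<lambda>q. \<one> \<otimes> y q \<oplus> r \<otimes> g q) \<in> L"
      using add assms by (intro coord_submoduleD(4)) auto
    then show ?case using coord_submoduleD(2)[OF assms(1) add.IH] by simp
  qed
qed

lemma lspan_mono:
  assumes "G \<subseteq> G'"
  shows "lspan G \<subseteq> lspan G'"
proof
  fix y assume "y \<in> lspan G"
  then show "y \<in> lspan G'"
  proof induction
    case zero then show ?case by (rule lspan.zero)
  next
    case (add y g r)
    then show ?case using assms by (intro lspan.add) blast+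
  qed
qed

lemma lspan_coord_submodule:
  assumes "\<And>g q. g \<in> G \<Longrightarrow> g q \<in> carrier R" "\<And>g q. g \<in> G \<Longrightarrow> q \<notin> Q \<Longrightarrow> g q = \<zero>"
  shows "coord_submodule Q (lspan G)"
proof -
  have c: "y q \<in> carrier R" if "y \<in> lspan G" for y q
    using that by induction (auto simp: assms)
  have s: "y q = \<zero>" if "y \<in> lspan G" "q \<notin> Q" for y q
    using that by induction (auto simp: assms)
  have sm: "(\<lambda>q. a \<otimes> y q) \<in> lspan G" if "y \<in> lspan G" "a \<in> carrier R" for a y
    using that
  proof induction
    case zero then show ?case using lspan.zero by simp
  next
    case (add y g r)
    have "(\<lambda>q. a \<otimes> y q \<oplus> (a \<otimes> r) \<otimes> g q) \<in> lspan G"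
      using add by (intro lspan.add) auto
    moreover have "(\<lambda>q. a \<otimes> y q \<oplus> (a \<otimes> r) \<otimes> g q) = (\<lambda>q. a \<otimes> (y q \<oplus> r \<otimes> g q))"
      using add c[OF add(1)] assms(1)[OF add(2)] by (auto simp: r_distr m_assoc)
    ultimately show ?case by simp
  qed
  have ad: "(\<lambda>q. y q \<oplus> z q) \<in> lspan G" if "z \<in> lspan G" "y \<in> lspan G" for y z
    using that
  proof induction
    case zero then show ?case using c by simp
  next
    case (add z g r)
    have "(\<lambda>q. (y q \<oplus> z q) \<oplus> r \<otimes> g q) \<in> lspan G"
      using add by (intro lspan.add) auto
    moreover have "(\<lambda>q. (y q \<oplus> z q) \<oplus> r \<otimes> g q) = (\<lambda>q. y q \<oplus> (z q \<oplus> r \<otimes> g q))"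
      using add c[OF add(1)] c[OF add.prems] assms(1)[OF add(2)] by (auto simp: a_assoc)
    ultimately show ?case by simp
  qed
  show ?thesis
    unfolding coord_submodule_def
    using lspan.zero c s ad sm by auto
qed

lemma lspan_incl:
  assumes "\<And>q. g q \<in> carrier R" "g \<in> G"
  shows "g \<in> lspan G"
  using lspan.add[OF lspan.zero assms(2) one_closed] assms(1) by simp

lemma maximal_ideal_exists:
  assumes "ideal I R" "\<one> \<notin> I"
  shows "\<exists>M. maximalideal M R \<and> I \<subseteq> M"
proof -
  define A where "A = {J. ideal J R \<and> I \<subseteq> J \<and> \<one> \<notin> J}"
  have "\<exists>M\<in>A. \<forall>J\<in>A. M \<subseteq> J \<longrightarrow> J = M"
  proof (rule subset_Zorn_nonempty)
    show "A \<noteq> {}" using assms unfolding A_def by auto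
    fix C assume C: "C \<noteq> {}" "subset.chain A C"
    then have CA: "C \<subseteq> A" and ch: "\<And>J K. J \<in> C \<Longrightarrow> K \<in> C \<Longrightarrow> J \<subseteq> K \<or> K \<subseteq> J"
      unfolding subset_chain_def by auto
    have id: "ideal J R" if "J \<in> C" for J using that CA unfolding A_def by auto
    have "ideal (\<Union>C) R"
    proof (rule ideal_by_closure)
      show "\<Union>C \<subseteq> carrier R"
        using id additive_subgroup.a_subset[OF ideal.axioms(1)] by blast
      obtain J where "J \<in> C" using C(1) by blast
      then show "\<zero> \<in> \<Union>C"
        using additive_subgroup.zero_closed[OF ideal.axioms(1)[OF id]] by blast
    next
      fix a b assume "a \<in> \<Union>C" "b \<in> \<Union>C"
      then obtain J where "J \<in> C" "a \<in> J" "b \<in> J" using ch by blast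
      then show "a \<oplus> b \<in> \<Union>C"
        using additive_subgroup.a_closed[OF ideal.axioms(1)[OF id]] by blast
    next
      fix a x assume "a \<in> \<Union>C" "x \<in> carrier R"
      then obtain J where J: "J \<in> C" "a \<in> J" by blast
      then show "x \<otimes> a \<in> \<Union>C"
        using ideal.I_l_closed[OF id[OF J(1)] J(2) \<open>x \<in> carrier R\<close>] by blast
    qed
    then show "\<Union>C \<in> A" using C(1) CA unfolding A_def by blast
  qed
  then obtain M where MA: "M \<in> A" and mx: "\<And>J. J \<in> A \<Longrightarrow> M \<subseteq> J \<Longrightarrow> J = M"
    by blast
  from MA have M: "ideal M R" "I \<subseteq> M" "\<one> \<notin> M" unfolding A_def by auto
  have "maximalideal M R"
  proof (rule maximalidealI[OF M(1)])
    show "carrier R \<noteq> M" using M(3) by auto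
    fix J assume J: "ideal J R" "M \<subseteq> J" "J \<subseteq> carrier R"
    show "J = M \<or> J = carrier R"
    proof (cases "\<one> \<in> J")
      case True then show ?thesis using ideal.one_imp_carrier[OF J(1)] by simp
    next
      case False then show ?thesis using mx J M unfolding A_def by blast
    qed
  qed
  then show ?thesis using M by blast
qed

text \<open>
  To show that an ideal is the whole ring it suffices to find a denominator in it at each prime.
\<close>

lemma ideal_local_global:
  assumes "ideal I R" "\<And>P. primeideal P R \<Longrightarrow> \<exists>u\<in>I. u \<notin> P"
  shows "\<one> \<in> I"
  using maximal_ideal_exists[OF assms(1)] assms(2) maximalideal_prime by blast

lemma arithmetical_valuative:
  assumes "arithmetical" "primeideal P R"
  shows "valuative P"
  unfolding valuative_def
proof (intro ballI)
  interpret primeideal P R by fact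
  fix a b assume ab: "a \<in> carrier R" "b \<in> carrier R"
  then obtain s t u v where *: "s \<in> carrier R" "t \<in> carrier R" "u \<in> carrier R" "v \<in> carrier R"
    "s \<oplus> t = \<one>" "s \<otimes> b = u \<otimes> a" "t \<otimes> a = v \<otimes> b"
    using assms(1)[unfolded arithmetical_def, rule_format, OF ab] by (elim bexE conjE) (rule that)
  have "\<one> \<notin> P" using I_notcarr one_imp_carrier by blast
  then have "s \<notin> P \<or> t \<notin> P" using *(5) a_closed by metis
  then show "\<exists>u\<in>carrier R - P. \<exists>c\<in>carrier R. u \<otimes> a = c \<otimes> b \<or> u \<otimes> b = c \<otimes> a"
    using * by blast
qed

text \<open>
  A finite family has a member that divides the others at \<open>P\<close>, with one common denominator.
\<close>

lemma valuative_divisor: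
  assumes P: "primeideal P R" "valuative P" and A: "finite A" "A \<noteq> {}" and y: "\<And>q. q \<in> A \<Longrightarrow> y q \<in> carrier R"
  shows "\<exists>i\<in>A. \<exists>u\<in>carrier R - P. \<forall>q\<in>A. \<exists>c\<in>carrier R. u \<otimes> y q = y i \<otimes> c"
  using A y
proof (induction A rule: finite_ne_induct)
  interpret primeideal P R by fact
  case (singleton x)
  have "\<one> \<notin> P" using I_notcarr one_imp_carrier by blast
  moreover have "\<one> \<otimes> y x = y x \<otimes> \<one>" using singleton by simp
  ultimately show ?case by blast
next
  case (insert x A)
  interpret primeideal P R by fact
  obtain i u where i: "i \<in> A" "u \<in> carrier R" "u \<notin> P"
    and iu: "\<And>q. q \<in> A \<Longrightarrow> \<exists>c\<in>carrier R. u \<otimes> y q = y i \<otimes> c"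
    using insert by blast
  have yc: "y i \<in> carrier R" "y x \<in> carrier R" "\<And>q. q \<in> A \<Longrightarrow> y q \<in> carrier R" using insert i by auto
  obtain v c where v: "v \<in> carrier R" "v \<notin> P" "c \<in> carrier R"
    and alt: "v \<otimes> y x = c \<otimes> y i \<or> v \<otimes> y i = c \<otimes> y x"
    using P(2) yc unfolding valuative_def by blast
  have uv: "u \<otimes> v \<in> carrier R - P" using primeideal_mult_iff[OF P(1)] i v by auto
  show ?case
    using alt
  proof
    assume e: "v \<otimes> y x = c \<otimes> y i"
    have "\<exists>c\<in>carrier R. (u \<otimes> v) \<otimes> y q = y i \<otimes> c" if "q \<in> insert x A" for q
    proof (cases "q = x")
      case True
      have "(u \<otimes> v) \<otimes> y x = u \<otimes> (v \<otimes> y x)" using i v yc by (simp add: m_assoc)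
      also have "\<dots> = y i \<otimes> (u \<otimes> c)" unfolding e using i v yc by algebra
      finally show ?thesis using True i v by blast
    next
      case False
      then have "q \<in> A" using that by simp
      then obtain c' where c': "c' \<in> carrier R" "u \<otimes> y q = y i \<otimes> c'" using iu by blast
      have "(u \<otimes> v) \<otimes> y q = v \<otimes> (u \<otimes> y q)" using i v yc that False by (simp add: m_assoc m_lcomm)
      also have "\<dots> = y i \<otimes> (v \<otimes> c')" unfolding c'(2) using i v yc c'(1) by algebra
      finally show ?thesis using c' v by blast
    qed
    then show ?thesis using i uv by blast
  next
    assume e: "v \<otimes> y i = c \<otimes> y x"
    have "\<exists>c\<in>carrier R. (u \<otimes> v) \<otimes> y q = y x \<otimes> c" if "q \<in> insert x A" for q
    proof (cases "q = x")
      case True then show ?thesis using i v yc by (metis m_closed m_comm)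
    next
      case False
      then have "q \<in> A" using that by simp
      then obtain c' where c': "c' \<in> carrier R" "u \<otimes> y q = y i \<otimes> c'" using iu by blast
      have "(u \<otimes> v) \<otimes> y q = v \<otimes> (u \<otimes> y q)" using i v yc that False by (simp add: m_assoc m_lcomm)
      also have "\<dots> = (v \<otimes> y i) \<otimes> c'" unfolding c'(2) using i v yc c'(1) by algebra
      also have "\<dots> = y x \<otimes> (c \<otimes> c')" unfolding e using i v yc c'(1) by algebra
      finally show ?thesis using c' v by blast
    qed
    then show ?thesis using uv by blast
  qed
qed

end

context domain
begin

text \<open>
  Divide a nonzero vector by a coordinate that divides the other coordinates at \<open>P\<close>; saturation
  keeps the quotient in \<open>L\<close>, and the coordinate itself has become the denominator \<open>u\<close>.
\<close>

lemma saturated_primitive_vector: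
  assumes P: "primeideal P R" "valuative P"
    and L: "coord_submodule Q L" "saturated L" "finite Q" "z \<in> L" "z q \<noteq> \<zero>"
  shows "\<exists>y\<in>L. \<exists>i. y i \<notin> P"
proof -
  interpret primeideal P R by fact
  note D = coord_submoduleD[OF L(1)]
  have qQ: "q \<in> Q" using D(3) L by blast
  obtain i u where i: "i \<in> Q" "u \<in> carrier R" "u \<notin> P"
    and "\<And>q. q \<in> Q \<Longrightarrow> \<exists>c\<in>carrier R. u \<otimes> z q = z i \<otimes> c"
    using valuative_divisor[OF P L(3), of z] qQ D(2)[OF L(4)] by blast
  then obtain c where c: "\<And>q. q \<in> Q \<Longrightarrow> c q \<in> carrier R \<and> u \<otimes> z q = z i \<otimes> c q" by metis
  define y where "y = (\<lambda>q. if q \<in> Q then c q else \<zero>)"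
  have u0: "u \<noteq> \<zero>" using i(3) additive_subgroup.zero_closed[OF additive_subgroup_axioms] by metis
  have zc: "z q \<in> carrier R" for q using D(2)[OF L(4)] .
  have zi: "z i \<noteq> \<zero>"
  proof
    assume "z i = \<zero>"
    then have "u \<otimes> z q = \<zero>" using c[OF qQ] by auto
    then show False using u0 L(5) i zc integral by blast
  qed
  have yc: "y q \<in> carrier R" for q unfolding y_def using c by auto
  have "(\<lambda>q. z i \<otimes> y q) = (\<lambda>q. u \<otimes> z q)"
    unfolding y_def using c D(3)[OF L(4)] i zc by (auto simp: fun_eq_iff)
  then have "(\<lambda>q. z i \<otimes> y q) \<in> L" using coord_submodule_smult[OF L(1,4) i(2)] by simp
  then have "y \<in> L" using saturatedD[OF L(2), of y "z i"] yc zc zi by blast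
  moreover have "y i = u"
    using c[OF i(1)] i zc zi unfolding y_def by (metis m_comm m_lcancel)
  ultimately show ?thesis using i by blast
qed

lemma zero_ideal: "ideal {\<zero>} R"
  using zeroprimeideal primeideal.axioms(1) by blast

lemma coord_submodule_coordinate_kernel:
  assumes "coord_submodule Q L" "ideal P R"
  shows "coord_submodule Q {y\<in>L. y q \<in> P}"
  by (rule coord_submodule_kernel[OF assms(1) linear_on_coordinate[OF assms(1)] assms(2)])

text \<open>
  A vector whose coordinate \<open>q\<close> lies in \<open>P\<close> can be corrected by \<open>y\<close> to make that coordinate zero,
  which changes it only by a factor outside \<open>P\<close> and by a vector in \<open>P\<close>.
\<close>

lemma leads_coordinate_kernel:
  fixes L :: "('q::linorder \<Rightarrow> 'a) set"
  assumes P: "primeideal P R" and L: "coord_submodule Q L" and y: "y \<in> L" "y q \<notin> P"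
  shows "leads P {z\<in>L. z q \<in> P} = leads P {z\<in>L. z q \<in> {\<zero>}}"
proof (intro equalityI subsetI)
  interpret primeideal P R by fact
  note D = coord_submoduleD[OF L]
  have z0: "\<zero> \<in> P" using additive_subgroup.zero_closed[OF additive_subgroup_axioms] .
  {
    fix p assume "p \<in> leads P {z\<in>L. z q \<in> P}"
    then obtain z where z: "z \<in> L" "z q \<in> P" "z p \<notin> P" "\<And>q'. q' > p \<Longrightarrow> z q' \<in> P"
      unfolding leads_def by auto
    define w where "w = (\<lambda>p. y q \<otimes> z p \<oplus> (\<ominus> z q) \<otimes> y p)"
    have "w \<in> L" unfolding w_def using D(2)[OF y(1)] D(2)[OF z(1)] y z by (intro D(4)) auto
    moreover have "w q = \<zero>" unfolding w_def using D(2)[OF y(1)] D(2)[OF z(1)] by (simp add: cross_cancel)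
    moreover have k: "w p \<in> P \<longleftrightarrow> z p \<in> P" for p
    proof -
      have "(\<ominus> z q) \<otimes> y p \<in> P" using z(2) D(2)[OF y(1)] by (intro I_r_closed a_inv_closed) auto
      then show ?thesis unfolding w_def
        using ideal_add_iff(1)[OF is_ideal] D(2)[OF y(1)] D(2)[OF z(1)] y(2) primeideal_mult_iff[OF P]
        by auto
    qed
    ultimately show "p \<in> leads P {z\<in>L. z q \<in> {\<zero>}}"
      using z unfolding leads_def by auto
  next
    fix p assume "p \<in> leads P {z\<in>L. z q \<in> {\<zero>}}"
    then show "p \<in> leads P {z\<in>L. z q \<in> P}" using z0 unfolding leads_def by auto
  }
qed

lemma card_leads_drop_coordinate:
  fixes L :: "('q::linorder \<Rightarrow> 'a) set"
  assumes "primeideal P R" "coord_submodule Q L" "finite Q" "y \<in> L" "y q \<notin> P"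
  shows "card (leads P L) = Suc (card (leads P {y\<in>L. y q \<in> {\<zero>}}))"
  using card_leads_coordinate[OF assms] leads_coordinate_kernel[OF assms(1,2,4,5)] by simp

text \<open>
  Over a valuation ring a saturated submodule is a direct summand, so it keeps its rank modulo
  \<open>P\<close>. Here this is seen by elimination: a primitive vector provides a coordinate \<open>q\<close> that does
  not vanish modulo \<open>P\<close>, and passing to the vectors with \<open>q\<close>-th coordinate zero lowers both ranks.
\<close>

lemma card_leads_saturated:
  fixes L :: "('q::linorder \<Rightarrow> 'a) set"
  assumes P: "primeideal P R" "valuative P" and "finite Q" "coord_submodule Q L" "saturated L"
  shows "card (leads P L) = card (leads {\<zero>} L)"
  using assms(4,5)
proof (induction "card (leads {\<zero>} L)" arbitrary: L)
  case 0
  interpret primeideal P R by fact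
  have "leads {\<zero>} L = {}"
    using 0 leads_subset[OF 0(2) zero_ideal] assms(3) by (metis card_0_eq finite_subset)
  then have "y q = \<zero>" if "y \<in> L" for y q
    using leads_empty[OF 0(2) zero_ideal assms(3)] that by blast
  moreover have "\<zero> \<in> P" using additive_subgroup.zero_closed[OF additive_subgroup_axioms] .
  ultimately have "leads P L = {}" unfolding leads_def by fastforce
  then show ?case using 0 by simp
next
  case (Suc k)
  then obtain q0 where "q0 \<in> leads {\<zero>} L" by fastforce
  then obtain z where "z \<in> L" "z q0 \<noteq> \<zero>" unfolding leads_def by auto
  then obtain y q where y: "y \<in> L" "y q \<notin> P"
    using saturated_primitive_vector[OF P Suc.prems assms(3)] by blast
  interpret primeideal P R by fact
  have y0: "y q \<notin> {\<zero>}" using y additive_subgroup.zero_closed[OF additive_subgroup_axioms] by auto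
  let ?L = "{y\<in>L. y q \<in> {\<zero>}}"
  have 1: "card (leads P L) = Suc (card (leads P ?L))"
    by (rule card_leads_drop_coordinate[OF P(1) Suc.prems(1) assms(3) y])
  have 2: "card (leads {\<zero>} L) = Suc (card (leads {\<zero>} ?L))"
    by (rule card_leads_drop_coordinate[OF zeroprimeideal Suc.prems(1) assms(3) y(1) y0])
  have "card (leads P ?L) = card (leads {\<zero>} ?L)"
    using Suc.hyps(1)[OF _ coord_submodule_coordinate_kernel[OF Suc.prems(1) zero_ideal, of q]
        saturated_kernel[OF domain_axioms Suc.prems(2)]] Suc.hyps(2) 2 by simp
  then show ?case using 1 2 by simp
qed

text \<open>
  Nakayama's lemma in the form needed here: a submodule \<open>T\<close> that has all the leading positions of
  \<open>L\<close> modulo \<open>P\<close> agrees with \<open>L\<close> at \<open>P\<close>. A vector \<open>t\<close> of \<open>T\<close> with a coordinate outside \<open>P\<close> clears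
  that coordinate in \<open>L\<close> and in \<open>T\<close> alike, and the ranks modulo \<open>P\<close> stay equal.
\<close>

lemma local_nakayama:
  fixes L :: "('q::linorder \<Rightarrow> 'a) set"
  assumes P: "primeideal P R" "valuative P" and Q: "finite Q"
    and "coord_submodule Q L" "saturated L" "coord_submodule Q T" "T \<subseteq> L" "leads P L \<subseteq> leads P T"
    and "y \<in> L"
  shows "\<exists>u\<in>carrier R - P. (\<lambda>q. u \<otimes> y q) \<in> T"
  using assms(4-9)
proof (induction "card (leads P L)" arbitrary: L T y)
  case 0
  interpret primeideal P R by fact
  have "card (leads {\<zero>} L) = 0" using 0(1) card_leads_saturated[OF P Q 0(2,3)] by simp
  then have "leads {\<zero>} L = {}"
    using leads_subset[OF 0(2) zero_ideal] Q by (metis card_0_eq finite_subset)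
  then have y0: "y q = \<zero>" for q
    using leads_empty[OF 0(2) zero_ideal Q _ 0(7)] by blast
  have "\<one> \<notin> P" using I_notcarr one_imp_carrier by blast
  moreover have "(\<lambda>q. \<one> \<otimes> y q) \<in> T" using coord_submoduleD(1)[OF 0(4)] y0 by simp
  ultimately show ?case by blast
next
  case (Suc k)
  interpret primeideal P R by fact
  obtain q0 where "q0 \<in> leads P L" using Suc by fastforce
  then obtain t where t: "t \<in> T" "t q0 \<notin> P" using Suc.prems(5) unfolding leads_def by auto
  define q where "q = q0"
  let ?L = "{y\<in>L. y q \<in> {\<zero>}}" and ?T = "{y\<in>T. y q \<in> {\<zero>}}"
  have tL: "t \<in> L" using t Suc.prems by auto
  have 1: "card (leads P L) = Suc (card (leads P ?L))"
    by (rule card_leads_drop_coordinate[OF P(1) Suc.prems(1) Q tL]) (use t q_def in auto)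
  have 2: "card (leads P T) = Suc (card (leads P ?T))"
    by (rule card_leads_drop_coordinate[OF P(1) Suc.prems(3) Q t(1)]) (use t q_def in auto)
  have cL: "coord_submodule Q ?L" and cT: "coord_submodule Q ?T"
    by (rule coord_submodule_coordinate_kernel[OF _ zero_ideal], rule Suc.prems)+
  have "leads P L = leads P T" using leads_mono[OF Suc.prems(4)] Suc.prems(5) by blast
  then have "card (leads P ?L) = card (leads P ?T)" using 1 2 by simp
  moreover have "leads P ?T \<subseteq> leads P ?L" using Suc.prems(4) by (intro leads_mono) auto
  moreover have "finite (leads P ?L)"
    using leads_subset[OF cL is_ideal] Q finite_subset by blast
  ultimately have eq: "leads P ?L \<subseteq> leads P ?T"
    using card_subset_eq[of "leads P ?L" "leads P ?T"] by simp
  note DL = coord_submoduleD[OF Suc.prems(1)]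
  define w where "w = (\<lambda>p. t q \<otimes> y p \<oplus> (\<ominus> y q) \<otimes> t p)"
  have tc: "t p \<in> carrier R" and yc: "y p \<in> carrier R" for p using DL(2) tL Suc.prems(6) by auto
  have "w \<in> L"
    unfolding w_def using tc yc tL Suc.prems(6) by (intro DL(4)) auto
  moreover have "w q = \<zero>" unfolding w_def using tc yc by (simp add: cross_cancel)
  ultimately have "w \<in> ?L" by simp
  moreover have "?T \<subseteq> ?L" using Suc.prems(4) by auto
  ultimately obtain u where u: "u \<in> carrier R - P" "(\<lambda>p. u \<otimes> w p) \<in> ?T"
    using Suc.hyps(1)[OF _ cL saturated_kernel[OF domain_axioms Suc.prems(2)] cT _ eq, of w]
      Suc.hyps(2) 1 by auto
  have "(\<lambda>p. \<one> \<otimes> (u \<otimes> w p) \<oplus> (u \<otimes> y q) \<otimes> t p) \<in> T"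
    using u t yc by (intro coord_submoduleD(4)[OF Suc.prems(3)]) auto
  moreover have "\<one> \<otimes> (u \<otimes> w p) \<oplus> (u \<otimes> y q) \<otimes> t p = (u \<otimes> t q) \<otimes> y p" for p
  proof -
    have "u \<in> carrier R" using u by simp
    then show ?thesis unfolding w_def using tc[of p] yc[of p] yc[of q] tc[of q] by algebra
  qed
  ultimately have "(\<lambda>p. (u \<otimes> t q) \<otimes> y p) \<in> T" by simp
  moreover have "u \<otimes> t q \<in> carrier R - P"
    using u t tc primeideal_mult_iff[OF P(1)] q_def by auto
  ultimately show ?case by blast
qed

text \<open>
  The elimination of \<open>card_leads_saturated\<close>, with the vectors used for it collected as generators.
  One denominator serves all \<open>y\<close>, which is what makes the passage to the global statement work.
\<close>

lemma local_finitely_generated: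
  fixes L :: "('q::linorder \<Rightarrow> 'a) set"
  assumes P: "primeideal P R" "valuative P" and Q: "finite Q"
    and "coord_submodule Q L" "saturated L"
  shows "\<exists>u\<in>carrier R - P. \<exists>G. finite G \<and> G \<subseteq> L \<and> (\<forall>y\<in>L. (\<lambda>q. u \<otimes> y q) \<in> lspan G)"
  using assms(4-5)
proof (induction "card (leads {\<zero>} L)" arbitrary: L)
  case 0
  interpret primeideal P R by fact
  have "leads {\<zero>} L = {}"
    using 0 leads_subset[OF 0(2) zero_ideal] Q by (metis card_0_eq finite_subset)
  then have y0: "y q = \<zero>" if "y \<in> L" for y q
    using leads_empty[OF 0(2) zero_ideal Q] that by blast
  have "\<one> \<notin> P" using I_notcarr one_imp_carrier by blast
  moreover have "(\<lambda>q. \<one> \<otimes> y q) \<in> lspan {}" if "y \<in> L" for y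
    using y0[OF that] lspan.zero by simp
  ultimately show ?case by (intro bexI[of _ \<one>] exI[of _ "{}"]) auto
next
  case (Suc k)
  then obtain q0 where "q0 \<in> leads {\<zero>} L" by fastforce
  then obtain z where "z \<in> L" "z q0 \<noteq> \<zero>" unfolding leads_def by auto
  then obtain y q where y: "y \<in> L" "y q \<notin> P"
    using saturated_primitive_vector[OF P Suc.prems Q] by blast
  interpret primeideal P R by fact
  have y0: "y q \<notin> {\<zero>}" using y additive_subgroup.zero_closed[OF additive_subgroup_axioms] by auto
  let ?L = "{y\<in>L. y q \<in> {\<zero>}}"
  note DL = coord_submoduleD[OF Suc.prems(1)]
  have 2: "card (leads {\<zero>} L) = Suc (card (leads {\<zero>} ?L))"
    by (rule card_leads_drop_coordinate[OF zeroprimeideal Suc.prems(1) Q y(1) y0])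
  then obtain u G where u: "u \<in> carrier R - P" and G: "finite G" "G \<subseteq> ?L"
    and uG: "\<And>z. z \<in> ?L \<Longrightarrow> (\<lambda>q. u \<otimes> z q) \<in> lspan G"
    using Suc.hyps(1)[OF _ coord_submodule_coordinate_kernel[OF Suc.prems(1) zero_ideal, of q]
        saturated_kernel[OF domain_axioms Suc.prems(2)]] Suc.hyps(2) by auto
  have yc: "y p \<in> carrier R" for p using DL(2) y by auto
  have "(\<lambda>p. (u \<otimes> y q) \<otimes> z p) \<in> lspan (insert y G)" if z: "z \<in> L" for z
  proof -
    have zc: "z p \<in> carrier R" for p using DL(2) z by auto
    define w where "w = (\<lambda>p. y q \<otimes> z p \<oplus> (\<ominus> z q) \<otimes> y p)"
    have "w \<in> L"
      unfolding w_def using zc yc y z by (intro DL(4)) auto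
    moreover have "w q = \<zero>" unfolding w_def using zc yc by (simp add: cross_cancel)
    ultimately have "w \<in> ?L" by simp
    then have "(\<lambda>p. u \<otimes> w p) \<in> lspan (insert y G)" using uG lspan_mono[of G "insert y G"] by auto
    then have "(\<lambda>p. u \<otimes> w p \<oplus> (u \<otimes> z q) \<otimes> y p) \<in> lspan (insert y G)"
      using u zc by (intro lspan.add) auto
    moreover have "u \<otimes> w p \<oplus> (u \<otimes> z q) \<otimes> y p = (u \<otimes> y q) \<otimes> z p" for p
    proof -
      have "u \<in> carrier R" using u by simp
      then show ?thesis unfolding w_def using zc[of p] yc[of p] yc[of q] zc[of q] by algebra
    qed
    ultimately show ?thesis by simp
  qed
  moreover have "u \<otimes> y q \<in> carrier R - P"
    using u y yc primeideal_mult_iff[OF P(1)] by auto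
  moreover have "finite (insert y G)" "insert y G \<subseteq> L" using G y by auto
  ultimately show ?case by blast
qed

text \<open>
  The multipliers that move \<open>y \<in> L\<close> into \<open>T\<close> form an ideal; by \<open>local_nakayama\<close> no prime ideal
  contains it.
\<close>

lemma saturated_eqI:
  fixes L :: "('q::linorder \<Rightarrow> 'a) set"
  assumes ar: "arithmetical" and Q: "finite Q"
    and L: "coord_submodule Q L" "saturated L" and T: "coord_submodule Q T" "T \<subseteq> L"
    and le: "\<And>P. primeideal P R \<Longrightarrow> leads P L \<subseteq> leads P T"
  shows "T = L"
proof (intro equalityI T(2) subsetI)
  fix y assume y: "y \<in> L"
  note DT = coord_submoduleD[OF T(1)] and DL = coord_submoduleD[OF L(1)]
  define I where "I = {r\<in>carrier R. (\<lambda>q. r \<otimes> y q) \<in> T}"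
  have yc: "y q \<in> carrier R" for q using DL(2) y by auto
  have "ideal I R"
  proof (rule ideal_by_closure)
    show "I \<subseteq> carrier R" unfolding I_def by auto
    show "\<zero> \<in> I" unfolding I_def using DT(1) yc by simp
    show "a \<oplus> b \<in> I" if "a \<in> I" "b \<in> I" for a b
      using that coord_submodule_add[OF T(1)] yc unfolding I_def by (auto simp: l_distr)
    show "x \<otimes> a \<in> I" if "a \<in> I" "x \<in> carrier R" for a x
      using that coord_submodule_smult[OF T(1), of _ x] yc unfolding I_def by (auto simp: m_assoc)
  qed
  moreover have "\<exists>u\<in>I. u \<notin> P" if P: "primeideal P R" for P
    using local_nakayama[OF P arithmetical_valuative[OF ar P] Q L T le[OF P] y] unfolding I_def by auto
  ultimately have "\<one> \<in> I" using ideal_local_global by blast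
  then show "y \<in> T" unfolding I_def using yc by auto
qed

text \<open>
  The multipliers that move \<open>L\<close> into the span of finitely many of its elements form an ideal: the
  sum of two of them is served by the union of the two generating sets.
\<close>

lemma saturated_finitely_generated:
  fixes L :: "('q::linorder \<Rightarrow> 'a) set"
  assumes ar: "arithmetical" and Q: "finite Q"
    and L: "coord_submodule Q L" "saturated L"
  shows "\<exists>G. finite G \<and> G \<subseteq> L \<and> L = lspan G"
proof -
  note DL = coord_submoduleD[OF L(1)]
  define I where "I = {r\<in>carrier R. \<exists>G. finite G \<and> G \<subseteq> L \<and> (\<forall>y\<in>L. (\<lambda>q. r \<otimes> y q) \<in> lspan G)}"
  have yc: "y q \<in> carrier R" if "y \<in> L" for y q using DL(2) that by auto
  have cs: "coord_submodule Q (lspan G)" if "G \<subseteq> L" for G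
    using that DL(2,3) by (intro lspan_coord_submodule) auto
  have mul: "x \<otimes> a \<in> I" if a: "a \<in> I" and x: "x \<in> carrier R" for a x
  proof -
    obtain G where G: "finite G" "G \<subseteq> L" "\<forall>y\<in>L. (\<lambda>q. a \<otimes> y q) \<in> lspan G" "a \<in> carrier R"
      using a unfolding I_def by blast
    have "(\<lambda>q. (x \<otimes> a) \<otimes> y q) \<in> lspan G" if "y \<in> L" for y
      using coord_submodule_smult[OF cs[OF G(2)] _ x, of "\<lambda>q. a \<otimes> y q"] G that x yc
      by (auto simp: m_assoc)
    then show ?thesis unfolding I_def using G x by blast
  qed
  have "ideal I R"
  proof (rule ideal_by_closure[OF _ _ _ mul])
    show "I \<subseteq> carrier R" unfolding I_def by auto
    show "\<zero> \<in> I" unfolding I_def using lspan.zero yc by (auto intro!: exI[of _ "{}"])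
  next
    fix a b assume a: "a \<in> I" and b: "b \<in> I"
    obtain G where G: "finite G" "G \<subseteq> L" "\<forall>y\<in>L. (\<lambda>q. a \<otimes> y q) \<in> lspan G" "a \<in> carrier R"
      using a unfolding I_def by blast
    obtain H where H: "finite H" "H \<subseteq> L" "\<forall>y\<in>L. (\<lambda>q. b \<otimes> y q) \<in> lspan H" "b \<in> carrier R"
      using b unfolding I_def by blast
    have "(\<lambda>q. (a \<oplus> b) \<otimes> y q) \<in> lspan (G \<union> H)" if "y \<in> L" for y
    proof -
      have "(\<lambda>q. a \<otimes> y q) \<in> lspan (G \<union> H)" "(\<lambda>q. b \<otimes> y q) \<in> lspan (G \<union> H)"
        using G H that lspan_mono[of G "G \<union> H"] lspan_mono[of H "G \<union> H"] by auto
      then have "(\<lambda>q. a \<otimes> y q \<oplus> b \<otimes> y q) \<in> lspan (G \<union> H)"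
        using coord_submodule_add[OF cs[of "G \<union> H"]] G(2) H(2) by simp
      then show ?thesis using G H yc[OF that] by (simp add: l_distr)
    qed
    then show "a \<oplus> b \<in> I" unfolding I_def using G H by (auto intro!: exI[of _ "G \<union> H"])
  qed
  moreover have "\<exists>u\<in>I. u \<notin> P" if P: "primeideal P R" for P
    using local_finitely_generated[OF P arithmetical_valuative[OF ar P] Q L] unfolding I_def by auto
  ultimately have "\<one> \<in> I" using ideal_local_global by blast
  then obtain G where G: "finite G" "G \<subseteq> L" "\<forall>y\<in>L. (\<lambda>q. \<one> \<otimes> y q) \<in> lspan G"
    unfolding I_def by blast
  then have "L \<subseteq> lspan G" using yc by auto
  then show ?thesis using G lspan_least[OF L(1) G(2)] by blast
qed

end

section \<open>Compactness for monomial submodules\<close>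

definition monoms :: "nat \<Rightarrow> nat \<Rightarrow> nat multiset set" where
  "monoms N s = {a. set_mset a \<subseteq> {..N} \<and> size a = s}"

text \<open>
  A pair \<open>(j, a)\<close> stands for the monomial \<open>x\<^sup>a\<close> in coordinate \<open>j\<close> of a free module over a
  polynomial ring in \<open>x\<^sub>0, \<dots>, x\<^sub>N\<close>. One set will hold the leading monomials of an ideal in
  coordinate \<open>0\<close> and those of a module of syzygies in the coordinates \<open>1, \<dots>, n\<close>.
\<close>

definition monomial_submodule :: "nat \<Rightarrow> nat \<Rightarrow> (nat \<times> nat multiset) set \<Rightarrow> bool" where
  "monomial_submodule N n Z \<longleftrightarrow> (\<forall>j a. (j, a) \<in> Z \<longrightarrow>
     j \<le> n \<and> set_mset a \<subseteq> {..N} \<and> (\<forall>i\<le>N. (j, add_mset i a) \<in> Z))"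

text \<open>
  For \<open>(j, b)\<close> in a monomial submodule \<open>Z\<close>: it is not a minimal generator of \<open>Z\<close>.
\<close>

definition decomposable :: "(nat \<times> nat multiset) set \<Rightarrow> nat \<Rightarrow> nat multiset \<Rightarrow> bool" where
  "decomposable Z j b \<longleftrightarrow> (\<exists>i\<in>#b. (j, b - {#i#}) \<in> Z)"

definition layer :: "(nat \<times> nat multiset) set \<Rightarrow> nat set \<Rightarrow> nat \<Rightarrow> (nat \<times> nat multiset) set" where
  "layer Z J s = {(j, a) \<in> Z. j \<in> J \<and> size a = s}"

text \<open>
  What Buchberger's criterion says about the leading monomials of an ideal generated in degrees at
  most \<open>d\<close>. S-polynomials of elements of degree \<open>D\<close> have degree at most \<open>2 * D\<close>, so if no new
  leading monomial shows up between \<open>D\<close> and \<open>2 * D\<close>, none shows up later.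
\<close>

definition gap_property :: "nat \<Rightarrow> (nat \<times> nat multiset) set \<Rightarrow> bool" where
  "gap_property d Z \<longleftrightarrow> (\<forall>D\<ge>d.
     (\<forall>b. (0, b) \<in> Z \<longrightarrow> D < size b \<longrightarrow> size b \<le> 2 * D \<longrightarrow> decomposable Z 0 b) \<longrightarrow>
     (\<forall>b. (0, b) \<in> Z \<longrightarrow> D < size b \<longrightarrow> decomposable Z 0 b))"

lemma finite_monoms: "finite (monoms N s)"
proof -
  have "monoms N s \<subseteq> mset ` {xs. set xs \<subseteq> {..N} \<and> length xs = s}"
  proof
    fix a assume a: "a \<in> monoms N s"
    obtain xs where xs: "mset xs = a" using ex_mset by blast
    have "set xs \<subseteq> {..N}" "length xs = s"
      using a unfolding monoms_def xs[symmetric] by auto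
    then show "a \<in> mset ` {xs. set xs \<subseteq> {..N} \<and> length xs = s}" using xs by blast
  qed
  moreover have "finite {xs. set xs \<subseteq> {..N} \<and> length xs = s}"
    by (rule finite_lists_length_eq) simp
  ultimately show ?thesis by (rule finite_subset[OF _ finite_imageI])
qed

lemma nat_incseq_subseq:
  fixes s :: "nat \<Rightarrow> nat"
  shows "\<exists>r. strict_mono (r :: nat \<Rightarrow> nat) \<and> (\<forall>i j. i \<le> j \<longrightarrow> s (r i) \<le> s (r j))"
proof -
  obtain f where f: "strict_mono (f :: nat \<Rightarrow> nat)" "monoseq (\<lambda>n. s (f n))"
    using seq_monosub by blast
  show ?thesis
  proof (cases "\<forall>m n. m \<le> n \<longrightarrow> s (f m) \<le> s (f n)")
    case True then show ?thesis using f by blast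
  next
    case False
    then have dec: "\<And>m n. m \<le> n \<Longrightarrow> s (f n) \<le> s (f m)" using f(2) unfolding monoseq_def by blast
    obtain k where k: "\<And>n. s (f k) \<le> s (f n)"
      using ex_has_least_nat[of "\<lambda>_. True" 0 "\<lambda>n. s (f n)"] by auto
    have "s (f (k + i)) = s (f k)" for i using k[of "k + i"] dec[of k "k + i"] by simp
    moreover have "strict_mono (\<lambda>i. f (k + i))" using f(1) unfolding strict_mono_def by auto
    ultimately show ?thesis by (intro exI[of _ "\<lambda>i. f (k + i)"]) auto
  qed
qed

lemma multiset_count_subseq:
  fixes b :: "nat \<Rightarrow> 'v multiset"
  assumes "finite V"
  shows "\<exists>r. strict_mono (r :: nat \<Rightarrow> nat) \<and>
    (\<forall>v\<in>V. \<forall>i j. i \<le> j \<longrightarrow> count (b (r i)) v \<le> count (b (r j)) v)"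
  using assms
proof induction
  case empty
  show ?case by (rule exI[of _ id]) (simp add: strict_mono_def)
next
  case (insert v V)
  then obtain r :: "nat \<Rightarrow> nat" where r: "strict_mono r"
    "\<And>w i j. w \<in> V \<Longrightarrow> i \<le> j \<Longrightarrow> count (b (r i)) w \<le> count (b (r j)) w" by blast
  obtain t :: "nat \<Rightarrow> nat" where "strict_mono t \<and>
      (\<forall>i j. i \<le> j \<longrightarrow> count (b (r (t i))) v \<le> count (b (r (t j))) v)"
    using nat_incseq_subseq[of "\<lambda>k. count (b (r k)) v"] by (elim exE) (rule that)
  then have t: "strict_mono t" "\<And>i j. i \<le> j \<Longrightarrow> count (b (r (t i))) v \<le> count (b (r (t j))) v"
    by simp_all
  have "strict_mono (r \<circ> t)" using r(1) t(1) by (rule strict_mono_o)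
  moreover have "\<And>i j. i \<le> j \<Longrightarrow> t i \<le> t j" using t(1) strict_mono_less_eq by blast
  ultimately have "\<forall>w\<in>insert v V. \<forall>i j. i \<le> j \<longrightarrow> count (b ((r \<circ> t) i)) w \<le> count (b ((r \<circ> t) j)) w"
    using r(2) t(2) by simp
  then show ?case using \<open>strict_mono (r \<circ> t)\<close> by blast
qed

lemma dickson:
  fixes b :: "nat \<Rightarrow> 'v multiset"
  assumes "finite V" "\<And>k. set_mset (b k) \<subseteq> V"
  shows "\<exists>i j. i < j \<and> b i \<subseteq># b j"
proof -
  obtain r :: "nat \<Rightarrow> nat" where r: "strict_mono r"
    "\<And>v i j. v \<in> V \<Longrightarrow> i \<le> j \<Longrightarrow> count (b (r i)) v \<le> count (b (r j)) v"
    using multiset_count_subseq[OF assms(1), of b] by blast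
  have "b (r 0) \<subseteq># b (r 1)"
  proof (rule mset_subset_eqI)
    fix v show "count (b (r 0)) v \<le> count (b (r 1)) v"
    proof (cases "v \<in> V")
      case True then show ?thesis using r(2)[of v 0 1] by simp
    next
      case False
      then have "count (b (r 0)) v = 0" using assms(2)[of "r 0"] by (meson not_in_iff subsetD)
      then show ?thesis by simp
    qed
  qed
  moreover have "r 0 < r 1" using r(1) by (simp add: strict_mono_def)
  ultimately show ?thesis by blast
qed

lemma monomial_submodule_add:
  assumes "monomial_submodule N n Z" "(j, a) \<in> Z" "set_mset c \<subseteq> {..N}"
  shows "(j, a + c) \<in> Z"
  using assms(3)
proof (induction c)
  case empty then show ?case using assms by simp
next
  case (add i c)
  then have "(j, add_mset i (a + c)) \<in> Z" using assms(1) unfolding monomial_submodule_def by auto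
  then show ?case by simp
qed

text \<open>
  Otherwise some coordinate has minimal generators of arbitrarily large degree; by Dickson's lemma
  one of them divides a later one.
\<close>

lemma monomial_submodule_finite_type:
  assumes Z: "monomial_submodule N n Z"
  shows "\<exists>D. \<forall>j b. (j, b) \<in> Z \<longrightarrow> D < size b \<longrightarrow> decomposable Z j b"
proof -
  have "\<exists>D. \<forall>b. (j, b) \<in> Z \<longrightarrow> D < size b \<longrightarrow> decomposable Z j b" for j
  proof (rule ccontr)
    assume "\<not> ?thesis"
    then have "\<forall>D. \<exists>b. (j, b) \<in> Z \<and> D < size b \<and> \<not> decomposable Z j b" by blast
    then obtain B where B: "\<And>D. (j, B D) \<in> Z" "\<And>D. D < size (B D)" "\<And>D. \<not> decomposable Z j (B D)"
      by metis
    define b where "b = rec_nat (B 0) (\<lambda>_ x. B (size x))"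
    have bS: "b (Suc k) = B (size (b k))" for k unfolding b_def by simp
    have bB: "\<exists>D. b k = B D" for k by (cases k) (auto simp: b_def)
    have inc: "size (b i) < size (b j)" if "i < j" for i j
      using that B(2) by (induction rule: strict_inc_induct) (metis bS less_trans)+
    have bZ: "(j, b k) \<in> Z" and bN: "\<not> decomposable Z j (b k)" for k using bB B by metis+
    have sub: "set_mset (b k) \<subseteq> {..N}" for k using bZ Z unfolding monomial_submodule_def by blast
    obtain i k where ik: "i < k" "b i \<subseteq># b k" using dickson[OF _ sub] by blast
    define c where "c = b k - b i"
    have bk: "b k = b i + c" using ik(2) unfolding c_def by simp
    then have "c \<noteq> {#}" using inc[OF ik(1)] by auto
    then obtain v c' where c: "c = add_mset v c'" by (metis multiset_cases)
    have "set_mset c' \<subseteq> {..N}" using sub[of k] bk c by auto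
    then have "(j, b i + c') \<in> Z" using monomial_submodule_add[OF Z bZ] by blast
    then have "decomposable Z j (b k)" unfolding decomposable_def bk c by auto
    then show False using bN by blast
  qed
  then obtain D where D: "\<And>j b. (j, b) \<in> Z \<Longrightarrow> D j < size b \<Longrightarrow> decomposable Z j b" by metis
  have "decomposable Z j b" if "(j, b) \<in> Z" "Max (D ` {..n}) < size b" for j b
  proof -
    have "j \<le> n" using that(1) Z unfolding monomial_submodule_def by blast
    then have "D j \<le> Max (D ` {..n})" by auto
    then have "D j < size b" using that by linarith
    then show ?thesis by (rule D[OF that(1)])
  qed
  then show ?thesis by blast
qed

text \<open>
  The space of subsets of a countable set is sequentially compact.
\<close>

lemma convergent_subsequence:
  fixes Z :: "nat \<Rightarrow> 'i set" and e :: "nat \<Rightarrow> 'i"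
  assumes "range e = UNIV"
  shows "\<exists>r L. strict_mono (r :: nat \<Rightarrow> nat) \<and> (\<forall>x. \<exists>k0. \<forall>k\<ge>k0. x \<in> Z (r k) \<longleftrightarrow> x \<in> L)"
proof -
  define P where "P n s \<longleftrightarrow> (\<exists>t. \<forall>k. (e n \<in> Z (s k)) = t)" for n and s :: "nat \<Rightarrow> nat"
  interpret subseqs P
  proof
    fix n and s :: "nat \<Rightarrow> nat"
    have "infinite {k. e n \<in> Z (s k)} \<or> infinite {k. e n \<notin> Z (s k)}"
    proof -
      have "{k. e n \<in> Z (s k)} \<union> {k. e n \<notin> Z (s k)} = UNIV" by auto
      then show ?thesis by (metis finite_Un infinite_UNIV_nat)
    qed
    then obtain A t where A: "infinite (A :: nat set)" "\<And>k. k \<in> A \<Longrightarrow> (e n \<in> Z (s k)) = t" by blast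
    have "strict_mono (enumerate A)" using A(1) by (rule strict_mono_enumerate)
    moreover have "enumerate A k \<in> A" for k using A(1) by (rule enumerate_in_set)
    ultimately show "\<exists>r'. strict_mono r' \<and> P n (s \<circ> r')" unfolding P_def using A(2) by auto
  qed
  define L where "L = {x. \<exists>k0. \<forall>k\<ge>k0. x \<in> Z (diagseq k)}"
  have "\<exists>k0. \<forall>k\<ge>k0. x \<in> Z (diagseq k) \<longleftrightarrow> x \<in> L" for x
  proof -
    obtain n where n: "x = e n" using assms by blast
    have "P n (diagseq \<circ> (+) (Suc n))" by (rule diagseq_holds) (auto simp: P_def)
    then obtain t where t: "\<And>k. (x \<in> Z (diagseq (Suc n + k))) = t" unfolding P_def n by auto
    then have t: "(x \<in> Z (diagseq k)) = t" if "k \<ge> Suc n" for k using that t[of "k - Suc n"] by simp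
    have "x \<in> L \<longleftrightarrow> t"
    proof
      assume "x \<in> L"
      then obtain k0 where "\<forall>k\<ge>k0. x \<in> Z (diagseq k)" unfolding L_def by blast
      then show t using t[of "max k0 (Suc n)"] by simp
    next
      assume t then show "x \<in> L" unfolding L_def using t by blast
    qed
    then show ?thesis using t by blast
  qed
  then show ?thesis using subseq_diagseq by blast
qed

text \<open>
  From degree \<open>D\<close> on, a monomial submodule without generators above \<open>D\<close> is determined by its layer
  of degree \<open>D\<close>.
\<close>

lemma generated_layers_subset:
  assumes Z: "monomial_submodule N n Z" and Z': "monomial_submodule N n Z'"
    and gen: "\<And>b. (j, b) \<in> Z \<Longrightarrow> D < size b \<Longrightarrow> decomposable Z j b"
    and base: "\<And>b. (j, b) \<in> Z \<Longrightarrow> size b = D \<Longrightarrow> (j, b) \<in> Z'"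
    and b: "(j, b) \<in> Z" "D \<le> size b"
  shows "(j, b) \<in> Z'"
  using b
proof (induction "size b" arbitrary: b)
  case 0 then show ?case using base by simp
next
  case (Suc s)
  show ?case
  proof (cases "size b = D")
    case True then show ?thesis using base Suc by simp
  next
    case False
    then obtain i where i: "i \<in># b" "(j, b - {#i#}) \<in> Z"
      using gen[OF Suc.prems(1)] Suc.prems(2) unfolding decomposable_def by auto
    then have s: "size (b - {#i#}) = s" using Suc.hyps(2) by (simp add: size_Diff_singleton)
    then have "(j, b - {#i#}) \<in> Z'" using Suc.hyps(1)[OF s[symmetric] i(2)] Suc False by simp
    moreover have "i \<le> N" using i(1) Suc.prems(1) Z unfolding monomial_submodule_def by auto
    ultimately have "(j, add_mset i (b - {#i#})) \<in> Z'"
      using Z' unfolding monomial_submodule_def by blast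
    then show ?thesis using i(1) by simp
  qed
qed

lemma finite_layer:
  assumes "monomial_submodule N n Z"
  shows "finite (layer Z J s)"
proof -
  have "layer Z J s \<subseteq> {..n} \<times> monoms N s"
    using assms unfolding layer_def monomial_submodule_def monoms_def by auto
  then show ?thesis using finite_monoms finite_subset by blast
qed

text \<open>
  The uniform bound comes from compactness. Let \<open>Z\<^sub>k\<close> be a counterexample to the bound \<open>k\<close>, and
  pass to a subsequence that converges to some \<open>L\<close>. By Dickson's lemma \<open>L\<close> has no generators above
  some degree \<open>D \<ge> d\<close>. For large \<open>k\<close> the set \<open>Z\<^sub>k\<close> agrees with \<open>L\<close> up to degree \<open>2 * D\<close>, so the
  gap property forces coordinate \<open>0\<close> of \<open>Z\<^sub>k\<close> to be that of \<open>L\<close> from degree \<open>D\<close> on. The prescribed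
  function \<open>h\<close> then fixes the sizes of the layers in the remaining coordinates. There \<open>Z\<^sub>k\<close>
  contains \<open>L\<close> from degree \<open>D\<close> on, hence equals \<open>L\<close>, and has no generators above \<open>D\<close>, contrary to
  the choice of \<open>Z\<^sub>k\<close> when \<open>k \<ge> D\<close>.

  Only monomials occur in this statement. This is why the bound is the same for all rings.
\<close>

theorem uniform_generation_bound:
  fixes h :: "nat \<Rightarrow> nat"
  shows "\<exists>D. \<forall>Z. monomial_submodule N n Z \<longrightarrow> gap_property d Z \<longrightarrow>
      (\<forall>s. card (layer Z {1..n} s) + card (layer Z {0} (s + d)) = h s) \<longrightarrow>
      (\<forall>j b. (j, b) \<in> Z \<longrightarrow> 1 \<le> j \<longrightarrow> D < size b \<longrightarrow> decomposable Z j b)"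
proof (rule ccontr)
  assume neg: "\<not> ?thesis"
  have "\<exists>Z j b. monomial_submodule N n Z \<and> gap_property d Z \<and>
      (\<forall>s. card (layer Z {1..n} s) + card (layer Z {0} (s + d)) = h s) \<and>
      (j, b) \<in> Z \<and> 1 \<le> j \<and> D < size b \<and> \<not> decomposable Z j b" for D
    using neg by blast
  then obtain Z J B where Z: "\<And>k. monomial_submodule N n (Z k)" and gap: "\<And>k. gap_property d (Z k)"
    and card: "\<And>k s. card (layer (Z k) {1..n} s) + card (layer (Z k) {0} (s + d)) = h s"
    and bad: "\<And>k. (J k, B k) \<in> Z k" "\<And>k. 1 \<le> (J k :: nat)" "\<And>k. k < size (B k)"
      "\<And>k. \<not> decomposable (Z k) (J k) (B k)"
    by metis
  define e :: "nat \<Rightarrow> nat \<times> nat multiset" where "e = map_prod id mset \<circ> from_nat"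
  have "x \<in> range e" for x
  proof -
    obtain xs where "mset xs = snd x" using ex_mset by blast
    then have "e (to_nat (fst x, xs)) = x" unfolding e_def by simp
    then show ?thesis by (metis rangeI)
  qed
  then have "range e = UNIV" by blast
  then obtain r L where r: "strict_mono (r :: nat \<Rightarrow> nat)"
    and lim: "\<And>x. \<exists>k0. \<forall>k\<ge>k0. x \<in> Z (r k) \<longleftrightarrow> x \<in> L"
    using convergent_subsequence[of e Z] by blast
  \<comment> \<open>Any finitely many membership questions are settled simultaneously from some index on.\<close>
  have fin: "\<exists>k0. \<forall>k\<ge>k0. \<forall>x\<in>F. x \<in> Z (r k) \<longleftrightarrow> x \<in> L" if "finite F" for F
    using that
  proof induction
    case (insert x F)
    then obtain k0 where "\<forall>k\<ge>k0. \<forall>x\<in>F. x \<in> Z (r k) \<longleftrightarrow> x \<in> L" by blast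
    moreover obtain k1 where "\<forall>k\<ge>k1. x \<in> Z (r k) \<longleftrightarrow> x \<in> L" using lim by blast
    ultimately show ?case by (intro exI[of _ "max k0 k1"]) auto
  qed auto
  have L: "monomial_submodule N n L"
    unfolding monomial_submodule_def
  proof (intro allI impI)
    fix j a assume ja: "(j, a) \<in> L"
    obtain k where "(j, a) \<in> Z (r k)" using lim[of "(j, a)"] ja by blast
    moreover have "(j, add_mset i a) \<in> L" if "i \<le> N" for i
    proof -
      obtain k where "(j, a) \<in> Z (r k) \<longleftrightarrow> (j, a) \<in> L" "(j, add_mset i a) \<in> Z (r k) \<longleftrightarrow> (j, add_mset i a) \<in> L"
        using fin[of "{(j, a), (j, add_mset i a)}"] by auto
      then show ?thesis using ja Z[of "r k"] that unfolding monomial_submodule_def by blast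
    qed
    ultimately show "j \<le> n \<and> set_mset a \<subseteq> {..N} \<and> (\<forall>i\<le>N. (j, add_mset i a) \<in> L)"
      using Z[of "r k"] unfolding monomial_submodule_def by blast
  qed
  obtain D0 where D0: "\<And>j b. (j, b) \<in> L \<Longrightarrow> D0 < size b \<Longrightarrow> decomposable L j b"
    using monomial_submodule_finite_type[OF L] by blast
  define D where "D = max d D0"
  have D: "decomposable L j b" if "(j, b) \<in> L" "D < size b" for j b using D0 that D_def by auto
  \<comment> \<open>Agreement up to degree \<open>2 * D\<close> is what the gap property asks for.\<close>
  define F where "F = {..n} \<times> (\<Union>s\<le>2*D. monoms N s)"
  have "finite F" unfolding F_def using finite_monoms by auto
  then obtain k0 where k0: "\<And>k x. k \<ge> k0 \<Longrightarrow> x \<in> F \<Longrightarrow> x \<in> Z (r k) \<longleftrightarrow> x \<in> L" using fin by blast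
  have agree: "(j, b) \<in> Z (r k) \<longleftrightarrow> (j, b) \<in> L" if "k \<ge> k0" "size b \<le> 2 * D" for k j b
  proof (cases "j \<le> n \<and> set_mset b \<subseteq> {..N}")
    case True
    then have "(j, b) \<in> F" unfolding F_def monoms_def using that by auto
    then show ?thesis using k0 that by blast
  next
    case False
    then show ?thesis using Z[of "r k"] L unfolding monomial_submodule_def by blast
  qed
  have dec0: "decomposable (Z (r k)) 0 b" if k: "k \<ge> k0" and b: "(0, b) \<in> Z (r k)" "D < size b" for k b
  proof -
    have "decomposable (Z (r k)) 0 b" if b: "(0, b) \<in> Z (r k)" "D < size b" "size b \<le> 2 * D" for b
    proof -
      have "(0, b) \<in> L" using agree k b by blast
      then obtain i where i: "i \<in># b" "(0, b - {#i#}) \<in> L" using D b unfolding decomposable_def by blast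
      moreover have "size (b - {#i#}) \<le> 2 * D" using b(3) by (simp add: size_Diff_submset le_diff_conv size_Diff_singleton i)
      ultimately show ?thesis using agree[OF k] unfolding decomposable_def by blast
    qed
    then show ?thesis using gap[of "r k"] b unfolding gap_property_def D_def by (meson max.cobounded1)
  qed
  have same0: "(0, b) \<in> Z (r k) \<longleftrightarrow> (0, b) \<in> L" if "k \<ge> k0" "D \<le> size b" for k b
    using generated_layers_subset[OF Z[of "r k"] L, of 0 D b] dec0[OF that(1)]
      generated_layers_subset[OF L Z[of "r k"], of 0 D b] D agree[OF that(1)] that(2) by fastforce
  have "layer (Z (r k)) {1..n} s = layer L {1..n} s" if k: "k \<ge> k0" and s: "D \<le> s" for k s
  proof -
    have sub: "layer L {1..n} s \<subseteq> layer (Z (r k)) {1..n} s"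
      using generated_layers_subset[OF L Z[of "r k"], of _ D] D agree[OF k] s
      unfolding layer_def by fastforce
    have w0: "layer (Z (r k)) {0} (s + d) = layer L {0} (s + d)"
      using same0[OF k] s unfolding layer_def by auto
    have "finite ({..n} \<times> monoms N s)" using finite_monoms by auto
    then obtain k1 where k1: "\<And>k x. k \<ge> k1 \<Longrightarrow> x \<in> {..n} \<times> monoms N s \<Longrightarrow> x \<in> Z (r k) \<longleftrightarrow> x \<in> L"
      using fin by blast
    \<comment> \<open>A later member of the sequence shows that the layer of \<open>L\<close> has the prescribed size.\<close>
    define k' where "k' = max k0 k1"
    have "(j, b) \<in> Z (r k') \<longleftrightarrow> (j, b) \<in> L" if "size b = s" for j b
    proof (cases "j \<le> n \<and> set_mset b \<subseteq> {..N}")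
      case True then show ?thesis using k1[of k' "(j, b)"] that unfolding k'_def monoms_def by auto
    next
      case False then show ?thesis using Z[of "r k'"] L unfolding monomial_submodule_def by blast
    qed
    then have "layer (Z (r k')) {1..n} s = layer L {1..n} s" unfolding layer_def by auto
    moreover have "layer (Z (r k')) {0} (s + d) = layer L {0} (s + d)"
      using same0[of k'] s unfolding layer_def k'_def by auto
    ultimately have "card (layer (Z (r k)) {1..n} s) = card (layer L {1..n} s)"
      using card[of "r k" s] card[of "r k'" s] w0 by simp
    then show ?thesis using sub card_subset_eq[OF finite_layer[OF Z[of "r k"]] sub] by simp
  qed
  then have same: "(j, b) \<in> Z (r k) \<longleftrightarrow> (j, b) \<in> L" if "k \<ge> k0" "D \<le> size b" "1 \<le> j" for k j b
  proof (cases "j \<le> n")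
    case True
    then have "(j, b) \<in> layer (Z (r k)) {1..n} (size b) \<longleftrightarrow> (j, b) \<in> layer L {1..n} (size b)"
      using \<open>\<And>k s. k \<ge> k0 \<Longrightarrow> D \<le> s \<Longrightarrow> layer (Z (r k)) {1..n} s = layer L {1..n} s\<close> that by blast
    then show ?thesis using True that unfolding layer_def by auto
  next
    case False then show ?thesis using Z[of "r k"] L unfolding monomial_submodule_def by blast
  qed
  define k where "k = max k0 D"
  have "k \<le> r k" using r by (rule seq_suble)
  then have Bk: "D < size (B (r k))" using bad(3)[of "r k"] k_def by simp
  have "(J (r k), B (r k)) \<in> L" using same[of k] bad(1,2)[of "r k"] Bk k_def by auto
  then obtain i where i: "i \<in># B (r k)" "(J (r k), B (r k) - {#i#}) \<in> L"
    using D Bk unfolding decomposable_def by blast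
  then have "(J (r k), B (r k) - {#i#}) \<in> Z (r k)"
    using same[of k] bad(2)[of "r k"] Bk k_def by (auto simp: size_Diff_singleton)
  then show False using bad(4)[of "r k"] i(1) unfolding decomposable_def by blast
qed

section \<open>Leading monomials of graded submodules\<close>

text \<open>
  Positions are pairs, but they are compared and eliminated as single elements of a linear order.
\<close>

declare split_paired_All [simp del] split_paired_Ex [simp del]

text \<open>
  Multiplication by the monomial \<open>x\<^sup>c\<close>.
\<close>

definition (in ring) shift :: "nat multiset \<Rightarrow> (nat \<times> nat multiset \<Rightarrow> 'a) \<Rightarrow> nat \<times> nat multiset \<Rightarrow> 'a" where
  "shift c y = (\<lambda>(j, a). if c \<subseteq># a then y (j, a - c) else \<zero>)"

lemma (in ring) shift_at_sum [simp]: "shift c y (j, a + c) = y (j, a)"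
  unfolding shift_def by simp

lemma (in ring) shift_nonzeroD:
  assumes "shift c y (j, b) \<noteq> \<zero>"
  obtains a where "b = a + c" "shift c y (j, b) = y (j, a)"
  using assms that[of "b - c"] unfolding shift_def by (auto split: if_splits)

lemma (in ring) shift_shift: "shift e (shift c y) = shift (c + e) y"
proof (rule ext, clarify)
  fix j a
  show "shift e (shift c y) (j, a) = shift (c + e) y (j, a)"
  proof (cases "e \<subseteq># a")
    case True
    then obtain a' where "a = a' + e" by (metis subset_mset.diff_add)
    then show ?thesis unfolding shift_def by simp
  next
    case False
    then have "\<not> c + e \<subseteq># a" by (meson mset_subset_eq_add_right subset_mset.order_trans)
    then show ?thesis using False unfolding shift_def by simp
  qed
qed

text \<open>
  Leading positions move by \<open>c\<close>, since the order of monomials is compatible with multiplication.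
\<close>

lemma (in ring) shift_vanish:
  assumes "\<And>q. q > (j, a) \<Longrightarrow> y q \<in> P" "\<zero> \<in> P" "q > (j, a + c)"
  shows "shift c y q \<in> P"
proof (cases "shift c y q = \<zero>")
  case False
  obtain k b where q: "q = (k, b)" by (cases q)
  obtain a' where a': "b = a' + c" "shift c y (k, b) = y (k, a')"
    using shift_nonzeroD False q by metis
  have "(k, a') > (j, a)" using assms(3) a' q by auto
  then show ?thesis using a' assms(1) q by simp
qed (use assms in simp)

lemma (in ring) shift_vanish_ge:
  assumes "\<And>q. q \<ge> (j, a) \<Longrightarrow> y q = \<zero>" "q \<ge> (j, a + c)"
  shows "shift c y q = \<zero>"
proof (rule ccontr)
  assume *: "shift c y q \<noteq> \<zero>"
  obtain k b where q: "q = (k, b)" by (cases q)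
  obtain a' where a': "b = a' + c" "shift c y (k, b) = y (k, a')"
    using shift_nonzeroD * q by metis
  have "(k, a') \<ge> (j, a)" using assms(2) a' q by auto
  then show False using a' assms(1) q * by simp
qed

text \<open>
  \<open>M s\<close> is the part of degree \<open>s\<close> of a graded submodule of the free module of vectors of
  polynomials in \<open>x\<^sub>0, \<dots>, x\<^sub>N\<close> with components indexed by \<open>J\<close>; a vector is its family of
  coefficients.
\<close>

locale graded_submodules = domain R for R (structure) +
  fixes N :: nat and J :: "nat set" and M :: "nat \<Rightarrow> (nat \<times> nat multiset \<Rightarrow> 'a) set"
  assumes graded: "coord_submodule (J \<times> monoms N s) (M s)"
    and shift_closed: "y \<in> M s \<Longrightarrow> set_mset c \<subseteq> {..N} \<Longrightarrow> shift c y \<in> M (s + size c)"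
    and finite_J: "finite J"
begin

lemma M_carrier: "y \<in> M s \<Longrightarrow> y q \<in> carrier R"
  using coord_submoduleD(2)[OF graded] .

lemma M_support: "y \<in> M s \<Longrightarrow> y (j, a) \<noteq> \<zero> \<Longrightarrow> j \<in> J \<and> a \<in> monoms N s"
  using coord_submoduleD(3)[OF graded, of y s "(j, a)"] by auto

lemma finite_positions: "finite (J \<times> monoms N s)"
  using finite_J finite_monoms by simp

lemma leads_shift:
  assumes "(j, a) \<in> leads P (M s)" "\<zero> \<in> P" "set_mset c \<subseteq> {..N}"
  shows "(j, a + c) \<in> leads P (M (s + size c))"
proof -
  obtain y where y: "y \<in> M s" "y (j, a) \<notin> P" "\<And>q. q > (j, a) \<Longrightarrow> y q \<in> P"
    using assms(1) unfolding leads_def by blast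
  show ?thesis
    using shift_closed[OF y(1) assms(3)] y(2) shift_vanish[OF y(3) assms(2)]
    by (intro leadsI[of "shift c y"]) auto
qed

text \<open>
  The multiples of degree \<open>t\<close>, by monomials, of the elements of degree \<open>D\<close>. The set \<open>U\<close> will be
  \<open>{\<mu><..}\<close> or \<open>{\<nu>..}\<close> and thus bounds their leading positions.
\<close>

definition shifted_gens :: "nat \<Rightarrow> nat \<Rightarrow> (nat \<times> nat multiset) set \<Rightarrow> (nat \<times> nat multiset \<Rightarrow> 'a) set" where
  "shifted_gens D t U = {shift c g | c g. g \<in> M D \<and> c \<in> monoms N (t - D) \<and> (\<forall>q\<in>U. shift c g q = \<zero>)}"

text \<open>
  The span over the fraction field, intersected with the vectors over \<open>R\<close>.
\<close>

definition sat_span :: "(nat \<times> nat multiset \<Rightarrow> 'a) set \<Rightarrow> (nat \<times> nat multiset \<Rightarrow> 'a) set" where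
  "sat_span G = {p. (\<forall>q. p q \<in> carrier R) \<and> (\<exists>r\<in>carrier R. r \<noteq> \<zero> \<and> (\<lambda>q. r \<otimes> p q) \<in> lspan G)}"

lemma shifted_gensI:
  assumes "g \<in> M D" "c \<in> monoms N (t - D)" "\<And>q. q \<in> U \<Longrightarrow> shift c g q = \<zero>"
  shows "shift c g \<in> shifted_gens D t U"
  using assms unfolding shifted_gens_def by blast

lemma shifted_gensE:
  assumes "x \<in> shifted_gens D t U"
  obtains c g where "x = shift c g" "g \<in> M D" "c \<in> monoms N (t - D)" "\<And>q. q \<in> U \<Longrightarrow> x q = \<zero>"
  using assms unfolding shifted_gens_def by blast

lemma shifted_gens_antimono: "U \<subseteq> U' \<Longrightarrow> shifted_gens D t U' \<subseteq> shifted_gens D t U"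
  unfolding shifted_gens_def by blast

lemma shifted_gens_M:
  assumes "D \<le> t" "x \<in> shifted_gens D t U"
  shows "x \<in> M t"
  using assms(2)
proof (rule shifted_gensE)
  fix c g assume "x = shift c g" "g \<in> M D" "c \<in> monoms N (t - D)"
  then show "x \<in> M t" using shift_closed[of g D c] assms(1) unfolding monoms_def by auto
qed

lemma shifted_gens_carrier: "x \<in> shifted_gens D t U \<Longrightarrow> x q \<in> carrier R"
proof (erule shifted_gensE)
  fix c g assume "x = shift c g" "g \<in> M D"
  then show "x q \<in> carrier R" using M_carrier unfolding shift_def by (cases q) auto
qed

lemma lspan_gens_submodule:
  assumes "D \<le> t"
  shows "coord_submodule (J \<times> monoms N t) (lspan (shifted_gens D t U))"
proof (rule lspan_coord_submodule)
  fix x q assume "x \<in> shifted_gens D t U" "q \<notin> J \<times> monoms N t"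
  then show "x q = \<zero>" using shifted_gens_M[OF assms] coord_submoduleD(3)[OF graded] by blast
qed (rule shifted_gens_carrier)

lemma lspan_gens_vanish:
  assumes "x \<in> lspan (shifted_gens D t U)" "q \<in> U"
  shows "x q = \<zero>"
  using assms(1)
proof induction
  case (add y g r)
  have "g q = \<zero>" using shifted_gensE[OF add(2)] assms(2) by metis
  then show ?case using add by simp
qed simp

lemma lspan_gens_shift:
  assumes "D \<le> s" "set_mset e \<subseteq> {..N}" "x \<in> lspan (shifted_gens D s {(j, b)..})"
  shows "shift e x \<in> lspan (shifted_gens D (s + size e) {(j, b + e)..})"
  using assms(3)
proof induction
  case zero
  have "shift e (\<lambda>_. \<zero>) = (\<lambda>_. \<zero>)" unfolding shift_def by auto
  then show ?case using lspan.zero by simp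
next
  case (add y g r)
  obtain c h where c: "g = shift c h" "h \<in> M D" "c \<in> monoms N (s - D)" "\<And>q. q \<ge> (j, b) \<Longrightarrow> g q = \<zero>"
    using add(2) by (rule shifted_gensE) auto
  have "shift e g = shift (c + e) h" using c shift_shift by simp
  moreover have "shift (c + e) h \<in> shifted_gens D (s + size e) {(j, b + e)..}"
  proof (rule shifted_gensI[OF c(2)])
    show "c + e \<in> monoms N (s + size e - D)" using c(3) assms(1,2) unfolding monoms_def by auto
    fix q assume "q \<in> {(j, b + e)..}"
    then show "shift (c + e) h q = \<zero>"
      using shift_vanish_ge[where y=g and q=q and c=e, OF c(4)] c(1) shift_shift[of e c h] by simp
  qed
  ultimately have "(\<lambda>q. shift e y q \<oplus> r \<otimes> shift e g q) \<in> lspan (shifted_gens D (s + size e) {(j, b + e)..})"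
    using add by (intro lspan.add) auto
  moreover have "(\<lambda>q. shift e y q \<oplus> r \<otimes> shift e g q) = shift e (\<lambda>q. y q \<oplus> r \<otimes> g q)"
    using add(3) unfolding shift_def by auto
  ultimately show ?case by simp
qed

text \<open>
  Division with remainder by \<open>M D\<close>: the leading term of \<open>w\<close> is cancelled by a multiple of an
  element of \<open>M D\<close>, and the remainder has a lower leading position.
\<close>

lemma reduce_by_leads:
  assumes D: "D \<le> s"
    and leads: "\<And>j b. (j, b) \<in> leads {\<zero>} (M s) \<Longrightarrow>
      \<exists>a c. b = a + c \<and> (j, a) \<in> leads {\<zero>} (M D) \<and> c \<in> monoms N (s - D)"
    and "w \<in> M s" "\<And>q. q \<ge> \<nu> \<Longrightarrow> w q = \<zero>"
  shows "w \<in> sat_span (shifted_gens D s {\<nu>..})"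
  using assms(3,4)
proof (induction \<nu> arbitrary: w rule: less_induct)
  case (less \<nu>)
  have wc: "w q \<in> carrier R" for q using M_carrier less.prems(1) .
  show ?case
  proof (cases "\<exists>q. w q \<noteq> \<zero>")
    case False
    then have "(\<lambda>q. \<one> \<otimes> w q) = (\<lambda>_. \<zero>)" by auto
    then have "(\<lambda>q. \<one> \<otimes> w q) \<in> lspan (shifted_gens D s {\<nu>..})" using lspan.zero by metis
    then show ?thesis unfolding sat_span_def using wc one_not_zero one_closed by blast
  next
    case True
    then obtain q0 where "w q0 \<notin> {\<zero>}" by auto
    then obtain \<kappa> where \<kappa>: "w \<kappa> \<noteq> \<zero>" "\<And>q. q > \<kappa> \<Longrightarrow> w q = \<zero>"
      using lead_exists[OF graded zero_ideal finite_positions less.prems(1)] by blast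
    have lt: "\<kappa> < \<nu>" using \<kappa>(1) less.prems(2) by (meson not_less)
    obtain j b where jb: "\<kappa> = (j, b)" by (cases \<kappa>)
    have "(j, b) \<in> leads {\<zero>} (M s)" using leadsI[OF less.prems(1), of \<kappa>] \<kappa> jb by auto
    then obtain a c where ac: "b = a + c" "(j, a) \<in> leads {\<zero>} (M D)" "c \<in> monoms N (s - D)"
      using leads by blast
    obtain h where h: "h \<in> M D" "h (j, a) \<noteq> \<zero>" "\<And>q. q > (j, a) \<Longrightarrow> h q = \<zero>"
      using ac(2) unfolding leads_def by auto
    define g where "g = shift c h"
    have gs: "g \<in> M s" using shift_closed[OF h(1), of c] ac(3) D unfolding monoms_def g_def by auto
    have g\<kappa>: "g \<kappa> = h (j, a)" unfolding g_def jb ac(1) by simp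
    have gv: "g q = \<zero>" if "q > \<kappa>" for q
      using shift_vanish[of j a h "{\<zero>}" c q] h(3) that unfolding g_def jb ac(1) by simp
    have gc: "g q \<in> carrier R" for q using M_carrier gs .
    define w' where "w' = (\<lambda>q. g \<kappa> \<otimes> w q \<oplus> (\<ominus> w \<kappa>) \<otimes> g q)"
    have "w' \<in> M s" unfolding w'_def using gs less.prems(1) gc wc
      by (intro coord_submoduleD(4)[OF graded]) auto
    moreover have "w' q = \<zero>" if "q \<ge> \<kappa>" for q
      using that \<kappa>(2) gv gc wc unfolding w'_def by (cases "q = \<kappa>") (auto simp: cross_cancel)
    ultimately have "w' \<in> sat_span (shifted_gens D s {\<kappa>..})" using less.IH[OF lt] by blast
    then obtain r where r: "r \<in> carrier R" "r \<noteq> \<zero>" "(\<lambda>q. r \<otimes> w' q) \<in> lspan (shifted_gens D s {\<kappa>..})"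
      unfolding sat_span_def by blast
    have "{\<nu>..} \<subseteq> {\<kappa>..}" using lt by auto
    then have r': "(\<lambda>q. r \<otimes> w' q) \<in> lspan (shifted_gens D s {\<nu>..})"
      using lspan_mono[OF shifted_gens_antimono] r(3) by blast
    have "g \<in> shifted_gens D s {\<nu>..}"
      unfolding g_def using h(1) ac(3) gv lt unfolding g_def by (intro shifted_gensI) auto
    then have "(\<lambda>q. r \<otimes> w' q \<oplus> (r \<otimes> w \<kappa>) \<otimes> g q) \<in> lspan (shifted_gens D s {\<nu>..})"
      using r r' wc by (intro lspan.add) auto
    moreover have "r \<otimes> w' q \<oplus> (r \<otimes> w \<kappa>) \<otimes> g q = (r \<otimes> g \<kappa>) \<otimes> w q" for q
      unfolding w'_def using r(1) wc[of q] wc[of \<kappa>] gc[of q] gc[of \<kappa>] by algebra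
    ultimately have "(\<lambda>q. (r \<otimes> g \<kappa>) \<otimes> w q) \<in> lspan (shifted_gens D s {\<nu>..})" by simp
    moreover have "r \<otimes> g \<kappa> \<noteq> \<zero>" using r g\<kappa> h(2) gc[of \<kappa>] integral by metis
    ultimately show ?thesis unfolding sat_span_def using wc r gc by blast
  qed
qed

text \<open>
  If two of the generators have the same leading position \<open>\<mu>\<close>, the combination cancelling it is a
  monomial multiple of an S-polynomial. The latter lives in the degree of a least common multiple
  of two monomials of degree \<open>D\<close>, that is, between \<open>D\<close> and \<open>2 * D\<close>, where division leaves no
  remainder.
\<close>

lemma s_polynomial_reduces:
  assumes leads: "\<And>s j b. D \<le> s \<Longrightarrow> s \<le> 2 * D \<Longrightarrow> (j, b) \<in> leads {\<zero>} (M s) \<Longrightarrow>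
      \<exists>a c. b = a + c \<and> (j, a) \<in> leads {\<zero>} (M D) \<and> c \<in> monoms N (s - D)"
    and t: "D \<le> t"
    and g: "g \<in> shifted_gens D t {\<mu><..}" "g \<mu> \<noteq> \<zero>" and g0: "g0 \<in> shifted_gens D t {\<mu><..}" "g0 \<mu> \<noteq> \<zero>"
  shows "(\<lambda>q. g0 \<mu> \<otimes> g q \<oplus> (\<ominus> g \<mu>) \<otimes> g0 q) \<in> sat_span (shifted_gens D t {\<mu>..})"
proof -
  obtain j m where \<mu>: "\<mu> = (j, m)" by (cases \<mu>)
  have unshift: "\<exists>a c h. h \<in> M D \<and> x = shift c h \<and> m = a + c \<and> x \<mu> = h (j, a) \<and>
      c \<in> monoms N (t - D) \<and> a \<in> monoms N D \<and> (\<forall>q>(j, a). h q = \<zero>)"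
    if x: "x \<in> shifted_gens D t {\<mu><..}" and "x \<mu> \<noteq> \<zero>" for x
    using x
  proof (rule shifted_gensE)
    fix c h assume h: "x = shift c h" "h \<in> M D" "c \<in> monoms N (t - D)" "\<And>q. q \<in> {\<mu><..} \<Longrightarrow> x q = \<zero>"
    then obtain a where a: "m = a + c" "x \<mu> = h (j, a)"
      using shift_nonzeroD[of c h j m] \<open>x \<mu> \<noteq> \<zero>\<close> \<mu> by metis
    then have "a \<in> monoms N D" using M_support[OF h(2)] \<open>x \<mu> \<noteq> \<zero>\<close> by metis
    moreover have "h q = \<zero>" if "q > (j, a)" for q
    proof -
      obtain k b where q: "q = (k, b)" by (cases q)
      have "(k, b + c) > \<mu>" using that unfolding q \<mu> a(1) by auto
      then show ?thesis using h(4)[of "(k, b + c)"] h(1) q by simp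
    qed
    ultimately show ?thesis using h a by blast
  qed
  obtain a c h where h: "h \<in> M D" "g = shift c h" "m = a + c" "g \<mu> = h (j, a)"
      "c \<in> monoms N (t - D)" "a \<in> monoms N D" "\<And>q. q > (j, a) \<Longrightarrow> h q = \<zero>"
    using unshift[OF g] by blast
  obtain a0 c0 h0 where h0: "h0 \<in> M D" "g0 = shift c0 h0" "m = a0 + c0" "g0 \<mu> = h0 (j, a0)"
      "c0 \<in> monoms N (t - D)" "a0 \<in> monoms N D" "\<And>q. q > (j, a0) \<Longrightarrow> h0 q = \<zero>"
    using unshift[OF g0] by blast
  \<comment> \<open>The least common multiple of the two leading monomials.\<close>
  define l where "l = a \<union># a0"
  have "a \<subseteq># m" "a0 \<subseteq># m" using h(3) h0(3) by (simp, metis mset_subset_eq_add_left)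
  then have "l \<subseteq># m" unfolding l_def by simp
  then obtain e where e: "m = l + e" by (metis subset_mset.add_diff_inverse)
  obtain x where x: "l = a + x" unfolding l_def by (metis subset_mset.sup_ge1 subset_mset.add_diff_inverse)
  obtain x0 where x0: "l = a0 + x0" unfolding l_def by (metis subset_mset.sup_ge2 subset_mset.add_diff_inverse)
  have c: "c = x + e" using h(3) e x by (metis add.assoc add_left_cancel)
  have c0: "c0 = x0 + e" using h0(3) e x0 by (metis add.assoc add_left_cancel)
  have sub: "set_mset x \<subseteq> {..N}" "set_mset x0 \<subseteq> {..N}" "set_mset e \<subseteq> {..N}"
    using h(5) h0(5) c c0 unfolding monoms_def by auto
  have sz: "size a = D" "size a0 = D" using h(6) h0(6) unfolding monoms_def by auto
  have sl: "size l = D + size x" unfolding x using sz by simp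
  have sl0: "size l = D + size x0" unfolding x0 using sz by simp
  have "l \<subseteq># a + a0" unfolding l_def by (simp add: mset_subset_eqI)
  then have l2: "size l \<le> 2 * D" using size_mset_mono sz by fastforce
  have lD: "D \<le> size l" using sl by simp
  have hc: "h q \<in> carrier R" and h0c: "h0 q \<in> carrier R" for q using M_carrier h h0 by auto
  \<comment> \<open>The S-polynomial; multiplying it by the monomial \<open>e\<close> gives the combination of \<open>g\<close> and \<open>g0\<close>.\<close>
  define w where "w = (\<lambda>q. h0 (j, a0) \<otimes> shift x h q \<oplus> (\<ominus> h (j, a)) \<otimes> shift x0 h0 q)"
  have sM: "shift x h \<in> M (size l)" "shift x0 h0 \<in> M (size l)"
    using shift_closed[OF h(1) sub(1)] shift_closed[OF h0(1) sub(2)] sl sl0 by auto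
  then have wM: "w \<in> M (size l)" unfolding w_def using hc h0c
    by (intro coord_submoduleD(4)[OF graded]) auto
  have "w q = \<zero>" if "q \<ge> (j, l)" for q
  proof (cases "q = (j, l)")
    case True
    have "shift x h (j, l) = h (j, a)" unfolding x by simp
    moreover have "shift x0 h0 (j, l) = h0 (j, a0)" unfolding x0 by simp
    ultimately show ?thesis unfolding w_def True using hc h0c by (simp add: cross_cancel)
  next
    case False
    then have "q > (j, a + x)" "q > (j, a0 + x0)" using that x x0 by auto
    then have "shift x h q = \<zero>" "shift x0 h0 q = \<zero>"
      using shift_vanish[of j a h "{\<zero>}" x q] shift_vanish[of j a0 h0 "{\<zero>}" x0 q] h(7) h0(7) by auto
    then show ?thesis unfolding w_def using hc h0c by simp
  qed
  then have "w \<in> sat_span (shifted_gens D (size l) {(j, l)..})"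
    using reduce_by_leads[OF lD leads[OF lD l2] wM] by blast
  then obtain r where r: "r \<in> carrier R" "r \<noteq> \<zero>"
    "(\<lambda>q. r \<otimes> w q) \<in> lspan (shifted_gens D (size l) {(j, l)..})"
    unfolding sat_span_def by blast
  have "size m = t" using h(3,5) sz t unfolding monoms_def by auto
  then have "size l + size e = t" using e by simp
  then have "shift e (\<lambda>q. r \<otimes> w q) \<in> lspan (shifted_gens D t {\<mu>..})"
    using lspan_gens_shift[OF lD sub(3) r(3)] e \<mu> by simp
  moreover have "shift e (\<lambda>q. r \<otimes> w q) = (\<lambda>q. r \<otimes> (g0 \<mu> \<otimes> g q \<oplus> (\<ominus> g \<mu>) \<otimes> g0 q))"
  proof
    fix q
    have "g = shift e (shift x h)" "g0 = shift e (shift x0 h0)"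
      using h(2) h0(2) c c0 shift_shift by auto
    then show "shift e (\<lambda>q. r \<otimes> w q) q = r \<otimes> (g0 \<mu> \<otimes> g q \<oplus> (\<ominus> g \<mu>) \<otimes> g0 q)"
      unfolding w_def h(4) h0(4) using r(1) hc h0c
      by (cases q) (auto simp: shift_def)
  qed
  ultimately have "(\<lambda>q. r \<otimes> (g0 \<mu> \<otimes> g q \<oplus> (\<ominus> g \<mu>) \<otimes> g0 q)) \<in> lspan (shifted_gens D t {\<mu>..})"
    by simp
  then show ?thesis unfolding sat_span_def
    using r shifted_gens_carrier[OF g(1)] shifted_gens_carrier[OF g0(1)] by blast
qed

text \<open>
  In a combination of the generators, every generator with a term at \<open>\<mu>\<close> can be traded for a
  multiple of a single one, \<open>g0\<close>, and lower terms. If the combination has no term at \<open>\<mu>\<close>, the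
  resulting coefficient of \<open>g0\<close> vanishes.
\<close>

lemma lower_the_level:
  assumes leads: "\<And>s j b. D \<le> s \<Longrightarrow> s \<le> 2 * D \<Longrightarrow> (j, b) \<in> leads {\<zero>} (M s) \<Longrightarrow>
      \<exists>a c. b = a + c \<and> (j, a) \<in> leads {\<zero>} (M D) \<and> c \<in> monoms N (s - D)"
    and t: "D \<le> t" and p: "p \<in> sat_span (shifted_gens D t {\<mu><..})" "p \<mu> = \<zero>"
  shows "p \<in> sat_span (shifted_gens D t {\<mu>..})"
proof -
  let ?L = "lspan (shifted_gens D t {\<mu>..})"
  note cs = lspan_gens_submodule[OF t, of "{\<mu>..}"]
  have pc: "p q \<in> carrier R" for q using p unfolding sat_span_def by blast
  obtain r0 where r0: "r0 \<in> carrier R" "r0 \<noteq> \<zero>" "(\<lambda>q. r0 \<otimes> p q) \<in> lspan (shifted_gens D t {\<mu><..})"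
    using p unfolding sat_span_def by blast
  show ?thesis
  proof (cases "\<exists>g0\<in>shifted_gens D t {\<mu><..}. g0 \<mu> \<noteq> \<zero>")
    case False
    have "shifted_gens D t {\<mu><..} \<subseteq> shifted_gens D t {\<mu>..}"
    proof
      fix x assume x: "x \<in> shifted_gens D t {\<mu><..}"
      then show "x \<in> shifted_gens D t {\<mu>..}"
      proof (rule shifted_gensE)
        fix c h assume h: "x = shift c h" "h \<in> M D" "c \<in> monoms N (t - D)" "\<And>q. q \<in> {\<mu><..} \<Longrightarrow> x q = \<zero>"
        have "x q = \<zero>" if "q \<in> {\<mu>..}" for q using h(4)[of q] False x that by (cases "q = \<mu>") auto
        then show ?thesis using h by (auto intro: shifted_gensI)
      qed
    qed
    then show ?thesis using r0 pc lspan_mono unfolding sat_span_def by blast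
  next
    case True
    then obtain g0 where g0: "g0 \<in> shifted_gens D t {\<mu><..}" "g0 \<mu> \<noteq> \<zero>" by blast
    have g0c: "g0 q \<in> carrier R" for q using shifted_gens_carrier[OF g0(1)] .
    have key: "\<exists>r\<in>carrier R. \<exists>e\<in>carrier R. r \<noteq> \<zero> \<and> (\<lambda>q. r \<otimes> x q \<oplus> (\<ominus> e) \<otimes> g0 q) \<in> ?L"
      if "x \<in> lspan (shifted_gens D t {\<mu><..})" for x
      using that
    proof induction
      case zero
      have "(\<lambda>q. \<one> \<otimes> \<zero> \<oplus> (\<ominus> \<zero>) \<otimes> g0 q) \<in> ?L" using lspan.zero g0c by simp
      then show ?case by (metis one_closed zero_closed one_not_zero)
    next
      case (add x g k)
      then obtain r e where r: "r \<in> carrier R" "e \<in> carrier R" "r \<noteq> \<zero>"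
        "(\<lambda>q. r \<otimes> x q \<oplus> (\<ominus> e) \<otimes> g0 q) \<in> ?L" by blast
      have xc: "x q \<in> carrier R" for q
        using coord_submoduleD(2)[OF lspan_gens_submodule[OF t] add(1)] .
      have gc: "g q \<in> carrier R" for q using shifted_gens_carrier[OF add(2)] .
      \<comment> \<open>A generator without a term at \<open>\<mu>\<close> already lies below; the others are cleared by \<open>g0\<close>.\<close>
      obtain r' where r': "r' \<in> carrier R" "r' \<noteq> \<zero>"
        "(\<lambda>q. r' \<otimes> (g0 \<mu> \<otimes> g q \<oplus> (\<ominus> g \<mu>) \<otimes> g0 q)) \<in> ?L"
      proof (cases "g \<mu> = \<zero>")
        case True
        from add(2) have "g \<in> shifted_gens D t {\<mu>..}"
        proof (rule shifted_gensE)
          fix c h assume h: "g = shift c h" "h \<in> M D" "c \<in> monoms N (t - D)" "\<And>q. q \<in> {\<mu><..} \<Longrightarrow> g q = \<zero>"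
          have "g q = \<zero>" if "q \<in> {\<mu>..}" for q using h(4)[of q] True that by (cases "q = \<mu>") auto
          then show ?thesis using h by (auto intro: shifted_gensI)
        qed
        then have "(\<lambda>q. \<zero> \<oplus> g0 \<mu> \<otimes> g q) \<in> ?L" using g0c by (intro lspan.add lspan.zero) auto
        then have "(\<lambda>q. \<one> \<otimes> (g0 \<mu> \<otimes> g q \<oplus> (\<ominus> g \<mu>) \<otimes> g0 q)) \<in> ?L"
          using gc g0c True by simp
        then show ?thesis using that one_closed one_not_zero by blast
      next
        case False
        then show ?thesis
          using s_polynomial_reduces[OF leads t add(2) False g0] that unfolding sat_span_def by blast
      qed
      have "(\<lambda>q. (r' \<otimes> g0 \<mu>) \<otimes> (r \<otimes> x q \<oplus> (\<ominus> e) \<otimes> g0 q) \<oplus>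
          (r \<otimes> k) \<otimes> (r' \<otimes> (g0 \<mu> \<otimes> g q \<oplus> (\<ominus> g \<mu>) \<otimes> g0 q))) \<in> ?L"
        using r r' add(3) g0c by (intro coord_submoduleD(4)[OF cs r(4) r'(3)]) auto
      moreover have "(r' \<otimes> g0 \<mu>) \<otimes> (r \<otimes> x q \<oplus> (\<ominus> e) \<otimes> g0 q) \<oplus>
          (r \<otimes> k) \<otimes> (r' \<otimes> (g0 \<mu> \<otimes> g q \<oplus> (\<ominus> g \<mu>) \<otimes> g0 q)) =
          (r \<otimes> r' \<otimes> g0 \<mu>) \<otimes> (x q \<oplus> k \<otimes> g q) \<oplus>
          (\<ominus> (r' \<otimes> g0 \<mu> \<otimes> e \<oplus> r \<otimes> k \<otimes> r' \<otimes> g \<mu>)) \<otimes> g0 q" for q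
        using r(1,2) r'(1) add(3) g0c[of q] g0c[of \<mu>] gc[of q] gc[of \<mu>] xc[of q] by algebra
      ultimately have "(\<lambda>q. (r \<otimes> r' \<otimes> g0 \<mu>) \<otimes> (x q \<oplus> k \<otimes> g q) \<oplus>
          (\<ominus> (r' \<otimes> g0 \<mu> \<otimes> e \<oplus> r \<otimes> k \<otimes> r' \<otimes> g \<mu>)) \<otimes> g0 q) \<in> ?L" by simp
      moreover have "r \<otimes> r' \<otimes> g0 \<mu> \<noteq> \<zero>"
        using r r' g0(2) g0c integral_iff by simp
      moreover have "r \<otimes> r' \<otimes> g0 \<mu> \<in> carrier R" "r' \<otimes> g0 \<mu> \<otimes> e \<oplus> r \<otimes> k \<otimes> r' \<otimes> g \<mu> \<in> carrier R"
        using r r' g0c gc add(3) by auto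
      ultimately show ?case by blast
    qed
    obtain r e where r: "r \<in> carrier R" "e \<in> carrier R" "r \<noteq> \<zero>"
      "(\<lambda>q. r \<otimes> (r0 \<otimes> p q) \<oplus> (\<ominus> e) \<otimes> g0 q) \<in> ?L" using key[OF r0(3)] by blast
    have "r \<otimes> (r0 \<otimes> p \<mu>) \<oplus> (\<ominus> e) \<otimes> g0 \<mu> = \<zero>" using lspan_gens_vanish[OF r(4), of \<mu>] by simp
    then have "e \<otimes> g0 \<mu> = \<zero>" using p(2) r r0 g0c[of \<mu>] by (simp add: l_minus)
    then have "e = \<zero>" using g0(2) integral r(2) g0c by blast
    then have "(\<lambda>q. (r \<otimes> r0) \<otimes> p q) \<in> ?L" using r r0 pc g0c by (simp add: m_assoc)
    moreover have "r \<otimes> r0 \<noteq> \<zero>" using r r0 integral_iff by simp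
    ultimately show ?thesis unfolding sat_span_def using pc r r0 by blast
  qed
qed

text \<open>
  The level is lowered until it is the leading position of \<open>p\<close>; then one of the generators has the
  same leading position.
\<close>

lemma leads_of_combinations:
  assumes leads: "\<And>s j b. D \<le> s \<Longrightarrow> s \<le> 2 * D \<Longrightarrow> (j, b) \<in> leads {\<zero>} (M s) \<Longrightarrow>
      \<exists>a c. b = a + c \<and> (j, a) \<in> leads {\<zero>} (M D) \<and> c \<in> monoms N (s - D)"
    and t: "D \<le> t" and "p \<in> sat_span (shifted_gens D t {\<mu><..})"
    and \<kappa>: "p (j, b) \<noteq> \<zero>" "\<And>q. q > (j, b) \<Longrightarrow> p q = \<zero>"
  shows "\<exists>a c. b = a + c \<and> (j, a) \<in> leads {\<zero>} (M D) \<and> c \<in> monoms N (t - D)"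
  using assms(3)
proof (induction \<mu> rule: less_induct)
  case (less \<mu>)
  have pc: "p q \<in> carrier R" for q using less.prems unfolding sat_span_def by blast
  obtain r where r: "r \<in> carrier R" "r \<noteq> \<zero>" "(\<lambda>q. r \<otimes> p q) \<in> lspan (shifted_gens D t {\<mu><..})"
    using less.prems unfolding sat_span_def by blast
  have "p q = \<zero>" if "q > \<mu>" for q
    using lspan_gens_vanish[OF r(3), of q] that integral[OF _ r(1) pc[of q]] r(2) by auto
  then have le: "(j, b) \<le> \<mu>" using \<kappa>(1) by (meson not_less)
  show ?case
  proof (cases "p \<mu> = \<zero>")
    case False
    then have \<mu>: "\<mu> = (j, b)" using le \<kappa>(2)[of \<mu>] by (cases "\<mu> = (j, b)") auto
    have "\<exists>g\<in>shifted_gens D t {\<mu><..}. g \<mu> \<noteq> \<zero>"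
    proof (rule ccontr)
      assume none: "\<not> ?thesis"
      have "x \<mu> = \<zero>" if "x \<in> lspan (shifted_gens D t {\<mu><..})" for x
        using that by induction (use none in auto)
      from this[OF r(3)] show False using False r pc integral by blast
    qed
    then obtain g where g: "g \<in> shifted_gens D t {\<mu><..}" "g \<mu> \<noteq> \<zero>" by blast
    from g(1) show ?thesis
    proof (rule shifted_gensE)
      fix c h assume h: "g = shift c h" "h \<in> M D" "c \<in> monoms N (t - D)" "\<And>q. q \<in> {\<mu><..} \<Longrightarrow> g q = \<zero>"
      then obtain a where a: "b = a + c" "g \<mu> = h (j, a)"
        using shift_nonzeroD[of c h j b] g(2) \<mu> by metis
      have "h q = \<zero>" if "q > (j, a)" for q
      proof -
        obtain k m where q: "q = (k, m)" by (cases q)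
        have "(k, m + c) > \<mu>" using that unfolding q \<mu> a(1) by auto
        then show ?thesis using h(4)[of "(k, m + c)"] h(1) q by simp
      qed
      then have "(j, a) \<in> leads {\<zero>} (M D)" using h(2) a(2) g(2) by (intro leadsI[of h]) auto
      then show ?thesis using a(1) h(3) by blast
    qed
  next
    case True
    then have p': "p \<in> sat_span (shifted_gens D t {\<mu>..})" using lower_the_level[OF leads t less.prems] by blast
    have lt: "(j, b) < \<mu>" using le True \<kappa>(1) by (metis order_le_less)
    \<comment> \<open>The next level to inspect is the largest position below \<open>\<mu>\<close>.\<close>
    define S where "S = {q \<in> J \<times> monoms N t. q < \<mu>}"
    have finS: "finite S" unfolding S_def using finite_positions by simp
    obtain r1 where r1: "r1 \<in> carrier R" "r1 \<noteq> \<zero>" "(\<lambda>q. r1 \<otimes> p q) \<in> lspan (shifted_gens D t {\<mu>..})"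
      using p' unfolding sat_span_def by blast
    have "r1 \<otimes> p (j, b) \<noteq> \<zero>" using r1 \<kappa>(1) pc integral by blast
    then have "(j, b) \<in> J \<times> monoms N t"
      using coord_submoduleD(3)[OF lspan_gens_submodule[OF t] r1(3)] by blast
    then have "(j, b) \<in> S" unfolding S_def using lt by simp
    then have ne: "S \<noteq> {}" by blast
    have max_lt: "Max S < \<mu>" using Max_in[OF finS ne] unfolding S_def by simp
    have "shifted_gens D t {\<mu>..} \<subseteq> shifted_gens D t {Max S<..}"
    proof
      fix x assume x: "x \<in> shifted_gens D t {\<mu>..}"
      then show "x \<in> shifted_gens D t {Max S<..}"
      proof (rule shifted_gensE)
        fix c h assume h: "x = shift c h" "h \<in> M D" "c \<in> monoms N (t - D)" "\<And>q. q \<in> {\<mu>..} \<Longrightarrow> x q = \<zero>"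
        have "x q = \<zero>" if "q \<in> {Max S<..}" for q
        proof (cases "q \<in> J \<times> monoms N t")
          case True
          then have "\<not> q < \<mu>" using that Max_ge[OF finS, of q] unfolding S_def by auto
          then show ?thesis using h(4)[of q] by simp
        next
          case False
          then show ?thesis using coord_submoduleD(3)[OF graded shifted_gens_M[OF t x]] by blast
        qed
        then show ?thesis using h by (auto intro: shifted_gensI)
      qed
    qed
    then have "p \<in> sat_span (shifted_gens D t {Max S<..})"
      using r1 pc lspan_mono unfolding sat_span_def by blast
    then show ?thesis using less.IH[OF max_lt] by blast
  qed
qed

text \<open>
  Buchberger's criterion, read off from degrees alone: \<open>M\<close> is generated in degree \<open>D\<close> from there
  on, and its leading monomials acquire no new generators between \<open>D\<close> and \<open>2 * D\<close>. Hence the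
  elements of degree \<open>D\<close> are a Groebner basis from degree \<open>D\<close> on.
\<close>

theorem leads_gap:
  assumes gen: "\<And>t. D \<le> t \<Longrightarrow> M t \<subseteq> lspan (shifted_gens D t {})"
    and dec: "\<And>j b. (j, b) \<in> leads {\<zero>} (M (size b)) \<Longrightarrow> D < size b \<Longrightarrow> size b \<le> 2 * D \<Longrightarrow>
      \<exists>i\<in>#b. (j, b - {#i#}) \<in> leads {\<zero>} (M (size b - 1))"
    and b: "(j, b) \<in> leads {\<zero>} (M (size b))" "D < size b"
  shows "\<exists>i\<in>#b. (j, b - {#i#}) \<in> leads {\<zero>} (M (size b - 1))"
proof -
  have pos: "a \<in> monoms N s" if "(j, a) \<in> leads {\<zero>} (M s)" for j a s
    using leads_subset[OF graded zero_ideal] that by blast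
  have "\<exists>a c. b = a + c \<and> (j, a) \<in> leads {\<zero>} (M D) \<and> c \<in> monoms N (s - D)"
    if "D \<le> s" "s \<le> 2 * D" "(j, b) \<in> leads {\<zero>} (M s)" for s j b
    using that
  proof (induction s arbitrary: b rule: dec_induct)
    case base
    then show ?case by (intro exI[of _ b] exI[of _ "{#}"]) (auto simp: monoms_def)
  next
    case (step s)
    have sb: "size b = Suc s" "set_mset b \<subseteq> {..N}" using pos[OF step.prems(2)] unfolding monoms_def by auto
    then obtain i where i: "i \<in># b" "(j, b - {#i#}) \<in> leads {\<zero>} (M s)"
      using dec[of j b] step by auto
    then obtain a c where ac: "b - {#i#} = a + c" "(j, a) \<in> leads {\<zero>} (M D)" "c \<in> monoms N (s - D)"
      using step by force
    have "b = a + add_mset i c" using ac(1) i(1) by (metis insert_DiffM union_mset_add_mset_right)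
    moreover have "add_mset i c \<in> monoms N (Suc s - D)" using ac(3) i(1) sb(2) step(1)
      unfolding monoms_def by auto
    ultimately show ?case using ac(2) by blast
  qed
  note low = this
  obtain p where p: "p \<in> M (size b)" "p (j, b) \<noteq> \<zero>" "\<And>q. q > (j, b) \<Longrightarrow> p q = \<zero>"
    using b(1) unfolding leads_def by auto
  let ?t = "size b"
  have t: "D \<le> ?t" using b(2) by simp
  define \<mu> where "\<mu> = Max (J \<times> monoms N ?t)"
  have "shifted_gens D ?t {} \<subseteq> shifted_gens D ?t {\<mu><..}"
  proof
    fix x assume x: "x \<in> shifted_gens D ?t {}"
    then show "x \<in> shifted_gens D ?t {\<mu><..}"
    proof (rule shifted_gensE)
      fix c h assume h: "x = shift c h" "h \<in> M D" "c \<in> monoms N (?t - D)"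
      have "x q = \<zero>" if "q \<in> {\<mu><..}" for q
      proof -
        have "q \<notin> J \<times> monoms N ?t"
          using that Max_ge[OF finite_positions, of q ?t] unfolding \<mu>_def by auto
        then show ?thesis using coord_submoduleD(3)[OF graded shifted_gens_M[OF t x]] by blast
      qed
      then show ?thesis using h by (auto intro: shifted_gensI)
    qed
  qed
  then have "p \<in> lspan (shifted_gens D ?t {\<mu><..})" using gen[OF t] p(1) lspan_mono by blast
  then have "(\<lambda>q. \<one> \<otimes> p q) \<in> lspan (shifted_gens D ?t {\<mu><..})" using M_carrier[OF p(1)] by simp
  then have "p \<in> sat_span (shifted_gens D ?t {\<mu><..})"
    unfolding sat_span_def using M_carrier[OF p(1)] one_not_zero one_closed by blast
  then obtain a c where ac: "b = a + c" "(j, a) \<in> leads {\<zero>} (M D)" "c \<in> monoms N (?t - D)"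
    using leads_of_combinations[where p=p and j=j and b=b, OF low t _ p(2,3)] by blast
  have "size c = ?t - D" using ac(3) unfolding monoms_def by simp
  then have "c \<noteq> {#}" using b(2) by auto
  then obtain i c' where c: "c = add_mset i c'" by (metis multiset_cases)
  have "(j, a + c') \<in> leads {\<zero>} (M (D + size c'))"
    using ac(3) c unfolding monoms_def by (intro leads_shift[OF ac(2)]) auto
  moreover have "D + size c' = ?t - 1" using \<open>size c = ?t - D\<close> c b(2) by auto
  ultimately show ?thesis using ac(1) c by (intro bexI[of _ i]) auto
qed

end

section \<open>Free modules and polynomial rings\<close>

lemma finite_submultisets: "finite {k. k \<subseteq># m}"
proof (induction m)
  case empty then show ?case by simp
next
  case (add x m)
  have "{k. k \<subseteq># add_mset x m} \<subseteq> {k. k \<subseteq># m} \<union> add_mset x ` {k. k \<subseteq># m}"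
  proof
    fix k assume k: "k \<in> {k. k \<subseteq># add_mset x m}"
    show "k \<in> {k. k \<subseteq># m} \<union> add_mset x ` {k. k \<subseteq># m}"
    proof (cases "x \<in># k")
      case True
      then obtain k' where "k = add_mset x k'" by (metis insert_DiffM)
      then show ?thesis using k by auto
    next
      case False
      then have "k \<subseteq># m" using k
        by (intro mset_subset_eqI) (metis count_add_mset le0 mem_Collect_eq mset_subset_eq_count not_in_iff)
      then show ?thesis by simp
    qed
  qed
  then show ?case using add finite_subset by (metis finite_UnI finite_imageI)
qed

lemma (in cring) free_module_simps:
  "carrier (free_module R S) = {v \<in> S \<rightarrow>\<^sub>E carrier R. finite {i \<in> S. v i \<noteq> \<zero>}}"
  "\<zero>\<^bsub>free_module R S\<^esub> = (\<lambda>i\<in>S. \<zero>)"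
  "u \<oplus>\<^bsub>free_module R S\<^esub> v = (\<lambda>i\<in>S. u i \<oplus> v i)"
  "a \<odot>\<^bsub>free_module R S\<^esub> v = (\<lambda>i\<in>S. a \<otimes> v i)"
  by (auto simp: free_module_def)

lemma (in cring) free_module_is_module: "module R (free_module R S)"
proof (rule moduleI)
  let ?F = "free_module R S"
  have closed_add: "(\<lambda>i\<in>S. u i \<oplus> v i) \<in> carrier ?F" if "u \<in> carrier ?F" "v \<in> carrier ?F" for u v
  proof -
    have "{i \<in> S. (\<lambda>i\<in>S. u i \<oplus> v i) i \<noteq> \<zero>} \<subseteq> {i \<in> S. u i \<noteq> \<zero>} \<union> {i \<in> S. v i \<noteq> \<zero>}"
      by auto
    moreover have "finite ({i \<in> S. u i \<noteq> \<zero>} \<union> {i \<in> S. v i \<noteq> \<zero>})"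
      using that unfolding free_module_simps by blast
    ultimately have "finite {i \<in> S. (\<lambda>i\<in>S. u i \<oplus> v i) i \<noteq> \<zero>}" by (rule finite_subset)
    then show ?thesis using that unfolding free_module_simps by (auto simp: PiE_iff)
  qed
  have closed_smult: "(\<lambda>i\<in>S. a \<otimes> v i) \<in> carrier ?F" if "a \<in> carrier R" "v \<in> carrier ?F" for a v
  proof -
    have "{i \<in> S. (\<lambda>i\<in>S. a \<otimes> v i) i \<noteq> \<zero>} \<subseteq> {i \<in> S. v i \<noteq> \<zero>}"
      using that by auto
    moreover have "finite {i \<in> S. v i \<noteq> \<zero>}"
      using that unfolding free_module_simps by blast
    ultimately have "finite {i \<in> S. (\<lambda>i\<in>S. a \<otimes> v i) i \<noteq> \<zero>}" by (rule finite_subset)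
    then show ?thesis using that unfolding free_module_simps by (auto simp: PiE_iff)
  qed
  have val: "v i \<in> carrier R" if "v \<in> carrier ?F" "i \<in> S" for v i
    using that unfolding free_module_simps by auto
  have eqI: "u = v" if "u \<in> carrier ?F" "v \<in> carrier ?F" "\<And>i. i \<in> S \<Longrightarrow> u i = v i" for u v
    using that unfolding free_module_simps by (auto intro: PiE_ext)
  show "cring R" by (rule is_cring)
  show "a \<odot>\<^bsub>?F\<^esub> x \<in> carrier ?F" if "a \<in> carrier R" "x \<in> carrier ?F" for a x
    unfolding free_module_simps(4) by (rule closed_smult[OF that])
  have z: "(\<lambda>i\<in>S. \<zero>) \<in> carrier ?F"
    unfolding free_module_simps by (auto simp: PiE_iff cong: conj_cong)
  show "abelian_group ?F"
  proof (rule abelian_groupI)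
    fix x y z assume x: "x \<in> carrier ?F" and y: "y \<in> carrier ?F" and z: "z \<in> carrier ?F"
    show "x \<oplus>\<^bsub>?F\<^esub> y \<in> carrier ?F" unfolding free_module_simps(3) by (rule closed_add[OF x y])
    show "x \<oplus>\<^bsub>?F\<^esub> y \<oplus>\<^bsub>?F\<^esub> z = x \<oplus>\<^bsub>?F\<^esub> (y \<oplus>\<^bsub>?F\<^esub> z)"
      unfolding free_module_simps(3) using val[OF x] val[OF y] val[OF z] by (auto simp: a_assoc)
    show "x \<oplus>\<^bsub>?F\<^esub> y = y \<oplus>\<^bsub>?F\<^esub> x"
      unfolding free_module_simps(3) using val[OF x] val[OF y] by (auto simp: a_comm)
  next
    show "\<zero>\<^bsub>?F\<^esub> \<in> carrier ?F" unfolding free_module_simps(2) by (rule z)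
  next
    fix x assume x: "x \<in> carrier ?F"
    have "\<zero>\<^bsub>?F\<^esub> \<oplus>\<^bsub>?F\<^esub> x \<in> carrier ?F" unfolding free_module_simps(2,3) by (rule closed_add[OF z x])
    then show "\<zero>\<^bsub>?F\<^esub> \<oplus>\<^bsub>?F\<^esub> x = x"
      by (rule eqI[OF _ x]) (use val[OF x] in \<open>simp add: free_module_simps(2,3)\<close>)
    have m: "(\<lambda>i\<in>S. \<ominus> \<one> \<otimes> x i) \<in> carrier ?F" using closed_smult x by simp
    have "(\<lambda>i\<in>S. \<ominus> \<one> \<otimes> x i) \<oplus>\<^bsub>?F\<^esub> x = \<zero>\<^bsub>?F\<^esub>"
      unfolding free_module_simps(2,3) using val[OF x] by (auto simp: l_minus l_neg)
    then show "\<exists>y\<in>carrier ?F. y \<oplus>\<^bsub>?F\<^esub> x = \<zero>\<^bsub>?F\<^esub>" using m by blast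
  qed
next
  let ?F = "free_module R S"
  have val: "v i \<in> carrier R" if "v \<in> carrier ?F" "i \<in> S" for v i
    using that unfolding free_module_simps by auto
  fix a b x y assume a: "a \<in> carrier R" and b: "b \<in> carrier R"
    and x: "x \<in> carrier ?F" and y: "y \<in> carrier ?F"
  show "(a \<oplus> b) \<odot>\<^bsub>?F\<^esub> x = a \<odot>\<^bsub>?F\<^esub> x \<oplus>\<^bsub>?F\<^esub> b \<odot>\<^bsub>?F\<^esub> x"
    unfolding free_module_simps using a b val[OF x] by (auto simp: l_distr)
  show "a \<odot>\<^bsub>?F\<^esub> (x \<oplus>\<^bsub>?F\<^esub> y) = a \<odot>\<^bsub>?F\<^esub> x \<oplus>\<^bsub>?F\<^esub> a \<odot>\<^bsub>?F\<^esub> y"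
    unfolding free_module_simps using a val[OF x] val[OF y] by (auto simp: r_distr)
  show "a \<otimes> b \<odot>\<^bsub>?F\<^esub> x = a \<odot>\<^bsub>?F\<^esub> (b \<odot>\<^bsub>?F\<^esub> x)"
    unfolding free_module_simps using a b val[OF x] by (auto simp: m_assoc)
next
  let ?F = "free_module R S"
  fix x assume x: "x \<in> carrier ?F"
  then have "\<And>i. i \<in> S \<Longrightarrow> x i \<in> carrier R" "x \<in> extensional S"
    unfolding free_module_simps by (auto simp: PiE_iff)
  then show "\<one> \<odot>\<^bsub>?F\<^esub> x = x"
    unfolding free_module_simps(4) by (auto intro!: extensionalityI[of _ S])
qed

lemma (in module) submodule_by_closure:
  assumes "H \<subseteq> carrier M" "\<zero>\<^bsub>M\<^esub> \<in> H" "\<And>x y. x \<in> H \<Longrightarrow> y \<in> H \<Longrightarrow> x \<oplus>\<^bsub>M\<^esub> y \<in> H"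
    and smult: "\<And>a x. a \<in> carrier R \<Longrightarrow> x \<in> H \<Longrightarrow> a \<odot>\<^bsub>M\<^esub> x \<in> H"
  shows "submodule H R M"
proof (rule submoduleI)
  fix x assume x: "x \<in> H"
  then have "\<ominus>\<^bsub>M\<^esub> x = (\<ominus> \<one>) \<odot>\<^bsub>M\<^esub> x" using smult_l_minus[of \<one> x] subsetD[OF assms(1) x] by simp
  then show "\<ominus>\<^bsub>M\<^esub> x \<in> H" using smult[OF _ x, of "\<ominus> \<one>"] by simp
qed (use assms in auto)

context cring
begin

lemma mpoly_simps:
  "carrier (mpoly_ring R N) = indexed_pset {1..N} (carrier R)"
  "p \<otimes>\<^bsub>mpoly_ring R N\<^esub> q = (\<lambda>m. finsum R (\<lambda>k. p k \<otimes> q (m - k)) {k. k \<subseteq># m})"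
  "\<one>\<^bsub>mpoly_ring R N\<^esub> = indexed_const \<one>"
  "\<zero>\<^bsub>mpoly_ring R N\<^esub> = (\<lambda>_. \<zero>)"
  "p \<oplus>\<^bsub>mpoly_ring R N\<^esub> q = (\<lambda>m. p m \<oplus> q m)"
  by (auto simp: mpoly_ring_def indexed_padd_def indexed_zero_def)

lemma mpoly_coeff [simp]: "p \<in> carrier (mpoly_ring R N) \<Longrightarrow> p m \<in> carrier R"
  using indexed_pset_in_carrier[of "carrier R" p "{1..N}"]
  unfolding mpoly_simps carrier_coeff_def by simp

lemma mpoly_const: "r \<in> carrier R \<Longrightarrow> indexed_const r \<in> carrier (mpoly_ring R N)"
  unfolding mpoly_simps by (rule indexed_pset.indexed_const)

lemma mpoly_add: "p \<in> carrier (mpoly_ring R N) \<Longrightarrow> q \<in> carrier (mpoly_ring R N) \<Longrightarrow>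
    (\<lambda>m. p m \<oplus> q m) \<in> carrier (mpoly_ring R N)"
  using indexed_pset.indexed_padd[of p "{1..N}" "carrier R" q] unfolding mpoly_simps indexed_padd_def .

lemma mpoly_pmult: "p \<in> carrier (mpoly_ring R N) \<Longrightarrow> i \<in> {1..N} \<Longrightarrow>
    indexed_pmult p i \<in> carrier (mpoly_ring R N)"
  unfolding mpoly_simps by (rule indexed_pset.indexed_pmult)

text \<open>
  The laws of multiplication are proved by this induction on one factor. It needs the product with
  a constant, a sum or a multiple of a variable only, and so no rearrangement of iterated sums.
\<close>

lemma mpoly_induct [consumes 1, case_names const add pmult]:
  assumes "p \<in> carrier (mpoly_ring R N)"
    and "\<And>r. r \<in> carrier R \<Longrightarrow> Q (indexed_const r)"
    and "\<And>p q. p \<in> carrier (mpoly_ring R N) \<Longrightarrow> q \<in> carrier (mpoly_ring R N) \<Longrightarrow>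
      Q p \<Longrightarrow> Q q \<Longrightarrow> Q (p \<oplus>\<^bsub>mpoly_ring R N\<^esub> q)"
    and "\<And>p i. p \<in> carrier (mpoly_ring R N) \<Longrightarrow> i \<in> {1..N} \<Longrightarrow> Q p \<Longrightarrow> Q (indexed_pmult p i)"
  shows "Q p"
  using assms(1) unfolding mpoly_simps(1)
proof (induction rule: indexed_pset.induct)
  case (indexed_padd p q)
  then show ?case using assms(3)[of p q] unfolding mpoly_simps indexed_padd_def by blast
qed (use assms(2,4) mpoly_simps(1) in auto)

lemma mult_coeff_closed:
  assumes "\<And>m. p m \<in> carrier R" "\<And>m. q m \<in> carrier R"
  shows "(p \<otimes>\<^bsub>mpoly_ring R N\<^esub> q) m \<in> carrier R"
  unfolding mpoly_simps using assms by (intro finsum_closed) auto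

lemma mult_const:
  assumes "r \<in> carrier R" "\<And>m. q m \<in> carrier R"
  shows "indexed_const r \<otimes>\<^bsub>mpoly_ring R N\<^esub> q = (\<lambda>m. r \<otimes> q m)"
proof
  fix m
  have "finsum R (\<lambda>k. indexed_const r k \<otimes> q (m - k)) {k. k \<subseteq># m} =
      finsum R (\<lambda>k. if {#} = k then r \<otimes> q (m - k) else \<zero>) {k. k \<subseteq># m}"
    using assms by (intro finsum_cong') (auto simp: indexed_const_def)
  also have "\<dots> = r \<otimes> q (m - {#})"
    using assms by (intro finsum_singleton) (auto simp: finite_submultisets)
  finally show "(indexed_const r \<otimes>\<^bsub>mpoly_ring R N\<^esub> q) m = r \<otimes> q m"
    unfolding mpoly_simps by simp
qed

lemma mult_add_left:
  assumes "\<And>m. p m \<in> carrier R" "\<And>m. p' m \<in> carrier R" "\<And>m. q m \<in> carrier R"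
  shows "(p \<oplus>\<^bsub>mpoly_ring R N\<^esub> p') \<otimes>\<^bsub>mpoly_ring R N\<^esub> q =
    (p \<otimes>\<^bsub>mpoly_ring R N\<^esub> q) \<oplus>\<^bsub>mpoly_ring R N\<^esub> (p' \<otimes>\<^bsub>mpoly_ring R N\<^esub> q)"
proof
  fix m
  have "finsum R (\<lambda>k. (p k \<oplus> p' k) \<otimes> q (m - k)) {k. k \<subseteq># m} =
      finsum R (\<lambda>k. p k \<otimes> q (m - k) \<oplus> p' k \<otimes> q (m - k)) {k. k \<subseteq># m}"
    using assms by (intro finsum_cong') (auto simp: l_distr)
  also have "\<dots> = finsum R (\<lambda>k. p k \<otimes> q (m - k)) {k. k \<subseteq># m} \<oplus>
      finsum R (\<lambda>k. p' k \<otimes> q (m - k)) {k. k \<subseteq># m}"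
    using assms by (intro finsum_addf) auto
  finally show "((p \<oplus>\<^bsub>mpoly_ring R N\<^esub> p') \<otimes>\<^bsub>mpoly_ring R N\<^esub> q) m =
    ((p \<otimes>\<^bsub>mpoly_ring R N\<^esub> q) \<oplus>\<^bsub>mpoly_ring R N\<^esub> (p' \<otimes>\<^bsub>mpoly_ring R N\<^esub> q)) m"
    unfolding mpoly_simps .
qed

lemma mult_add_right:
  assumes "\<And>m. p m \<in> carrier R" "\<And>m. q m \<in> carrier R" "\<And>m. q' m \<in> carrier R"
  shows "p \<otimes>\<^bsub>mpoly_ring R N\<^esub> (q \<oplus>\<^bsub>mpoly_ring R N\<^esub> q') =
    (p \<otimes>\<^bsub>mpoly_ring R N\<^esub> q) \<oplus>\<^bsub>mpoly_ring R N\<^esub> (p \<otimes>\<^bsub>mpoly_ring R N\<^esub> q')"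
proof
  fix m
  have "finsum R (\<lambda>k. p k \<otimes> (q (m - k) \<oplus> q' (m - k))) {k. k \<subseteq># m} =
      finsum R (\<lambda>k. p k \<otimes> q (m - k) \<oplus> p k \<otimes> q' (m - k)) {k. k \<subseteq># m}"
    using assms by (intro finsum_cong') (auto simp: r_distr)
  also have "\<dots> = finsum R (\<lambda>k. p k \<otimes> q (m - k)) {k. k \<subseteq># m} \<oplus>
      finsum R (\<lambda>k. p k \<otimes> q' (m - k)) {k. k \<subseteq># m}"
    using assms by (intro finsum_addf) auto
  finally show "(p \<otimes>\<^bsub>mpoly_ring R N\<^esub> (q \<oplus>\<^bsub>mpoly_ring R N\<^esub> q')) m =
    ((p \<otimes>\<^bsub>mpoly_ring R N\<^esub> q) \<oplus>\<^bsub>mpoly_ring R N\<^esub> (p \<otimes>\<^bsub>mpoly_ring R N\<^esub> q')) m"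
    unfolding mpoly_simps .
qed

lemma mult_pmult_right:
  assumes "\<And>m. p m \<in> carrier R" "\<And>m. q m \<in> carrier R"
  shows "p \<otimes>\<^bsub>mpoly_ring R N\<^esub> indexed_pmult q i = indexed_pmult (p \<otimes>\<^bsub>mpoly_ring R N\<^esub> q) i"
proof
  fix m
  have qc: "indexed_pmult q i k \<in> carrier R" for k using assms unfolding indexed_pmult_def by simp
  show "(p \<otimes>\<^bsub>mpoly_ring R N\<^esub> indexed_pmult q i) m = indexed_pmult (p \<otimes>\<^bsub>mpoly_ring R N\<^esub> q) i m"
  proof (cases "i \<in># m")
    case True
    then obtain m' where m: "m = add_mset i m'" by (metis insert_DiffM)
    have "finsum R (\<lambda>k. p k \<otimes> q (m' - k)) {k. k \<subseteq># m'} =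
        finsum R (\<lambda>k. p k \<otimes> indexed_pmult q i (m - k)) {k. k \<subseteq># m}"
    proof (rule add.finprod_mono_neutral_cong_left)
      show "finite {k. k \<subseteq># m}" by (rule finite_submultisets)
      show "{k. k \<subseteq># m'} \<subseteq> {k. k \<subseteq># m}" unfolding m by (auto intro: subset_mset.order_trans)
      show "(\<lambda>k. p k \<otimes> indexed_pmult q i (m - k)) \<in> {k. k \<subseteq># m} \<rightarrow> carrier R"
        using assms qc by auto
      fix k assume k: "k \<in> {k. k \<subseteq># m'}"
      then obtain l where "m' = k + l" by (auto simp: mset_subset_eq_exists_conv)
      then have "m - k = add_mset i (m' - k)" unfolding m by simp
      then show "p k \<otimes> q (m' - k) = p k \<otimes> indexed_pmult q i (m - k)" unfolding indexed_pmult_def by simp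
    next
      fix k assume k: "k \<in> {k. k \<subseteq># m} - {k. k \<subseteq># m'}"
      have "i \<notin># m - k"
      proof
        assume "i \<in># m - k"
        then obtain l where "m - k = add_mset i l" by (metis insert_DiffM)
        then have "m = k + add_mset i l" using k by (metis DiffD1 mem_Collect_eq subset_mset.add_diff_inverse)
        then have "m' = k + l" unfolding m by simp
        then show False using k by simp
      qed
      then show "p k \<otimes> indexed_pmult q i (m - k) = \<zero>"
        using assms unfolding indexed_pmult_def by simp
    qed
    then show ?thesis using True unfolding mpoly_simps m by (simp add: indexed_pmult_def)
  next
    case False
    have "finsum R (\<lambda>k. p k \<otimes> indexed_pmult q i (m - k)) {k. k \<subseteq># m} = finsum R (\<lambda>k. \<zero>) {k. k \<subseteq># m}"
      using assms False in_diffD[of i m] by (intro finsum_cong') (auto simp: indexed_pmult_def)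
    then show ?thesis using False unfolding mpoly_simps by (simp add: indexed_pmult_def)
  qed
qed

lemma mult_pmult_left:
  assumes "\<And>m. p m \<in> carrier R" "\<And>m. q m \<in> carrier R"
  shows "indexed_pmult p i \<otimes>\<^bsub>mpoly_ring R N\<^esub> q = indexed_pmult (p \<otimes>\<^bsub>mpoly_ring R N\<^esub> q) i"
proof
  fix m
  have pc: "indexed_pmult p i k \<in> carrier R" for k using assms unfolding indexed_pmult_def by simp
  show "(indexed_pmult p i \<otimes>\<^bsub>mpoly_ring R N\<^esub> q) m = indexed_pmult (p \<otimes>\<^bsub>mpoly_ring R N\<^esub> q) i m"
  proof (cases "i \<in># m")
    case True
    then obtain m' where m: "m = add_mset i m'" by (metis insert_DiffM)
    have "finsum R (\<lambda>k. p k \<otimes> q (m' - k)) {k. k \<subseteq># m'} =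
        finsum R (\<lambda>k. indexed_pmult p i (add_mset i k) \<otimes> q (m - add_mset i k)) {k. k \<subseteq># m'}"
      using assms unfolding m by (intro finsum_cong') (auto simp: indexed_pmult_def)
    also have "\<dots> = finsum R (\<lambda>k. indexed_pmult p i k \<otimes> q (m - k)) (add_mset i ` {k. k \<subseteq># m'})"
      using assms pc by (intro finsum_reindex[symmetric]) (auto simp: inj_on_def)
    also have "\<dots> = finsum R (\<lambda>k. indexed_pmult p i k \<otimes> q (m - k)) {k. k \<subseteq># m}"
    proof (rule add.finprod_mono_neutral_cong_left)
      show "finite {k. k \<subseteq># m}" by (rule finite_submultisets)
      show "add_mset i ` {k. k \<subseteq># m'} \<subseteq> {k. k \<subseteq># m}" unfolding m by auto
      show "(\<lambda>k. indexed_pmult p i k \<otimes> q (m - k)) \<in> {k. k \<subseteq># m} \<rightarrow> carrier R"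
        using assms pc by auto
      fix k assume k: "k \<in> {k. k \<subseteq># m} - add_mset i ` {k. k \<subseteq># m'}"
      have "i \<notin># k"
      proof
        assume "i \<in># k"
        then obtain l where l: "k = add_mset i l" by (metis insert_DiffM)
        then have "l \<subseteq># m'" using k m by simp
        then show False using k l by blast
      qed
      then show "indexed_pmult p i k \<otimes> q (m - k) = \<zero>"
        using assms unfolding indexed_pmult_def by simp
    qed simp
    finally show ?thesis using True unfolding mpoly_simps m by (simp add: indexed_pmult_def)
  next
    case False
    have "finsum R (\<lambda>k. indexed_pmult p i k \<otimes> q (m - k)) {k. k \<subseteq># m} = finsum R (\<lambda>k. \<zero>) {k. k \<subseteq># m}"
      using assms False mset_subset_eqD[of _ m i] by (intro finsum_cong') (auto simp: indexed_pmult_def)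
    then show ?thesis using False unfolding mpoly_simps by (simp add: indexed_pmult_def)
  qed
qed

lemma mpoly_smult:
  assumes "r \<in> carrier R" "q \<in> carrier (mpoly_ring R N)"
  shows "(\<lambda>m. r \<otimes> q m) \<in> carrier (mpoly_ring R N)"
  using assms(2)
proof (induction q rule: mpoly_induct)
  case (const s)
  have "(\<lambda>m. r \<otimes> indexed_const s m) = indexed_const (r \<otimes> s)"
    using assms const by (auto simp: indexed_const_def)
  moreover have "indexed_const (r \<otimes> s) \<in> carrier (mpoly_ring R N)"
    using assms const by (intro mpoly_const) simp
  ultimately show ?case by metis
next
  case (add p q)
  have "(\<lambda>m. r \<otimes> (p \<oplus>\<^bsub>mpoly_ring R N\<^esub> q) m) = (\<lambda>m. r \<otimes> p m \<oplus> r \<otimes> q m)"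
    using assms add(1,2) by (auto simp: mpoly_simps(5) r_distr)
  then show ?case using mpoly_add[OF add(3,4)] by simp
next
  case (pmult p i)
  have "(\<lambda>m. r \<otimes> indexed_pmult p i m) = indexed_pmult (\<lambda>m. r \<otimes> p m) i"
    using assms by (auto simp: indexed_pmult_def)
  then show ?case using mpoly_pmult[OF pmult(3,2)] by simp
qed

lemma mpoly_mult_closed:
  assumes "p \<in> carrier (mpoly_ring R N)" "q \<in> carrier (mpoly_ring R N)"
  shows "p \<otimes>\<^bsub>mpoly_ring R N\<^esub> q \<in> carrier (mpoly_ring R N)"
  using assms(1)
proof (induction p rule: mpoly_induct)
  case (const r) then show ?case using mpoly_smult assms(2) by (simp add: mult_const)
next
  case (add p p')
  have "(p \<oplus>\<^bsub>mpoly_ring R N\<^esub> p') \<otimes>\<^bsub>mpoly_ring R N\<^esub> q =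
    (p \<otimes>\<^bsub>mpoly_ring R N\<^esub> q) \<oplus>\<^bsub>mpoly_ring R N\<^esub> (p' \<otimes>\<^bsub>mpoly_ring R N\<^esub> q)"
    using add assms(2) by (intro mult_add_left) auto
  then show ?case using mpoly_add[OF add(3,4)] by (simp add: mpoly_simps(5))
next
  case (pmult p i)
  then show ?case using mpoly_pmult[OF pmult(3,2)] assms(2) by (simp add: mult_pmult_left)
qed

lemma mpoly_mult_comm:
  assumes "p \<in> carrier (mpoly_ring R N)" "q \<in> carrier (mpoly_ring R N)"
  shows "p \<otimes>\<^bsub>mpoly_ring R N\<^esub> q = q \<otimes>\<^bsub>mpoly_ring R N\<^esub> p"
  using assms(1)
proof (induction p rule: mpoly_induct)
  case (const r)
  show ?case using assms(2)
  proof (induction q rule: mpoly_induct)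
    case (const s)
    have "indexed_const r m \<in> carrier R" "indexed_const s m \<in> carrier R" for m
      using const \<open>r \<in> carrier R\<close> by (auto simp: indexed_const_def)
    then have "indexed_const r \<otimes>\<^bsub>mpoly_ring R N\<^esub> indexed_const s = (\<lambda>m. r \<otimes> indexed_const s m)"
      "indexed_const s \<otimes>\<^bsub>mpoly_ring R N\<^esub> indexed_const r = (\<lambda>m. s \<otimes> indexed_const r m)"
      using const \<open>r \<in> carrier R\<close> by (auto intro!: mult_const)
    moreover have "r \<otimes> indexed_const s m = s \<otimes> indexed_const r m" for m :: "nat multiset"
      using const \<open>r \<in> carrier R\<close> m_comm by (auto simp: indexed_const_def)
    ultimately show ?case by (simp add: fun_eq_iff)
  next
    case (add p q)
    have rc: "indexed_const r m \<in> carrier R" for m :: "nat multiset" using \<open>r \<in> carrier R\<close> by (auto simp: indexed_const_def)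
    show ?case using add mult_add_left[of p q "indexed_const r"] mult_add_right[of "indexed_const r" p q] rc by simp
  next
    case (pmult p i)
    have rc: "indexed_const r m \<in> carrier R" for m :: "nat multiset" using \<open>r \<in> carrier R\<close> by (auto simp: indexed_const_def)
    show ?case using pmult mult_pmult_left[of p "indexed_const r"] mult_pmult_right[of "indexed_const r" p] rc by simp
  qed
next
  case (add p p')
  then show ?case using assms(2) mult_add_left[of p p' q] mult_add_right[of q p p'] by simp
next
  case (pmult p i)
  then show ?case using assms(2) mult_pmult_left[of p q] mult_pmult_right[of q p] by simp
qed

lemma mpoly_mult_assoc:
  assumes "p \<in> carrier (mpoly_ring R N)" "q \<in> carrier (mpoly_ring R N)" "s \<in> carrier (mpoly_ring R N)"
  shows "(p \<otimes>\<^bsub>mpoly_ring R N\<^esub> q) \<otimes>\<^bsub>mpoly_ring R N\<^esub> s = p \<otimes>\<^bsub>mpoly_ring R N\<^esub> (q \<otimes>\<^bsub>mpoly_ring R N\<^esub> s)"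
  using assms(1)
proof (induction p rule: mpoly_induct)
  case (const r)
  note qs = mpoly_mult_closed[OF assms(2,3)]
  have "(\<lambda>m. r \<otimes> q m) \<otimes>\<^bsub>mpoly_ring R N\<^esub> s = (\<lambda>m. r \<otimes> (q \<otimes>\<^bsub>mpoly_ring R N\<^esub> s) m)"
  proof
    fix m
    have "finsum R (\<lambda>k. (r \<otimes> q k) \<otimes> s (m - k)) {k. k \<subseteq># m} =
        finsum R (\<lambda>k. r \<otimes> (q k \<otimes> s (m - k))) {k. k \<subseteq># m}"
      using assms const by (intro finsum_cong') (auto simp: m_assoc)
    also have "\<dots> = r \<otimes> finsum R (\<lambda>k. q k \<otimes> s (m - k)) {k. k \<subseteq># m}"
      using assms const finite_submultisets by (intro finsum_rdistr[symmetric]) auto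
    finally show "((\<lambda>m. r \<otimes> q m) \<otimes>\<^bsub>mpoly_ring R N\<^esub> s) m = r \<otimes> (q \<otimes>\<^bsub>mpoly_ring R N\<^esub> s) m"
      unfolding mpoly_simps .
  qed
  then show ?case using mult_const[OF const] assms qs by simp
next
  case (add p p')
  then show ?case
    using assms(2,3) mult_add_left[of p p' q] mpoly_mult_closed
      mult_add_left[of "p \<otimes>\<^bsub>mpoly_ring R N\<^esub> q" "p' \<otimes>\<^bsub>mpoly_ring R N\<^esub> q" s]
      mult_add_left[of p p' "q \<otimes>\<^bsub>mpoly_ring R N\<^esub> s"]
    by (simp add: mult_coeff_closed)
next
  case (pmult p i)
  then show ?case using assms(2,3) by (simp add: mult_pmult_left mult_coeff_closed)
qed

lemma mpoly_cring: "cring (mpoly_ring R N)"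
proof (rule cringI)
  let ?P = "mpoly_ring R N"
  show "abelian_group ?P"
  proof (rule abelian_groupI)
    fix p q s assume p: "p \<in> carrier ?P" and q: "q \<in> carrier ?P" and s: "s \<in> carrier ?P"
    show "p \<oplus>\<^bsub>?P\<^esub> q \<in> carrier ?P" using mpoly_add[OF p q] by (simp add: mpoly_simps(5))
    show "p \<oplus>\<^bsub>?P\<^esub> q \<oplus>\<^bsub>?P\<^esub> s = p \<oplus>\<^bsub>?P\<^esub> (q \<oplus>\<^bsub>?P\<^esub> s)"
      using p q s by (simp add: mpoly_simps(5) a_assoc)
    show "p \<oplus>\<^bsub>?P\<^esub> q = q \<oplus>\<^bsub>?P\<^esub> p" using p q by (simp add: mpoly_simps(5) a_comm)
  next
    show "\<zero>\<^bsub>?P\<^esub> \<in> carrier ?P" using mpoly_const[OF zero_closed] by (simp add: mpoly_simps(4) indexed_zero_def)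
  next
    fix p assume p: "p \<in> carrier ?P"
    show "\<zero>\<^bsub>?P\<^esub> \<oplus>\<^bsub>?P\<^esub> p = p" using p by (simp add: mpoly_simps(4,5))
    have "(\<lambda>m. \<ominus> \<one> \<otimes> p m) \<oplus>\<^bsub>?P\<^esub> p = \<zero>\<^bsub>?P\<^esub>"
      using p by (simp add: mpoly_simps(4,5) l_minus l_neg)
    then show "\<exists>q\<in>carrier ?P. q \<oplus>\<^bsub>?P\<^esub> p = \<zero>\<^bsub>?P\<^esub>" using mpoly_smult[OF _ p, of "\<ominus> \<one>"] by blast
  qed
  show "comm_monoid ?P"
  proof (rule comm_monoidI)
    show "\<one>\<^bsub>?P\<^esub> \<in> carrier ?P" unfolding mpoly_simps(3) by (rule mpoly_const) simp
    fix p assume p: "p \<in> carrier ?P"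
    show "\<one>\<^bsub>?P\<^esub> \<otimes>\<^bsub>?P\<^esub> p = p" unfolding mpoly_simps(3) using p by (simp add: mult_const)
  qed (use mpoly_mult_closed mpoly_mult_assoc mpoly_mult_comm in auto)
  fix p q s assume "p \<in> carrier ?P" "q \<in> carrier ?P" "s \<in> carrier ?P"
  then show "(p \<oplus>\<^bsub>?P\<^esub> q) \<otimes>\<^bsub>?P\<^esub> s = p \<otimes>\<^bsub>?P\<^esub> s \<oplus>\<^bsub>?P\<^esub> q \<otimes>\<^bsub>?P\<^esub> s"
    by (intro mult_add_left) auto
qed

lemma mpoly_finsum:
  assumes "finite A" "F \<in> A \<rightarrow> carrier (mpoly_ring R N)"
  shows "finsum (mpoly_ring R N) F A m = finsum R (\<lambda>j. F j m) A"
proof -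
  interpret P: cring "mpoly_ring R N" by (rule mpoly_cring)
  show ?thesis using assms
  proof (induction A rule: finite_induct)
    case empty then show ?case by (simp add: mpoly_simps(4))
  next
    case (insert j A)
    then have F: "F \<in> A \<rightarrow> carrier (mpoly_ring R N)" "F j \<in> carrier (mpoly_ring R N)" by auto
    have Fx: "F x m \<in> carrier R" if "x \<in> A" for x using that F(1) mpoly_coeff by blast
    have "finsum (mpoly_ring R N) F (insert j A) m = F j m \<oplus> finsum (mpoly_ring R N) F A m"
      using insert(1,2) F by (simp add: mpoly_simps(5))
    also have "\<dots> = F j m \<oplus> finsum R (\<lambda>j. F j m) A" using insert F by simp
    also have "\<dots> = finsum R (\<lambda>j. F j m) (insert j A)"
      using insert(1,2) mpoly_coeff[OF F(2)] Fx by (intro finsum_insert[symmetric]) auto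
    finally show ?case .
  qed
qed

lemma indexed_monomial:
  assumes "set_mset a \<subseteq> {1..N}" "r \<in> carrier R"
  shows "(\<lambda>m. if m = a then r else \<zero>) \<in> carrier (mpoly_ring R N)"
  using assms(1)
proof (induction a)
  case empty
  show ?case using mpoly_const[OF assms(2)] unfolding indexed_const_def .
next
  case (add i a)
  have "(\<lambda>m. if m = add_mset i a then r else \<zero>) = indexed_pmult (\<lambda>m. if m = a then r else \<zero>) i"
    unfolding indexed_pmult_def by (rule ext) (auto dest: multi_member_split)
  then show ?case using add mpoly_pmult by simp
qed

lemma mpoly_support:
  assumes "p \<in> carrier (mpoly_ring R N)" "p m \<noteq> \<zero>"
  shows "set_mset m \<subseteq> {1..N}"
  using assms
proof (induction p arbitrary: m rule: mpoly_induct)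
  case (const r) then show ?case by (auto simp: indexed_const_def split: if_splits)
next
  case (add p q)
  then have "p m \<noteq> \<zero> \<or> q m \<noteq> \<zero>" by (auto simp: mpoly_simps(5))
  then show ?case using add by blast
next
  case (pmult p i)
  then have "i \<in># m" "p (m - {#i#}) \<noteq> \<zero>" by (auto simp: indexed_pmult_def split: if_splits)
  then show ?case using pmult by (metis insert_DiffM insert_subset set_mset_add_mset_insert)
qed

lemma mpoly_finite_support:
  assumes "p \<in> carrier (mpoly_ring R N)"
  shows "finite {m. p m \<noteq> \<zero>}"
  using assms
proof (induction p rule: mpoly_induct)
  case (const r)
  have "{m. indexed_const r m \<noteq> \<zero>} \<subseteq> {{#}}" by (auto simp: indexed_const_def split: if_splits)
  then show ?case using finite_subset by blast
next
  case (add p q)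
  have "{m. (p \<oplus>\<^bsub>mpoly_ring R N\<^esub> q) m \<noteq> \<zero>} \<subseteq> {m. p m \<noteq> \<zero>} \<union> {m. q m \<noteq> \<zero>}"
    by (auto simp: mpoly_simps(5))
  then show ?case using add by (metis (no_types, lifting) finite_UnI finite_subset)
next
  case (pmult p i)
  have "{m. indexed_pmult p i m \<noteq> \<zero>} \<subseteq> add_mset i ` {m. p m \<noteq> \<zero>}"
  proof
    fix m assume "m \<in> {m. indexed_pmult p i m \<noteq> \<zero>}"
    then have "i \<in># m" "p (m - {#i#}) \<noteq> \<zero>" by (auto simp: indexed_pmult_def split: if_splits)
    then show "m \<in> add_mset i ` {m. p m \<noteq> \<zero>}" by (intro image_eqI[of _ _ "m - {#i#}"]) auto
  qed
  then show ?case using pmult by (metis (no_types, lifting) finite_imageI finite_subset)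
qed

lemma mpolyI:
  assumes "finite A" "\<And>m. m \<in> A \<Longrightarrow> set_mset m \<subseteq> {1..N}" "\<And>m. m \<notin> A \<Longrightarrow> p m = \<zero>" "\<And>m. p m \<in> carrier R"
  shows "p \<in> carrier (mpoly_ring R N)"
  using assms
proof (induction A arbitrary: p rule: finite_induct)
  case empty
  then have "p = indexed_const \<zero>" by (auto simp: indexed_zero_def)
  then show ?case using mpoly_const by simp
next
  case (insert a A)
  have "(\<lambda>m. if m = a then \<zero> else p m) \<in> carrier (mpoly_ring R N)"
    using insert by (intro insert.IH) auto
  moreover have "(\<lambda>m. if m = a then p a else \<zero>) \<in> carrier (mpoly_ring R N)"
    using insert.prems by (intro indexed_monomial) auto
  ultimately have "(\<lambda>m. (if m = a then \<zero> else p m) \<oplus> (if m = a then p a else \<zero>)) \<in> carrier (mpoly_ring R N)"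
    by (rule mpoly_add)
  moreover have "(\<lambda>m. (if m = a then \<zero> else p m) \<oplus> (if m = a then p a else \<zero>)) = p"
    using insert.prems(3) by auto
  ultimately show ?case by simp
qed

lemma total_degree_le_iff: "total_degree R p \<le> ereal (real b) \<longleftrightarrow> (\<forall>m. p m \<noteq> \<zero> \<longrightarrow> size m \<le> b)"
  unfolding total_degree_def by (auto simp: SUP_le_iff)

lemma solutions_iff:
  "y \<in> solutions R N n f \<longleftrightarrow> y \<in> {1..n} \<rightarrow>\<^sub>E carrier (mpoly_ring R N) \<and>
     finsum (mpoly_ring R N) (\<lambda>j. f j \<otimes>\<^bsub>mpoly_ring R N\<^esub> y j) {1..n} = \<zero>\<^bsub>mpoly_ring R N\<^esub>"
  unfolding solutions_def cring.free_module_simps[OF mpoly_cring] by auto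

lemma solutions_submodule:
  assumes f: "f \<in> {1..n} \<rightarrow> carrier (mpoly_ring R N)"
  shows "submodule (solutions R N n f) (mpoly_ring R N) (free_module (mpoly_ring R N) {1..n})"
proof -
  let ?P = "mpoly_ring R N" and ?F = "free_module (mpoly_ring R N) {1..n}"
  interpret P: cring ?P by (rule mpoly_cring)
  interpret F: module ?P ?F by (rule P.free_module_is_module)
  have fc: "f j \<in> carrier ?P" if "j \<in> {1..n}" for j using f that by auto
  have yc: "y j \<in> carrier ?P" if "y \<in> solutions R N n f" "j \<in> {1..n}" for y j
    using that unfolding solutions_iff by auto
  have ext: "finsum ?P (\<lambda>j. f j \<otimes>\<^bsub>?P\<^esub> (\<lambda>j\<in>{1..n}. g j) j) {1..n} = finsum ?P (\<lambda>j. f j \<otimes>\<^bsub>?P\<^esub> g j) {1..n}"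
    if "\<And>j. j \<in> {1..n} \<Longrightarrow> g j \<in> carrier ?P" for g
    using that fc by (intro P.finsum_cong') auto
  have add: "a \<oplus>\<^bsub>?F\<^esub> b \<in> solutions R N n f" if "a \<in> solutions R N n f" "b \<in> solutions R N n f" for a b
  proof -
    have "finsum ?P (\<lambda>j. f j \<otimes>\<^bsub>?P\<^esub> (a j \<oplus>\<^bsub>?P\<^esub> b j)) {1..n} =
      finsum ?P (\<lambda>j. f j \<otimes>\<^bsub>?P\<^esub> a j \<oplus>\<^bsub>?P\<^esub> f j \<otimes>\<^bsub>?P\<^esub> b j) {1..n}"
      using fc yc[OF that(1)] yc[OF that(2)] by (intro P.finsum_cong') (auto simp: P.r_distr)
    also have "\<dots> = finsum ?P (\<lambda>j. f j \<otimes>\<^bsub>?P\<^esub> a j) {1..n} \<oplus>\<^bsub>?P\<^esub> finsum ?P (\<lambda>j. f j \<otimes>\<^bsub>?P\<^esub> b j) {1..n}"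
      using fc yc[OF that(1)] yc[OF that(2)] by (intro P.finsum_addf) auto
    also have "\<dots> = \<zero>\<^bsub>?P\<^esub>" using that unfolding solutions_iff by simp
    finally show ?thesis using ext[of "\<lambda>j. a j \<oplus>\<^bsub>?P\<^esub> b j"] yc[OF that(1)] yc[OF that(2)]
      unfolding solutions_iff P.free_module_simps by auto
  qed
  have smult: "a \<odot>\<^bsub>?F\<^esub> y \<in> solutions R N n f" if "a \<in> carrier ?P" "y \<in> solutions R N n f" for a y
  proof -
    have "finsum ?P (\<lambda>j. f j \<otimes>\<^bsub>?P\<^esub> (a \<otimes>\<^bsub>?P\<^esub> y j)) {1..n} =
      finsum ?P (\<lambda>j. a \<otimes>\<^bsub>?P\<^esub> (f j \<otimes>\<^bsub>?P\<^esub> y j)) {1..n}"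
      using fc yc[OF that(2)] that(1) by (intro P.finsum_cong') (auto simp: P.m_lcomm)
    also have "\<dots> = a \<otimes>\<^bsub>?P\<^esub> finsum ?P (\<lambda>j. f j \<otimes>\<^bsub>?P\<^esub> y j) {1..n}"
      using fc yc[OF that(2)] that(1) by (intro P.finsum_rdistr[symmetric]) auto
    also have "\<dots> = \<zero>\<^bsub>?P\<^esub>" using that unfolding solutions_iff by simp
    finally show ?thesis using ext[of "\<lambda>j. a \<otimes>\<^bsub>?P\<^esub> y j"] yc[OF that(2)] that(1)
      unfolding solutions_iff P.free_module_simps by auto
  qed
  show ?thesis
  proof (rule F.submodule_by_closure[OF _ _ add smult])
    show "solutions R N n f \<subseteq> carrier ?F" unfolding solutions_def by auto
    have "finsum ?P (\<lambda>j. f j \<otimes>\<^bsub>?P\<^esub> \<zero>\<^bsub>?P\<^esub>) {1..n} = finsum ?P (\<lambda>j. \<zero>\<^bsub>?P\<^esub>) {1..n}"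
      using fc by (intro P.finsum_cong') auto
    then show "\<zero>\<^bsub>?F\<^esub> \<in> solutions R N n f" using ext[of "\<lambda>j. \<zero>\<^bsub>?P\<^esub>"]
      unfolding solutions_iff P.free_module_simps by auto
  qed
qed

lemma generated_in_degreeI:
  assumes f: "f \<in> {1..n} \<rightarrow> carrier (mpoly_ring R N)"
    and "finite G" "G \<subseteq> solutions R N n f" "\<And>y j. y \<in> G \<Longrightarrow> j \<in> {1..n} \<Longrightarrow> total_degree R (y j) \<le> ereal (real b)"
    and "\<And>H. submodule H (mpoly_ring R N) (free_module (mpoly_ring R N) {1..n}) \<Longrightarrow> G \<subseteq> H \<Longrightarrow>
      solutions R N n f \<subseteq> H"
  shows "generated_in_degree R N n f b"
proof -
  have "generated_submodule (mpoly_ring R N) (free_module (mpoly_ring R N) {1..n}) G = solutions R N n f"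
    unfolding generated_submodule_def
  proof (rule equalityI)
    show "(\<lambda>H. submodule H (mpoly_ring R N) (free_module (mpoly_ring R N) {1..n})) hull G \<subseteq> solutions R N n f"
      unfolding hull_def by (rule Inter_lower) (use assms(3) solutions_submodule[OF f] in simp)
    show "solutions R N n f \<subseteq> (\<lambda>H. submodule H (mpoly_ring R N) (free_module (mpoly_ring R N) {1..n})) hull G"
      unfolding hull_def by (rule Inter_greatest) (use assms(5) in simp)
  qed
  then show ?thesis unfolding generated_in_degree_def using assms(2,3,4) by (intro exI[of _ G]) simp
qed

end

section \<open>The graded module of syzygies\<close>

definition (in ring) coord_space :: "'q set \<Rightarrow> ('q \<Rightarrow> 'a) set" where
  "coord_space Q = {y. (\<forall>q. y q \<in> carrier R) \<and> (\<forall>q. q \<notin> Q \<longrightarrow> y q = \<zero>)}"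

definition (in ring) unit_vector :: "'q \<Rightarrow> 'q \<Rightarrow> 'a" where
  "unit_vector q = (\<lambda>p. if p = q then \<one> else \<zero>)"

context cring
begin

lemma coord_space_submodule: "coord_submodule Q (coord_space Q)"
  unfolding coord_submodule_def coord_space_def by auto

lemma unit_vector_in: "q \<in> Q \<Longrightarrow> unit_vector q \<in> coord_space Q"
  unfolding coord_space_def unit_vector_def by auto

text \<open>
  The coordinate vectors span; they are removed one by one from the support of \<open>y\<close>.
\<close>

lemma coord_space_lspan:
  assumes "finite Q" "y \<in> coord_space Q"
  shows "y \<in> lspan (unit_vector ` Q)"
  using assms
proof (induction Q arbitrary: y rule: finite_induct)
  case empty
  then have "y = (\<lambda>_. \<zero>)" unfolding coord_space_def by auto
  then show ?case using lspan.zero by metis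
next
  case (insert q Q)
  define z where "z = (\<lambda>p. if p = q then \<zero> else y p)"
  have yc: "y p \<in> carrier R" for p using insert.prems unfolding coord_space_def by auto
  have "z \<in> coord_space Q" using insert.prems unfolding coord_space_def z_def by auto
  then have "z \<in> lspan (unit_vector ` Q)" by (rule insert.IH)
  then have "z \<in> lspan (unit_vector ` insert q Q)"
    by (rule subsetD[OF lspan_mono[OF image_mono[OF subset_insertI]]])
  then have "(\<lambda>p. z p \<oplus> y q \<otimes> unit_vector q p) \<in> lspan (unit_vector ` insert q Q)"
    using yc by (intro lspan.add) auto
  moreover have "(\<lambda>p. z p \<oplus> y q \<otimes> unit_vector q p) = y"
    unfolding z_def unit_vector_def using yc by auto
  ultimately show ?case by simp
qed

lemma lspan_image:
  assumes L: "coord_submodule Q L" and \<phi>: "\<And>p. linear_on L (\<lambda>y. \<phi> y p)" and G: "G \<subseteq> L" and "y \<in> lspan G"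
  shows "\<phi> y \<in> lspan (\<phi> ` G)"
  using assms(4)
proof induction
  case zero
  have "\<phi> (\<lambda>_. \<zero>) = (\<lambda>_. \<zero>)"
    using linear_on_zero[OF \<phi> coord_submoduleD(1)[OF L]] by (rule ext)
  then show ?case using lspan.zero by metis
next
  case (add y g r)
  have yL: "y \<in> L" and gL: "g \<in> L" using lspan_least[OF L G] add G by auto
  have "\<phi> (\<lambda>q. \<one> \<otimes> y q \<oplus> r \<otimes> g q) p = \<one> \<otimes> \<phi> y p \<oplus> r \<otimes> \<phi> g p" for p
    using linear_onD(2)[OF \<phi> yL gL one_closed add(3)] .
  then have "\<phi> (\<lambda>q. y q \<oplus> r \<otimes> g q) = (\<lambda>p. \<phi> y p \<oplus> r \<otimes> \<phi> g p)"
    using coord_submoduleD(2)[OF L yL] linear_onD(1)[OF \<phi> yL] by (intro ext) simp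
  moreover have "(\<lambda>p. \<phi> y p \<oplus> r \<otimes> \<phi> g p) \<in> lspan (\<phi> ` G)"
    using add by (intro lspan.add) auto
  ultimately show ?case by simp
qed

end

lemma (in domain) leads_coord_space:
  fixes Q :: "'q::linorder set"
  shows "leads {\<zero>} (coord_space Q) = Q"
proof
  show "leads {\<zero>} (coord_space Q) \<subseteq> Q"
    by (rule leads_subset[OF coord_space_submodule zero_ideal])
  show "Q \<subseteq> leads {\<zero>} (coord_space Q)"
  proof
    fix q assume "q \<in> Q"
    then show "q \<in> leads {\<zero>} (coord_space Q)"
      by (intro leadsI[OF unit_vector_in]) (auto simp: unit_vector_def)
  qed
qed

text \<open>
  The monomial with \<open>x\<^sub>0\<close> replaced by \<open>1\<close>. The indeterminates of \<open>mpoly_ring R N\<close> are numbered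
  from \<open>1\<close>, so the index \<open>0\<close> is free for the homogenizing variable.
\<close>

abbreviation strip :: "nat multiset \<Rightarrow> nat multiset" where
  "strip b \<equiv> filter_mset (\<lambda>i. i \<noteq> 0) b"

lemma strip_pad: "0 \<notin># a \<Longrightarrow> strip (a + replicate_mset k 0) = a"
  by (rule multiset_eqI) (auto simp: not_in_iff)

text \<open>
  The equation of the theorem, to be homogenized in degree \<open>d\<close>. Then solutions of degree at most
  \<open>s\<close> become the homogeneous solutions of degree \<open>s\<close>, and the multiplication by \<open>x\<^sub>0\<close> is the
  inclusion of the solutions of degree at most \<open>s\<close> in those of degree at most \<open>s + 1\<close>.
\<close>

locale homogeneous_equation = domain R for R (structure) +
  fixes N n d :: nat and f :: "nat \<Rightarrow> nat multiset \<Rightarrow> 'a"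
  assumes f: "f \<in> {1..n} \<rightarrow> carrier (mpoly_ring R N)"
    and deg_f: "\<And>j m. j \<in> {1..n} \<Longrightarrow> f j m \<noteq> \<zero> \<Longrightarrow> size m \<le> d"
begin

abbreviation "Pol \<equiv> mpoly_ring R N"

sublocale Pol: cring Pol by (rule mpoly_cring)

lemma f_carrier: "j \<in> {1..n} \<Longrightarrow> f j \<in> carrier Pol" using f by auto

text \<open>
  Component \<open>j\<close> of a homogeneous vector of degree \<open>s\<close> at \<open>x\<^sub>0 = 1\<close>: the coefficient of \<open>x\<^sup>a\<close> is
  the coefficient at \<open>a\<close> filled up with copies of \<open>0\<close> to size \<open>s\<close>.
\<close>

definition dehom :: "nat \<Rightarrow> (nat \<times> nat multiset \<Rightarrow> 'a) \<Rightarrow> nat \<Rightarrow> nat multiset \<Rightarrow> 'a" where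
  "dehom s y j = (\<lambda>a. if 0 \<notin># a \<and> size a \<le> s then y (j, a + replicate_mset (s - size a) 0) else \<zero>)"

definition lincomb :: "nat \<Rightarrow> (nat \<times> nat multiset \<Rightarrow> 'a) \<Rightarrow> nat multiset \<Rightarrow> 'a" where
  "lincomb s y = finsum Pol (\<lambda>j. f j \<otimes>\<^bsub>Pol\<^esub> dehom s y j) {1..n}"

text \<open>
  The left-hand side of the homogenized equation, homogeneous of degree \<open>s + d\<close>. Its coefficients
  are placed in coordinate \<open>0\<close>, away from the coordinates \<open>1, \<dots>, n\<close> of the solutions.
\<close>

definition phi :: "nat \<Rightarrow> (nat \<times> nat multiset \<Rightarrow> 'a) \<Rightarrow> nat \<times> nat multiset \<Rightarrow> 'a" where
  "phi s y = (\<lambda>(j, b). if j = 0 \<and> b \<in> monoms N (s + d) then lincomb s y (strip b) else \<zero>)"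

abbreviation positions :: "nat \<Rightarrow> (nat \<times> nat multiset) set" where
  "positions s \<equiv> {1..n} \<times> monoms N s"

abbreviation space :: "nat \<Rightarrow> (nat \<times> nat multiset \<Rightarrow> 'a) set" where
  "space s \<equiv> coord_space (positions s)"

definition syz :: "nat \<Rightarrow> (nat \<times> nat multiset \<Rightarrow> 'a) set" where
  "syz s = {y \<in> space s. phi s y = (\<lambda>_. \<zero>)}"

text \<open>
  The part of degree \<open>t\<close> of the ideal generated by the homogenized \<open>f\<^sub>j\<close>.
\<close>

definition im :: "nat \<Rightarrow> (nat \<times> nat multiset \<Rightarrow> 'a) set" where
  "im t = (if d \<le> t then phi (t - d) ` space (t - d) else {\<lambda>_. \<zero>})"

lemma finite_pos: "finite (positions s)" using finite_monoms by simp

lemma spaceD: "y \<in> space s \<Longrightarrow> y q \<in> carrier R" "y \<in> space s \<Longrightarrow> q \<notin> positions s \<Longrightarrow> y q = \<zero>"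
  unfolding coord_space_def by auto

lemma dehom_closed:
  assumes "y \<in> space s"
  shows "dehom s y j \<in> carrier Pol"
proof (rule mpolyI[of "strip ` monoms N s"])
  show "finite (strip ` monoms N s)" using finite_monoms by simp
  fix m
  { assume "m \<in> strip ` monoms N s" then show "set_mset m \<subseteq> {1..N}" unfolding monoms_def by fastforce }
  show "dehom s y j m \<in> carrier R" unfolding dehom_def using spaceD(1)[OF assms] by simp
  assume m: "m \<notin> strip ` monoms N s"
  show "dehom s y j m = \<zero>"
  proof (rule ccontr)
    assume "dehom s y j m \<noteq> \<zero>"
    then have m0: "0 \<notin># m" "y (j, m + replicate_mset (s - size m) 0) \<noteq> \<zero>"
      unfolding dehom_def by (auto split: if_splits)
    then have "m + replicate_mset (s - size m) 0 \<in> monoms N s" using spaceD(2)[OF assms] by blast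
    then show False using m strip_pad[OF m0(1)] by (metis image_eqI)
  qed
qed

lemma dehom_degree: "dehom s y j m \<noteq> \<zero> \<Longrightarrow> size m \<le> s"
  unfolding dehom_def by (auto split: if_splits)

lemma lincomb_closed: "y \<in> space s \<Longrightarrow> lincomb s y \<in> carrier Pol"
  unfolding lincomb_def using dehom_closed f_carrier by (intro Pol.finsum_closed) auto

lemma mult_degree:
  assumes "\<And>m. p m \<in> carrier R" "\<And>m. q m \<in> carrier R" "\<And>m. p m \<noteq> \<zero> \<Longrightarrow> size m \<le> u" "\<And>m. q m \<noteq> \<zero> \<Longrightarrow> size m \<le> v"
    "(p \<otimes>\<^bsub>Pol\<^esub> q) m \<noteq> \<zero>"
  shows "size m \<le> u + v"
proof (rule ccontr)
  assume *: "\<not> ?thesis"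
  have "p k \<otimes> q (m - k) = \<zero>" if "k \<subseteq># m" for k
  proof -
    have "size m = size k + size (m - k)" using that by (metis size_union subset_mset.add_diff_inverse)
    then have "p k = \<zero> \<or> q (m - k) = \<zero>" using * assms(3)[of k] assms(4)[of "m - k"] by linarith
    then show ?thesis using assms(1)[of k] assms(2)[of "m - k"] by auto
  qed
  then have "finsum R (\<lambda>k. p k \<otimes> q (m - k)) {k. k \<subseteq># m} = finsum R (\<lambda>k. \<zero>) {k. k \<subseteq># m}"
    by (intro finsum_cong') auto
  then show False using assms(5) unfolding mpoly_simps by simp
qed

lemma lincomb_degree:
  assumes y: "y \<in> space s" and "lincomb s y m \<noteq> \<zero>"
  shows "size m \<le> s + d"
proof (rule ccontr)
  assume *: "\<not> ?thesis"
  have "(f j \<otimes>\<^bsub>Pol\<^esub> dehom s y j) m = \<zero>" if j: "j \<in> {1..n}" for j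
  proof (rule ccontr)
    assume ne: "(f j \<otimes>\<^bsub>Pol\<^esub> dehom s y j) m \<noteq> \<zero>"
    have "size m \<le> d + s"
    proof (rule mult_degree[OF _ _ _ _ ne])
      show "f j m \<in> carrier R" "dehom s y j m \<in> carrier R" for m
        using mpoly_coeff[OF f_carrier[OF j]] mpoly_coeff[OF dehom_closed[OF y]] by auto
    qed (use deg_f[OF j] dehom_degree in auto)
    then show False using * by simp
  qed
  then have "finsum R (\<lambda>j. (f j \<otimes>\<^bsub>Pol\<^esub> dehom s y j) m) {1..n} = finsum R (\<lambda>j. \<zero>) {1..n}"
    by (intro finsum_cong') auto
  moreover have "lincomb s y m = finsum R (\<lambda>j. (f j \<otimes>\<^bsub>Pol\<^esub> dehom s y j) m) {1..n}"
    unfolding lincomb_def using dehom_closed[OF y] f_carrier by (intro mpoly_finsum) auto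
  ultimately show False using assms(2) by simp
qed

text \<open>
  The value of the equation has degree at most \<open>s + d\<close>, so nothing is lost by homogenizing it.
\<close>

lemma phi_zero_iff:
  assumes y: "y \<in> space s"
  shows "phi s y = (\<lambda>_. \<zero>) \<longleftrightarrow> lincomb s y = \<zero>\<^bsub>Pol\<^esub>"
proof
  assume *: "phi s y = (\<lambda>_. \<zero>)"
  have "lincomb s y a = \<zero>" for a
  proof (rule ccontr)
    assume a: "lincomb s y a \<noteq> \<zero>"
    then have sz: "size a \<le> s + d" by (rule lincomb_degree[OF y])
    have sub: "set_mset a \<subseteq> {1..N}" using mpoly_support[OF lincomb_closed[OF y] a] .
    then have a0: "0 \<notin># a" by auto
    have "a + replicate_mset (s + d - size a) 0 \<in> monoms N (s + d)"
      using sz sub unfolding monoms_def by auto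
    then have "phi s y (0, a + replicate_mset (s + d - size a) 0) = lincomb s y a"
      unfolding phi_def using strip_pad[OF a0] by simp
    then show False using a * by simp
  qed
  then show "lincomb s y = \<zero>\<^bsub>Pol\<^esub>" unfolding mpoly_simps by (rule ext)
next
  assume "lincomb s y = \<zero>\<^bsub>Pol\<^esub>"
  then show "phi s y = (\<lambda>_. \<zero>)" unfolding phi_def mpoly_simps by auto
qed

lemma smult_as_mult:
  assumes "r \<in> carrier R" "p \<in> carrier Pol"
  shows "(\<lambda>m. r \<otimes> p m) = indexed_const r \<otimes>\<^bsub>Pol\<^esub> p"
  using mult_const[OF assms(1), of p] assms(2) by simp

lemma dehom_linear:
  assumes y: "y \<in> space s" and z: "z \<in> space s" and a: "a \<in> carrier R" and b: "b \<in> carrier R"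
  shows "dehom s (\<lambda>q. a \<otimes> y q \<oplus> b \<otimes> z q) j =
    indexed_const a \<otimes>\<^bsub>Pol\<^esub> dehom s y j \<oplus>\<^bsub>Pol\<^esub> indexed_const b \<otimes>\<^bsub>Pol\<^esub> dehom s z j"
  unfolding smult_as_mult[OF a dehom_closed[OF y], symmetric] smult_as_mult[OF b dehom_closed[OF z], symmetric]
  using a b by (auto simp: dehom_def mpoly_simps(5))

lemma lincomb_linear:
  assumes y: "y \<in> space s" and z: "z \<in> space s" and a: "a \<in> carrier R" and b: "b \<in> carrier R"
  shows "lincomb s (\<lambda>q. a \<otimes> y q \<oplus> b \<otimes> z q) m = a \<otimes> lincomb s y m \<oplus> b \<otimes> lincomb s z m"
proof -
  let ?a = "indexed_const a" and ?b = "indexed_const b"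
  have c: "?a \<in> carrier Pol" "?b \<in> carrier Pol" using mpoly_const a b by auto
  note dy = dehom_closed[OF y] and dz = dehom_closed[OF z]
  have "lincomb s (\<lambda>q. a \<otimes> y q \<oplus> b \<otimes> z q) = finsum Pol (\<lambda>j.
      ?a \<otimes>\<^bsub>Pol\<^esub> (f j \<otimes>\<^bsub>Pol\<^esub> dehom s y j) \<oplus>\<^bsub>Pol\<^esub> ?b \<otimes>\<^bsub>Pol\<^esub> (f j \<otimes>\<^bsub>Pol\<^esub> dehom s z j)) {1..n}"
    unfolding lincomb_def dehom_linear[OF assms]
    using c dy dz f_carrier by (intro Pol.finsum_cong') (auto simp: Pol.r_distr Pol.m_lcomm)
  also have "\<dots> = finsum Pol (\<lambda>j. ?a \<otimes>\<^bsub>Pol\<^esub> (f j \<otimes>\<^bsub>Pol\<^esub> dehom s y j)) {1..n} \<oplus>\<^bsub>Pol\<^esub>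
      finsum Pol (\<lambda>j. ?b \<otimes>\<^bsub>Pol\<^esub> (f j \<otimes>\<^bsub>Pol\<^esub> dehom s z j)) {1..n}"
    using c dy dz f_carrier by (intro Pol.finsum_addf) auto
  also have "finsum Pol (\<lambda>j. ?a \<otimes>\<^bsub>Pol\<^esub> (f j \<otimes>\<^bsub>Pol\<^esub> dehom s y j)) {1..n} = ?a \<otimes>\<^bsub>Pol\<^esub> lincomb s y"
    unfolding lincomb_def using c dy f_carrier by (intro Pol.finsum_rdistr[symmetric]) auto
  also have "finsum Pol (\<lambda>j. ?b \<otimes>\<^bsub>Pol\<^esub> (f j \<otimes>\<^bsub>Pol\<^esub> dehom s z j)) {1..n} = ?b \<otimes>\<^bsub>Pol\<^esub> lincomb s z"
    unfolding lincomb_def using c dz f_carrier by (intro Pol.finsum_rdistr[symmetric]) auto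
  finally show ?thesis
    unfolding smult_as_mult[OF a lincomb_closed[OF y], symmetric] smult_as_mult[OF b lincomb_closed[OF z], symmetric]
    by (simp add: mpoly_simps(5))
qed

lemma phi_linear: "linear_on (space s) (\<lambda>y. phi s y p)"
proof -
  obtain j b where p: "p = (j, b)" by (cases p)
  have "lincomb s y m \<in> carrier R" if "y \<in> space s" for y m
    using mpoly_coeff[OF lincomb_closed[OF that]] .
  then show ?thesis
    unfolding linear_on_def phi_def p using lincomb_linear by simp
qed

lemma dehom_shift0:
  assumes y: "y \<in> space s"
  shows "dehom (Suc s) (shift {#0#} y) j = dehom s y j"
proof
  fix a
  show "dehom (Suc s) (shift {#0#} y) j a = dehom s y j a"
  proof (cases "0 \<notin># a \<and> size a \<le> s")
    case True
    then have "Suc s - size a = Suc (s - size a)" using Suc_diff_le by blast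
    then show ?thesis using True unfolding dehom_def shift_def by simp
  next
    case False
    then show ?thesis unfolding dehom_def shift_def by (auto simp: le_Suc_eq)
  qed
qed

lemma dehom_shift:
  assumes y: "y \<in> space s" and i: "i \<noteq> 0"
  shows "dehom (Suc s) (shift {#i#} y) j = indexed_pmult (dehom s y j) i"
proof
  fix a
  show "dehom (Suc s) (shift {#i#} y) j a = indexed_pmult (dehom s y j) i a"
  proof (cases "i \<in># a")
    case True
    then obtain a' where a: "a = add_mset i a'" by (metis insert_DiffM)
    show ?thesis using i unfolding dehom_def shift_def indexed_pmult_def a by auto
  next
    case False
    then show ?thesis using i unfolding dehom_def shift_def indexed_pmult_def by auto
  qed
qed

lemma lincomb_shift0: "y \<in> space s \<Longrightarrow> lincomb (Suc s) (shift {#0#} y) = lincomb s y"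
  unfolding lincomb_def by (simp add: dehom_shift0)

lemma lincomb_shift:
  assumes y: "y \<in> space s" and i: "i \<in> {1..N}"
  shows "lincomb (Suc s) (shift {#i#} y) = indexed_pmult (lincomb s y) i"
proof
  fix m
  note dy = dehom_closed[OF y]
  have i0: "i \<noteq> 0" using i by auto
  have e: "f j \<otimes>\<^bsub>Pol\<^esub> dehom (Suc s) (shift {#i#} y) j = indexed_pmult (f j \<otimes>\<^bsub>Pol\<^esub> dehom s y j) i" if "j \<in> {1..n}" for j
    unfolding dehom_shift[OF y i0]
    by (rule mult_pmult_right[OF mpoly_coeff[OF f_carrier[OF that]] mpoly_coeff[OF dy]])
  have fd: "f j \<otimes>\<^bsub>Pol\<^esub> dehom s y j \<in> carrier Pol" if "j \<in> {1..n}" for j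
    using f_carrier[OF that] dy by simp
  have eq: "lincomb (Suc s) (shift {#i#} y) = finsum Pol (\<lambda>j. indexed_pmult (f j \<otimes>\<^bsub>Pol\<^esub> dehom s y j) i) {1..n}"
    unfolding lincomb_def using e fd mpoly_pmult[OF _ i] by (intro Pol.finsum_cong') auto
  have "lincomb (Suc s) (shift {#i#} y) m = finsum R (\<lambda>j. indexed_pmult (f j \<otimes>\<^bsub>Pol\<^esub> dehom s y j) i m) {1..n}"
    unfolding eq using fd mpoly_pmult[OF _ i] by (intro mpoly_finsum) auto
  also have "\<dots> = indexed_pmult (lincomb s y) i m"
  proof (cases "i \<in># m")
    case True
    have "lincomb s y (m - {#i#}) = finsum R (\<lambda>j. (f j \<otimes>\<^bsub>Pol\<^esub> dehom s y j) (m - {#i#})) {1..n}"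
      unfolding lincomb_def using fd by (intro mpoly_finsum) auto
    then show ?thesis using True by (simp add: indexed_pmult_def)
  next
    case False then show ?thesis by (simp add: indexed_pmult_def)
  qed
  finally show "lincomb (Suc s) (shift {#i#} y) m = indexed_pmult (lincomb s y) i m" .
qed

lemma space_shift:
  assumes "y \<in> space s" "set_mset c \<subseteq> {..N}"
  shows "shift c y \<in> space (s + size c)"
proof -
  have "shift c y q = \<zero>" if "q \<notin> positions (s + size c)" for q
  proof (rule ccontr)
    assume *: "shift c y q \<noteq> \<zero>"
    obtain j b where q: "q = (j, b)" by (cases q)
    obtain a where a: "b = a + c" "shift c y (j, b) = y (j, a)" using shift_nonzeroD * q by metis
    then have "(j, a) \<in> positions s" using spaceD(2)[OF assms(1)] * q by metis
    then show False using that q a(1) assms(2) unfolding monoms_def by auto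
  qed
  moreover have "shift c y q \<in> carrier R" for q
    using spaceD(1)[OF assms(1)] unfolding shift_def by (cases q) auto
  ultimately show ?thesis unfolding coord_space_def by blast
qed

lemma phi_shift_var:
  assumes y: "y \<in> space s" and i: "i \<le> N"
  shows "phi (Suc s) (shift {#i#} y) = shift {#i#} (phi s y)"
proof (rule ext, clarify)
  fix j b
  have size: "b \<in> monoms N (Suc s + d) \<longleftrightarrow> b - {#i#} \<in> monoms N (s + d)" if ib: "i \<in># b"
  proof -
    obtain b' where b: "b = add_mset i b'" using multi_member_split[OF ib] by (elim exE)
    show ?thesis unfolding b using i by (simp add: monoms_def)
  qed
  show "phi (Suc s) (shift {#i#} y) (j, b) = shift {#i#} (phi s y) (j, b)"
  proof (cases "i \<in># b")
    case True
    then obtain b' where b: "b = add_mset i b'" by (metis insert_DiffM)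
    show ?thesis
    proof (cases "i = 0")
      case True
      then show ?thesis using size b lincomb_shift0[OF y] by (simp add: phi_def shift_def)
    next
      case False
      then have iN: "i \<in> {1..N}" using i by simp
      show ?thesis using size b False lincomb_shift[OF y iN] by (simp add: phi_def shift_def indexed_pmult_def)
    qed
  next
    case False
    have "phi (Suc s) (shift {#i#} y) (j, b) = \<zero>"
    proof (cases "i = 0")
      case True
      show ?thesis
      proof (cases "b \<in> monoms N (Suc s + d)")
        case b: True
        have "strip b = b" by (rule multiset_eqI) (use False True in \<open>auto simp: not_in_iff\<close>)
        moreover have "lincomb s y b = \<zero>" using lincomb_degree[OF y, of b] b unfolding monoms_def by fastforce
        ultimately show ?thesis using lincomb_shift0[OF y] True by (simp add: phi_def)
      qed (simp add: phi_def)
    next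
      case i0: False
      then have iN: "i \<in> {1..N}" using i by simp
      have "i \<notin># b" by (rule False)
      then show ?thesis using lincomb_shift[OF y iN] by (simp add: phi_def indexed_pmult_def)
    qed
    then show ?thesis using False by (simp add: shift_def)
  qed
qed

text \<open>
  \<open>phi\<close> commutes with monomials in all of \<open>x\<^sub>0, \<dots>, x\<^sub>N\<close>; this makes its kernels and its images
  graded submodules.
\<close>

lemma phi_shift:
  assumes "y \<in> space s" "set_mset c \<subseteq> {..N}"
  shows "phi (s + size c) (shift c y) = shift c (phi s y)"
  using assms(2)
proof (induction c)
  case empty then show ?case by (simp add: shift_def)
next
  case (add i c)
  have c: "set_mset c \<subseteq> {..N}" "i \<le> N" using add.prems by auto
  have "shift (add_mset i c) y = shift {#i#} (shift c y)" by (simp add: shift_shift)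
  then have "phi (s + size (add_mset i c)) (shift (add_mset i c) y) = shift {#i#} (phi (s + size c) (shift c y))"
    using phi_shift_var[OF space_shift[OF assms(1) c(1)] c(2)] by simp
  also have "\<dots> = shift (add_mset i c) (phi s y)" using add.IH c by (simp add: shift_shift)
  finally show ?case .
qed

lemma space_submodule: "coord_submodule (positions s) (space s)"
  by (rule coord_space_submodule)

lemma phi_image_submodule: "coord_submodule ({0} \<times> monoms N (s + d)) (phi s ` space s)"
  unfolding coord_submodule_def
proof (intro conjI ballI)
  have "phi s (\<lambda>_. \<zero>) = (\<lambda>_. \<zero>)"
    using linear_on_zero[OF phi_linear coord_submoduleD(1)[OF space_submodule]] by (rule ext)
  then show "(\<lambda>_. \<zero>) \<in> phi s ` space s"
    using coord_submoduleD(1)[OF space_submodule] by (metis image_eqI)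
next
  fix w assume "w \<in> phi s ` space s"
  then obtain y where y: "y \<in> space s" "w = phi s y" by blast
  show "\<forall>q. w q \<in> carrier R" using linear_onD(1)[OF phi_linear y(1)] y(2) by simp
  have "phi s y q = \<zero>" if "q \<notin> {0} \<times> monoms N (s + d)" for q
    using that by (cases q) (auto simp: phi_def)
  then show "\<forall>q. q \<notin> {0} \<times> monoms N (s + d) \<longrightarrow> w q = \<zero>" unfolding y(2) by blast
next
  fix w w' a b assume "w \<in> phi s ` space s" "w' \<in> phi s ` space s" and ab: "a \<in> carrier R" "b \<in> carrier R"
  then obtain y z where y: "y \<in> space s" "w = phi s y" and z: "z \<in> space s" "w' = phi s z" by blast
  have "(\<lambda>q. a \<otimes> w q \<oplus> b \<otimes> w' q) = phi s (\<lambda>q. a \<otimes> y q \<oplus> b \<otimes> z q)"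
    using linear_onD(2)[OF phi_linear y(1) z(1) ab] y(2) z(2) by (intro ext) simp
  then show "(\<lambda>q. a \<otimes> w q \<oplus> b \<otimes> w' q) \<in> phi s ` space s"
    using coord_submoduleD(4)[OF space_submodule y(1) z(1) ab] by blast
qed

lemma syz_submodule: "coord_submodule (positions s) (syz s)"
  unfolding coord_submodule_def
proof (intro conjI ballI)
  have "phi s (\<lambda>_. \<zero>) = (\<lambda>_. \<zero>)"
    using linear_on_zero[OF phi_linear coord_submoduleD(1)[OF space_submodule]] by (rule ext)
  then show "(\<lambda>_. \<zero>) \<in> syz s" using coord_submoduleD(1)[OF space_submodule] unfolding syz_def by simp
next
  fix y assume "y \<in> syz s"
  then have y: "y \<in> space s" unfolding syz_def by simp
  show "\<forall>q. y q \<in> carrier R" "\<forall>q. q \<notin> positions s \<longrightarrow> y q = \<zero>"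
    using spaceD(1)[OF y] spaceD(2)[OF y] by blast+
next
  fix y z a b assume y: "y \<in> syz s" and z: "z \<in> syz s" and ab: "a \<in> carrier R" "b \<in> carrier R"
  have yz: "y \<in> space s" "z \<in> space s" "phi s y = (\<lambda>_. \<zero>)" "phi s z = (\<lambda>_. \<zero>)"
    using y z unfolding syz_def by auto
  have "phi s (\<lambda>q. a \<otimes> y q \<oplus> b \<otimes> z q) = (\<lambda>_. \<zero>)"
    using linear_onD(2)[OF phi_linear yz(1,2) ab] yz(3,4) ab by (intro ext) simp
  then show "(\<lambda>q. a \<otimes> y q \<oplus> b \<otimes> z q) \<in> syz s"
    using coord_submoduleD(4)[OF space_submodule yz(1,2) ab] unfolding syz_def by simp
qed

lemma syz_saturated: "saturated (syz s)"
  unfolding saturated_def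
proof (intro allI impI)
  fix y r assume *: "\<forall>q. y q \<in> carrier R" "r \<in> carrier R" "r \<noteq> \<zero>" "(\<lambda>q. r \<otimes> y q) \<in> syz s"
  have "y q = \<zero>" if "q \<notin> positions s" for q
    using coord_submoduleD(3)[OF syz_submodule *(4) that] * integral by blast
  then have y: "y \<in> space s" using * unfolding coord_space_def by blast
  have "(\<lambda>q. r \<otimes> y q \<oplus> \<zero> \<otimes> y q) = (\<lambda>q. r \<otimes> y q)" using * by simp
  then have "phi s (\<lambda>q. r \<otimes> y q \<oplus> \<zero> \<otimes> y q) = (\<lambda>_. \<zero>)" using * unfolding syz_def by simp
  then have e: "r \<otimes> phi s y p \<oplus> \<zero> \<otimes> phi s y p = \<zero>" for p
    using linear_onD(2)[OF phi_linear y y *(2) zero_closed, of p] by metis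
  have "phi s y p = \<zero>" for p
    using e[of p] linear_onD(1)[OF phi_linear y, of p] *(2,3) integral[of r "phi s y p"] by simp
  then show "y \<in> syz s" using y unfolding syz_def by auto
qed

sublocale im: graded_submodules R N "{0}" im
proof
  fix s
  show "coord_submodule ({0} \<times> monoms N s) (im s)"
    using phi_image_submodule[of "s - d"] unfolding im_def coord_submodule_def by auto
next
  fix y s and c :: "nat multiset" assume y: "y \<in> im s" and c: "set_mset c \<subseteq> {..N}"
  show "shift c y \<in> im (s + size c)"
  proof (cases "d \<le> s")
    case True
    then obtain z where z: "z \<in> space (s - d)" "y = phi (s - d) z" using y unfolding im_def by auto
    have "s - d + size c = s + size c - d" using True by simp
    then have "shift c y = phi (s + size c - d) (shift c z)" "shift c z \<in> space (s + size c - d)"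
      using space_shift[OF z(1) c] phi_shift[OF z(1) c] z(2) by auto
    then show ?thesis using True unfolding im_def by (metis image_eqI trans_le_add1)
  next
    case False
    then have y0: "shift c y = (\<lambda>_. \<zero>)" using y unfolding im_def shift_def by auto
    have "coord_submodule ({0} \<times> monoms N (s + size c)) (im (s + size c))"
      using phi_image_submodule[of "s + size c - d"] unfolding im_def coord_submodule_def by auto
    then show ?thesis unfolding y0 by (rule coord_submoduleD(1))
  qed
qed simp

sublocale syz: graded_submodules R N "{1..n}" syz
proof
  show "coord_submodule (positions s) (syz s)" for s by (rule syz_submodule)
  fix y s and c :: "nat multiset" assume y: "y \<in> syz s" and c: "set_mset c \<subseteq> {..N}"
  then have "y \<in> space s" "phi s y = (\<lambda>_. \<zero>)" unfolding syz_def by auto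
  moreover have "shift c (\<lambda>_. \<zero>) = (\<lambda>_. \<zero>)" unfolding shift_def by auto
  ultimately show "shift c y \<in> syz (s + size c)" using phi_shift[of y s c] space_shift[of y s c] c
    unfolding syz_def by simp
qed simp

lemma split_monom:
  assumes "a \<in> monoms N (u + v)"
  shows "\<exists>b c. a = b + c \<and> b \<in> monoms N u \<and> c \<in> monoms N v"
  using assms
proof (induction v arbitrary: a)
  case 0 then show ?case by (intro exI[of _ a] exI[of _ "{#}"]) (simp add: monoms_def)
next
  case (Suc v)
  then have "a \<noteq> {#}" unfolding monoms_def by auto
  then obtain i a' where a: "a = add_mset i a'" by (metis multiset_cases)
  then have "a' \<in> monoms N (u + v)" "i \<le> N" using Suc.prems unfolding monoms_def by auto
  then obtain b c where "a' = b + c" "b \<in> monoms N u" "c \<in> monoms N v" using Suc.IH by blast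
  then show ?case using a \<open>i \<le> N\<close> by (intro exI[of _ b] exI[of _ "add_mset i c"]) (simp add: monoms_def)
qed

text \<open>
  The ideal is generated by the images of the coordinate vectors in degree \<open>d\<close>, hence by its part
  of any degree \<open>D \<ge> d\<close> from there on.
\<close>

lemma im_generated:
  assumes D: "d \<le> D" "D \<le> t"
  shows "im t \<subseteq> lspan (im.shifted_gens D t {})"
proof
  fix w assume "w \<in> im t"
  then obtain y where y: "y \<in> space (t - d)" "w = phi (t - d) y" using D unfolding im_def by auto
  let ?U = "unit_vector ` positions (t - d) :: (nat \<times> nat multiset \<Rightarrow> 'a) set"
  have "y \<in> lspan ?U" by (rule coord_space_lspan[OF finite_pos y(1)])
  moreover have "?U \<subseteq> space (t - d)" by (rule image_subsetI) (rule unit_vector_in)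
  ultimately have "w \<in> lspan (phi (t - d) ` ?U)"
    unfolding y(2) using lspan_image[OF space_submodule phi_linear, of ?U] by simp
  moreover have "phi (t - d) ` ?U \<subseteq> im.shifted_gens D t {}"
  proof
    fix x assume "x \<in> phi (t - d) ` ?U"
    then obtain j a where a: "j \<in> {1..n}" "a \<in> monoms N (t - d)" "x = phi (t - d) (unit_vector (j, a))" by auto
    have td: "t - d = (D - d) + (t - D)" using D by simp
    then obtain b c where bc: "a = b + c" "b \<in> monoms N (D - d)" "c \<in> monoms N (t - D)"
      using split_monom[of a "D - d" "t - D"] a(2) by auto
    have c: "set_mset c \<subseteq> {..N}" "size c = t - D" using bc unfolding monoms_def by auto
    have u: "unit_vector (j, b) \<in> space (D - d)" using a(1) bc(2) by (intro unit_vector_in) simp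
    have "unit_vector (j, a) = shift c (unit_vector (j, b))"
    proof (rule ext, clarify)
      fix k m
      show "unit_vector (j, a) (k, m) = shift c (unit_vector (j, b)) (k, m)"
      proof (cases "c \<subseteq># m")
        case True
        then obtain m' where "m = m' + c" by (metis subset_mset.diff_add)
        then show ?thesis unfolding unit_vector_def bc(1) by simp
      next
        case False
        then show ?thesis unfolding unit_vector_def bc(1) shift_def by auto
      qed
    qed
    then have x: "x = shift c (phi (D - d) (unit_vector (j, b)))"
      using phi_shift[OF u c(1)] a(3) td c(2) by simp
    have "phi (D - d) (unit_vector (j, b)) \<in> im D" unfolding im_def using D(1) u by simp
    then show "x \<in> im.shifted_gens D t {}" unfolding x using bc(3) by (intro im.shifted_gensI) auto
  qed
  ultimately show "w \<in> lspan (im.shifted_gens D t {})" using lspan_mono by blast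
qed

text \<open>
  The leading monomials of the ideal over the fraction field, in coordinate \<open>0\<close>, and those of the
  syzygies modulo \<open>P\<close>, in the other coordinates.
\<close>

definition lead_set :: "'a set \<Rightarrow> (nat \<times> nat multiset) set" where
  "lead_set P = {(j, a). if j = 0 then (j, a) \<in> leads {\<zero>} (im (size a)) else (j, a) \<in> leads P (syz (size a))}"

lemma leads_im_pos: "(j, a) \<in> leads {\<zero>} (im s) \<Longrightarrow> j = 0 \<and> a \<in> monoms N s"
  using leads_subset[OF im.graded zero_ideal] by blast

lemma leads_syz_pos: "ideal P R \<Longrightarrow> (j, a) \<in> leads P (syz s) \<Longrightarrow> j \<in> {1..n} \<and> a \<in> monoms N s"
  using leads_subset[OF syz.graded] by blast

lemma lead_set_monomial:
  assumes P: "ideal P R"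
  shows "monomial_submodule N n (lead_set P)"
  unfolding monomial_submodule_def
proof (intro allI impI)
  interpret ideal P R by fact
  fix j a assume ja: "(j, a) \<in> lead_set P"
  show "j \<le> n \<and> set_mset a \<subseteq> {..N} \<and> (\<forall>i\<le>N. (j, add_mset i a) \<in> lead_set P)"
  proof (cases "j = 0")
    case True
    then have l: "(0, a) \<in> leads {\<zero>} (im (size a))" using ja unfolding lead_set_def by simp
    then have "(0, add_mset i a) \<in> leads {\<zero>} (im (size (add_mset i a)))" if "i \<le> N" for i
      using im.leads_shift[OF l, of "{#i#}"] that by simp
    then show ?thesis using leads_im_pos[OF l] True unfolding lead_set_def monoms_def by simp
  next
    case False
    then have l: "(j, a) \<in> leads P (syz (size a))" using ja unfolding lead_set_def by simp
    then have "(j, add_mset i a) \<in> leads P (syz (size (add_mset i a)))" if "i \<le> N" for i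
      using syz.leads_shift[OF l, of "{#i#}"] that additive_subgroup.zero_closed[OF additive_subgroup_axioms] by simp
    then show ?thesis using leads_syz_pos[OF P l] False unfolding lead_set_def monoms_def by simp
  qed
qed

lemma lead_set_gap: "gap_property d (lead_set P)"
  unfolding gap_property_def
proof (intro allI impI)
  fix D b
  assume D: "d \<le> D" and low: "\<forall>b. (0, b) \<in> lead_set P \<longrightarrow> D < size b \<longrightarrow> size b \<le> 2 * D \<longrightarrow> decomposable (lead_set P) 0 b"
    and b: "(0, b) \<in> lead_set P" "D < size b"
  have iff: "decomposable (lead_set P) 0 b \<longleftrightarrow> (\<exists>i\<in>#b. (0, b - {#i#}) \<in> leads {\<zero>} (im (size b - 1)))" for b
    unfolding decomposable_def lead_set_def by (auto simp: size_Diff_singleton)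
  have "\<exists>i\<in>#b. (0, b - {#i#}) \<in> leads {\<zero>} (im (size b - 1))"
  proof (rule im.leads_gap[OF im_generated[OF D]])
    show "(0, b) \<in> leads {\<zero>} (im (size b))" using b(1) unfolding lead_set_def by simp
  next
    fix j b assume jb: "(j, b) \<in> leads {\<zero>} (im (size b))" "D < size b" "size b \<le> 2 * D"
    then have "j = 0" using leads_im_pos by blast
    then show "\<exists>i\<in>#b. (j, b - {#i#}) \<in> leads {\<zero>} (im (size b - 1))"
      using low jb iff unfolding lead_set_def by simp
  qed (use b in auto)
  then show "decomposable (lead_set P) 0 b" using iff by blast
qed

text \<open>
  The link between the two parts. Over the fraction field the rank of the syzygies of degree \<open>s\<close>
  and the rank of the ideal in degree \<open>s + d\<close> add up to the number of unknown coefficients, and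
  the former rank is the same modulo \<open>P\<close> since the syzygies are saturated.
\<close>

lemma lead_set_card:
  assumes P: "primeideal P R" "valuative P"
  shows "card (layer (lead_set P) {1..n} s) + card (layer (lead_set P) {0} (s + d)) = n * card (monoms N s)"
proof -
  have id: "ideal P R" using P(1) primeideal.axioms(1) by blast
  have 1: "layer (lead_set P) {1..n} s = leads P (syz s)"
  proof -
    have "(j, a) \<in> layer (lead_set P) {1..n} s \<longleftrightarrow> (j, a) \<in> leads P (syz s)" for j a
    proof -
      have "j \<in> {1..n} \<and> size a = s" if "(j, a) \<in> leads P (syz s)"
        using leads_syz_pos[OF id that] unfolding monoms_def by simp
      then show ?thesis
        unfolding layer_def lead_set_def by (cases "j \<in> {1..n} \<and> size a = s") auto
    qed
    then show ?thesis by (intro Set.set_eqI) (metis surj_pair)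
  qed
  have 2: "layer (lead_set P) {0} (s + d) = leads {\<zero>} (im (s + d))"
  proof -
    have "(j, a) \<in> layer (lead_set P) {0} (s + d) \<longleftrightarrow> (j, a) \<in> leads {\<zero>} (im (s + d))" for j a
    proof -
      have "j = 0 \<and> size a = s + d" if "(j, a) \<in> leads {\<zero>} (im (s + d))"
        using leads_im_pos[OF that] unfolding monoms_def by simp
      then show ?thesis
        unfolding layer_def lead_set_def by (cases "j = 0 \<and> size a = s + d") auto
    qed
    then show ?thesis by (intro Set.set_eqI) (metis surj_pair)
  qed
  have im: "im (s + d) = phi s ` space s" unfolding im_def by simp
  have "card (leads {\<zero>} (space s)) = card (leads {\<zero>} {y \<in> space s. phi s y = (\<lambda>_. \<zero>)}) + card (leads {\<zero>} (phi s ` space s))"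
    by (rule card_leads_rank_nullity[OF finite_pos _ space_submodule phi_image_submodule phi_linear])
      (simp add: finite_monoms)
  then have "n * card (monoms N s) = card (leads {\<zero>} (syz s)) + card (leads {\<zero>} (im (s + d)))"
    unfolding im syz_def leads_coord_space by (simp add: card_cartesian_product)
  then show ?thesis unfolding 1 2
    using card_leads_saturated[OF P finite_pos syz_submodule syz_saturated] by simp
qed

definition tuple :: "nat \<Rightarrow> (nat \<times> nat multiset \<Rightarrow> 'a) \<Rightarrow> nat \<Rightarrow> nat multiset \<Rightarrow> 'a" where
  "tuple s y = (\<lambda>j\<in>{1..n}. dehom s y j)"

lemma tuple_solution:
  assumes "y \<in> syz s"
  shows "tuple s y \<in> solutions R N n f"
proof -
  have y: "y \<in> space s" "lincomb s y = \<zero>\<^bsub>Pol\<^esub>" using assms phi_zero_iff unfolding syz_def by auto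
  have "finsum Pol (\<lambda>j. f j \<otimes>\<^bsub>Pol\<^esub> tuple s y j) {1..n} = lincomb s y"
    unfolding lincomb_def using dehom_closed[OF y(1)] f_carrier
    by (intro Pol.finsum_cong') (auto simp: tuple_def)
  then show ?thesis unfolding solutions_iff using y dehom_closed[OF y(1)] by (auto simp: tuple_def)
qed

text \<open>
  The homogenization in degree \<open>s\<close>.
\<close>

lemma solution_tuple:
  assumes y: "y \<in> solutions R N n f" and s: "\<And>j m. j \<in> {1..n} \<Longrightarrow> y j m \<noteq> \<zero> \<Longrightarrow> size m \<le> s"
  shows "\<exists>z\<in>syz s. tuple s z = y"
proof -
  define z where "z = (\<lambda>(j, a). if (j, a) \<in> positions s then y j (strip a) else \<zero>)"
  have yP: "y j \<in> carrier Pol" if "j \<in> {1..n}" for j using y that unfolding solutions_iff by auto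
  have "z q \<in> carrier R" "q \<notin> positions s \<Longrightarrow> z q = \<zero>" for q
    using mpoly_coeff[OF yP] by (cases q, auto simp: z_def)+
  then have zs: "z \<in> space s" unfolding coord_space_def by blast
  have dz: "dehom s z j = y j" if j: "j \<in> {1..n}" for j
  proof
    fix a
    have zval: "z (j, m) = (if (j, m) \<in> positions s then y j (strip m) else \<zero>)" for m
      unfolding z_def by (rule prod.case)
    show "dehom s z j a = y j a"
    proof (cases "y j a = \<zero>")
      case True
      have "z (j, a + replicate_mset (s - size a) 0) = \<zero>" if "0 \<notin># a"
        unfolding zval strip_pad[OF that] True by simp
      then show ?thesis unfolding dehom_def using True by simp
    next
      case False
      then have "size a \<le> s" "set_mset a \<subseteq> {1..N}" using s[OF j] mpoly_support[OF yP[OF j]] by auto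
      then have a: "0 \<notin># a" "a + replicate_mset (s - size a) 0 \<in> monoms N s" unfolding monoms_def by auto
      have "dehom s z j a = z (j, a + replicate_mset (s - size a) 0)"
        unfolding dehom_def using a(1) \<open>size a \<le> s\<close> by simp
      also have "\<dots> = y j (strip (a + replicate_mset (s - size a) 0))"
        unfolding zval using a(2) j by simp
      finally show ?thesis unfolding strip_pad[OF a(1)] .
    qed
  qed
  have t: "tuple s z = y"
    using y unfolding tuple_def solutions_iff by (intro extensionalityI[of _ "{1..n}"]) (auto simp: dz PiE_iff)
  have "lincomb s z = finsum Pol (\<lambda>j. f j \<otimes>\<^bsub>Pol\<^esub> y j) {1..n}"
    unfolding lincomb_def using dz yP f_carrier by (intro Pol.finsum_cong') auto
  then have "lincomb s z = \<zero>\<^bsub>Pol\<^esub>" using y unfolding solutions_iff by simp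
  then have "z \<in> syz s" using zs phi_zero_iff unfolding syz_def by auto
  then show ?thesis using t by blast
qed

text \<open>
  If every leading monomial in degree \<open>s + 1\<close> modulo a prime ideal is a multiple of one in degree
  \<open>s\<close>, the multiples of the syzygies of degree \<open>s\<close> have all the leading positions, and
  \<open>saturated_eqI\<close> applies.
\<close>

lemma syz_step:
  assumes ar: "arithmetical"
    and dec: "\<And>P j b. primeideal P R \<Longrightarrow> (j, b) \<in> leads P (syz (Suc s)) \<Longrightarrow>
      \<exists>i\<in>#b. (j, b - {#i#}) \<in> leads P (syz s)"
  shows "syz (Suc s) = lspan {shift {#i#} z | i z. i \<le> N \<and> z \<in> syz s}"
proof -
  let ?G = "{shift {#i#} z | i z. i \<le> N \<and> z \<in> syz s}"
  have G: "?G \<subseteq> syz (Suc s)"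
  proof
    fix g assume "g \<in> ?G"
    then obtain i z where "i \<le> N" "z \<in> syz s" "g = shift {#i#} z" by blast
    then show "g \<in> syz (Suc s)" using syz.shift_closed[of z s "{#i#}"] by simp
  qed
  have T: "coord_submodule (positions (Suc s)) (lspan ?G)"
  proof (rule lspan_coord_submodule)
    fix g q assume "g \<in> ?G"
    then have g: "g \<in> syz (Suc s)" using G by blast
    show "g q \<in> carrier R" by (rule coord_submoduleD(2)[OF syz_submodule g])
    show "q \<notin> positions (Suc s) \<Longrightarrow> g q = \<zero>" by (rule coord_submoduleD(3)[OF syz_submodule g])
  qed
  have "lspan ?G = syz (Suc s)"
  proof (rule saturated_eqI[OF ar finite_pos syz_submodule syz_saturated T lspan_least[OF syz_submodule G]])
    fix P assume P: "primeideal P R"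
    then interpret primeideal P R .
    have z0: "\<zero> \<in> P" by (rule additive_subgroup.zero_closed[OF additive_subgroup_axioms])
    show "leads P (syz (Suc s)) \<subseteq> leads P (lspan ?G)"
    proof (clarify)
      fix j b assume jb: "(j, b) \<in> leads P (syz (Suc s))"
      obtain i where i: "i \<in># b" "(j, b - {#i#}) \<in> leads P (syz s)" using dec[OF P jb] by blast
      then obtain z where z: "z \<in> syz s" "z (j, b - {#i#}) \<notin> P" "\<And>q. q > (j, b - {#i#}) \<Longrightarrow> z q \<in> P"
        unfolding leads_def by blast
      have "i \<le> N" using leads_syz_pos[OF is_ideal jb] i(1) unfolding monoms_def by auto
      then have g: "shift {#i#} z \<in> ?G" using z by blast
      then have "shift {#i#} z \<in> lspan ?G"
        using coord_submoduleD(2)[OF syz_submodule] G by (intro lspan_incl) blast+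
      moreover have "shift {#i#} z (j, b) = z (j, b - {#i#})" using i(1) by (simp add: shift_def)
      moreover have "shift {#i#} z q \<in> P" if "q > (j, b)" for q
        using shift_vanish[of j "b - {#i#}" z P "{#i#}" q] z(3) z0 that i(1) by simp
      ultimately show "(j, b) \<in> leads P (lspan ?G)" using z(2) by (intro leadsI[of "shift {#i#} z"]) auto
    qed
  qed
  then show ?thesis by simp
qed

text \<open>
  Syzygies of degree above \<open>D\<close> are combinations of multiples of those of degree \<open>D\<close> by \<open>syz_step\<close>,
  and the syzygies of degree \<open>D\<close> are a finitely generated \<open>R\<close>-module. Putting \<open>x\<^sub>0 = 1\<close> turns its
  generators into generators of all the solutions.
\<close>

theorem generated_in_bounded_degree:
  assumes ar: "arithmetical"
    and bound: "\<And>Z. monomial_submodule N n Z \<Longrightarrow> gap_property d Z \<Longrightarrow>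
      (\<And>s. card (layer Z {1..n} s) + card (layer Z {0} (s + d)) = n * card (monoms N s)) \<Longrightarrow>
      (\<forall>j b. (j, b) \<in> Z \<longrightarrow> 1 \<le> j \<longrightarrow> D < size b \<longrightarrow> decomposable Z j b)"
  shows "generated_in_degree R N n f D"
proof -
  have step: "syz (Suc s) = lspan {shift {#i#} z | i z. i \<le> N \<and> z \<in> syz s}" if s: "D \<le> s" for s
  proof (rule syz_step[OF ar])
    fix P j b assume P: "primeideal P R" and jb: "(j, b) \<in> leads P (syz (Suc s))"
    have id: "ideal P R" using P primeideal.axioms(1) by blast
    have pos: "j \<in> {1..n}" "b \<in> monoms N (Suc s)" using leads_syz_pos[OF id jb] by auto
    then have "(j, b) \<in> lead_set P" using jb unfolding lead_set_def monoms_def by auto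
    then have "decomposable (lead_set P) j b"
      using bound[OF lead_set_monomial[OF id] lead_set_gap lead_set_card[OF P arithmetical_valuative[OF ar P]]]
        pos s unfolding monoms_def by auto
    then obtain i where i: "i \<in># b" "(j, b - {#i#}) \<in> lead_set P" unfolding decomposable_def by blast
    have "size (b - {#i#}) = s" using pos(2) i(1) unfolding monoms_def by (simp add: size_Diff_singleton)
    then have "(j, b - {#i#}) \<in> leads P (syz s)" using i(2) pos(1) unfolding lead_set_def by auto
    then show "\<exists>i\<in>#b. (j, b - {#i#}) \<in> leads P (syz s)" using i(1) by blast
  qed
  obtain G0 where G0: "finite G0" "G0 \<subseteq> syz D" "syz D = lspan G0"
    using saturated_finitely_generated[OF ar finite_pos syz_submodule syz_saturated] by blast
  show ?thesis
  proof (rule generated_in_degreeI[OF f, of "tuple D ` G0"])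
    show "finite (tuple D ` G0)" using G0 by simp
    show "tuple D ` G0 \<subseteq> solutions R N n f" using tuple_solution G0 by blast
    show "total_degree R (y j) \<le> ereal (real D)" if "y \<in> tuple D ` G0" "j \<in> {1..n}" for y j
      using that dehom_degree unfolding total_degree_le_iff tuple_def by auto
  next
    let ?F = "free_module Pol {1..n}"
    fix H assume H: "submodule H Pol ?F" and GH: "tuple D ` G0 \<subseteq> H"
    interpret F: module Pol ?F by (rule Pol.free_module_is_module)
    note HE = F.submoduleE[OF H]
    have smult: "(\<lambda>j\<in>{1..n}. a \<otimes>\<^bsub>Pol\<^esub> v j) \<in> H" if "a \<in> carrier Pol" "v \<in> H" for a v
      using HE(4)[OF that] unfolding Pol.free_module_simps .
    have addH: "(\<lambda>j\<in>{1..n}. u j \<oplus>\<^bsub>Pol\<^esub> v j) \<in> H" if "u \<in> H" "v \<in> H" for u v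
      using HE(5)[OF that] unfolding Pol.free_module_simps .
    have span: "tuple s y \<in> H" if G: "G \<subseteq> syz s" "\<And>g. g \<in> G \<Longrightarrow> tuple s g \<in> H" and y: "y \<in> lspan G" for s G y
      using y
    proof induction
      case zero
      have "tuple s (\<lambda>_. \<zero>) = \<zero>\<^bsub>?F\<^esub>"
        unfolding tuple_def dehom_def Pol.free_module_simps mpoly_simps by (auto simp: restrict_def)
      moreover have "\<zero>\<^bsub>?F\<^esub> \<in> H"
        using subgroup.one_closed[OF submodule.axioms(1)[OF H]] by simp
      ultimately show ?case by simp
    next
      case (add y g r)
      have yg: "y \<in> space s" "g \<in> space s"
        using lspan_least[OF syz_submodule G(1)] add(1,2) G(1) unfolding syz_def by auto
      have rP: "indexed_const r \<in> carrier Pol" using mpoly_const add(3) .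
      have oP: "indexed_const \<one> \<in> carrier Pol" using mpoly_const by simp
      have "(\<lambda>q. y q \<oplus> r \<otimes> g q) = (\<lambda>q. \<one> \<otimes> y q \<oplus> r \<otimes> g q)" using spaceD(1)[OF yg(1)] by simp
      then have "tuple s (\<lambda>q. y q \<oplus> r \<otimes> g q) = (\<lambda>j\<in>{1..n}. (\<lambda>j\<in>{1..n}. indexed_const \<one> \<otimes>\<^bsub>Pol\<^esub> tuple s y j) j
          \<oplus>\<^bsub>Pol\<^esub> (\<lambda>j\<in>{1..n}. indexed_const r \<otimes>\<^bsub>Pol\<^esub> tuple s g j) j)"
        using dehom_linear[OF yg one_closed add(3)] unfolding tuple_def by (auto simp: restrict_def)
      also have "\<dots> \<in> H" by (rule addH[OF smult[OF oP add.IH] smult[OF rP G(2)[OF add(2)]]])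
      finally show ?case .
    qed
    have all: "\<forall>y\<in>syz s. tuple s y \<in> H" if "D \<le> s" for s
      using that
    proof (induction s rule: dec_induct)
      case base
      show ?case unfolding G0(3) using span[OF G0(2)] GH by blast
    next
      case (step s)
      let ?G = "{shift {#i#} z | i z. i \<le> N \<and> z \<in> syz s}"
      have "g \<in> syz (Suc s) \<and> tuple (Suc s) g \<in> H" if "g \<in> ?G" for g
      proof -
        obtain i z where iz: "i \<le> N" "z \<in> syz s" "g = shift {#i#} z" using \<open>g \<in> ?G\<close> by blast
        have zs: "z \<in> space s" using iz unfolding syz_def by simp
        have zH: "tuple s z \<in> H" using step.IH iz by blast
        have "tuple (Suc s) g \<in> H"
        proof (cases "i = 0")
          case True
          have "dehom (Suc s) g = dehom s z" unfolding iz(3) True by (rule ext) (rule dehom_shift0[OF zs])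
          then show ?thesis using zH unfolding tuple_def by simp
        next
          case False
          then have iN: "i \<in> {1..N}" using iz by simp
          have c1: "indexed_const \<one> \<in> carrier Pol" by (rule mpoly_const) simp
          define v where "v = indexed_pmult (indexed_const \<one>) i"
          have vP: "v \<in> carrier Pol" unfolding v_def by (rule mpoly_pmult[OF c1 iN])
          have "v \<otimes>\<^bsub>Pol\<^esub> p = indexed_pmult p i" if "p \<in> carrier Pol" for p
            using mult_pmult_left[of "indexed_const \<one>" p] mult_const[of \<one> p] c1 that unfolding v_def by simp
          then have "tuple (Suc s) g = (\<lambda>j\<in>{1..n}. v \<otimes>\<^bsub>Pol\<^esub> tuple s z j)"
            using dehom_shift[OF zs False] dehom_closed[OF zs] iz unfolding tuple_def by (auto simp: restrict_def)
          then show ?thesis using smult[OF vP zH] by simp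
        qed
        moreover have "g \<in> syz (Suc s)" using syz.shift_closed[OF iz(2), of "{#i#}"] iz by simp
        ultimately show ?thesis by blast
      qed
      then show ?case using span[of ?G "Suc s"] \<open>\<And>s. D \<le> s \<Longrightarrow> syz (Suc s) = _ s\<close> step(1) by blast
    qed
    show "solutions R N n f \<subseteq> H"
    proof
      fix y assume y: "y \<in> solutions R N n f"
      have yP: "y j \<in> carrier Pol" if "j \<in> {1..n}" for j using y that unfolding solutions_iff by auto
      \<comment> \<open>A solution is homogenized in its degree, or in degree \<open>D\<close> if that is larger.\<close>
      define S where "S = insert D (size ` (\<Union>j\<in>{1..n}. {m. y j m \<noteq> \<zero>}))"
      have finS: "finite S" unfolding S_def using mpoly_finite_support[OF yP] by auto
      have "size m \<le> Max S" if "j \<in> {1..n}" "y j m \<noteq> \<zero>" for j m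
      proof (rule Max_ge[OF finS])
        show "size m \<in> S" unfolding S_def using that by blast
      qed
      moreover have "D \<le> Max S" using finS unfolding S_def by (intro Max_ge) auto
      ultimately show "y \<in> H" using solution_tuple[OF y, of "Max S"] all[of "Max S"] by blast
    qed
  qed
qed

end

section \<open>Pruefer domains in terms of pairs of elements\<close>

lemma (in cring) genideal_pair:
  assumes "a \<in> carrier R" "b \<in> carrier R" "x \<in> Idl {a, b}"
  shows "\<exists>p\<in>carrier R. \<exists>q\<in>carrier R. x = p \<otimes> a \<oplus> q \<otimes> b"
proof -
  let ?J = "{p \<otimes> a \<oplus> q \<otimes> b | p q. p \<in> carrier R \<and> q \<in> carrier R}"
  have J: "ideal ?J R"
  proof (rule ideal_by_closure)
    show "?J \<subseteq> carrier R" using assms by auto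
    have "\<zero> = \<zero> \<otimes> a \<oplus> \<zero> \<otimes> b" using assms by simp
    then show "\<zero> \<in> ?J" using zero_closed by blast
  next
    fix x y assume "x \<in> ?J" "y \<in> ?J"
    then obtain p q p' q' where xy: "x = p \<otimes> a \<oplus> q \<otimes> b" "y = p' \<otimes> a \<oplus> q' \<otimes> b"
      and c: "p \<in> carrier R" "q \<in> carrier R" "p' \<in> carrier R" "q' \<in> carrier R" by blast
    have "x \<oplus> y = (p \<oplus> p') \<otimes> a \<oplus> (q \<oplus> q') \<otimes> b" unfolding xy using c assms(1,2) by algebra
    then show "x \<oplus> y \<in> ?J" using c by blast
  next
    fix x r assume "x \<in> ?J" and r: "r \<in> carrier R"
    then obtain p q where x: "x = p \<otimes> a \<oplus> q \<otimes> b" and c: "p \<in> carrier R" "q \<in> carrier R" by blast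
    have "r \<otimes> x = (r \<otimes> p) \<otimes> a \<oplus> (r \<otimes> q) \<otimes> b" unfolding x using c r assms(1,2) by algebra
    then show "r \<otimes> x \<in> ?J" using c r by blast
  qed
  have "a = \<one> \<otimes> a \<oplus> \<zero> \<otimes> b" "b = \<zero> \<otimes> a \<oplus> \<one> \<otimes> b" using assms by auto
  then have "{a, b} \<subseteq> ?J" using one_closed zero_closed by blast
  then have "Idl {a, b} \<subseteq> ?J" by (rule genideal_minimal[OF J])
  then show ?thesis using assms(3) by blast
qed

lemma ideal_module_simps:
  "carrier (ideal_module R I) = I" "\<zero>\<^bsub>ideal_module R I\<^esub> = \<zero>\<^bsub>R\<^esub>"
  "x \<oplus>\<^bsub>ideal_module R I\<^esub> y = x \<oplus>\<^bsub>R\<^esub> y" "a \<odot>\<^bsub>ideal_module R I\<^esub> x = a \<otimes>\<^bsub>R\<^esub> x"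
  by (auto simp: ideal_module_def)

text \<open>
  The dual basis of a projective ideal. A projection \<open>\<pi>\<close> of a free module onto the ideal and the
  coordinates of the embedding \<open>h\<close> express each element as \<open>y = \<Sum>\<^sub>i h(y)\<^sub>i \<pi>(e\<^sub>i)\<close>, and linear
  forms on an ideal satisfy \<open>a h(b)\<^sub>i = b h(a)\<^sub>i\<close>. Write \<open>\<pi>(e\<^sub>i) = p\<^sub>i a + q\<^sub>i b\<close>. Expanding
  \<open>y = a\<close> and cancelling \<open>a\<close> gives \<open>s + t = 1\<close> for \<open>s = \<Sum>\<^sub>i h(a)\<^sub>i p\<^sub>i\<close> and \<open>t = \<Sum>\<^sub>i h(b)\<^sub>i q\<^sub>i\<close>.
\<close>

lemma (in domain) projective_pair_arithmetical:
  assumes a: "a \<in> carrier R" and b: "b \<in> carrier R" and a0: "a \<noteq> \<zero>"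
    and proj: "projective_module R (ideal_module R (Idl {a, b}))"
  shows "\<exists>s\<in>carrier R. \<exists>t\<in>carrier R. \<exists>u\<in>carrier R. \<exists>v\<in>carrier R.
     s \<oplus> t = \<one> \<and> s \<otimes> b = u \<otimes> a \<and> t \<otimes> a = v \<otimes> b"
proof -
  define I where "I = Idl {a, b}"
  have aI: "a \<in> I" and bI: "b \<in> I" unfolding I_def using genideal_self[of "{a, b}"] a b by auto
  interpret I: ideal I R unfolding I_def using a b by (intro genideal_ideal) auto
  note IR = I.Icarr
  have Iadd: "x \<oplus> y \<in> I" if "x \<in> I" "y \<in> I" for x y using that by simp
  have "\<exists>(S :: 'a set) H K h. submodule H R (free_module R S) \<and> submodule K R (free_module R S) \<and>
      H \<inter> K = {\<zero>\<^bsub>free_module R S\<^esub>} \<and> H <+>\<^bsub>free_module R S\<^esub> K = carrier (free_module R S) \<and>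
      h \<in> module_iso R (ideal_module R I) ((free_module R S)\<lparr>carrier := H\<rparr>)"
    using proj unfolding projective_module_def I_def by (rule conjunct2)
  then obtain S :: "'a set" and H K h where SHK: "submodule H R (free_module R S) \<and> submodule K R (free_module R S) \<and>
      H \<inter> K = {\<zero>\<^bsub>free_module R S\<^esub>} \<and> H <+>\<^bsub>free_module R S\<^esub> K = carrier (free_module R S) \<and>
      h \<in> module_iso R (ideal_module R I) ((free_module R S)\<lparr>carrier := H\<rparr>)"
    by (elim exE) (rule that)
  then have H: "submodule H R (free_module R S)" and K: "submodule K R (free_module R S)"
    and HK: "H \<inter> K = {\<zero>\<^bsub>free_module R S\<^esub>}" and sum: "H <+>\<^bsub>free_module R S\<^esub> K = carrier (free_module R S)"
    and h: "h \<in> module_iso R (ideal_module R I) ((free_module R S)\<lparr>carrier := H\<rparr>)" by simp_all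
  let ?F = "free_module R S"
  interpret F: module R ?F by (rule free_module_is_module)
  note HE = F.submoduleE[OF H] and KE = F.submoduleE[OF K]
  have hbij: "bij_betw h I H" and hadd: "\<And>x y. x \<in> I \<Longrightarrow> y \<in> I \<Longrightarrow> h (x \<oplus> y) = h x \<oplus>\<^bsub>?F\<^esub> h y"
    and hsm: "\<And>r x. r \<in> carrier R \<Longrightarrow> x \<in> I \<Longrightarrow> h (r \<otimes> x) = r \<odot>\<^bsub>?F\<^esub> h x"
    using h unfolding module_iso_def iso_def hom_def by (auto simp: ideal_module_simps)
  have hH: "h x \<in> H" if "x \<in> I" for x using hbij that bij_betwE by blast
  have hF: "h x \<in> carrier ?F" if "x \<in> I" for x using hH[OF that] HE(1) by blast
  have KF: "k \<in> carrier ?F" if "k \<in> K" for k using that KE(1) by blast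
  \<comment> \<open>The projection of the free module onto the ideal.\<close>
  have dec: "\<exists>y\<in>I. \<exists>k\<in>K. x = h y \<oplus>\<^bsub>?F\<^esub> k" if "x \<in> carrier ?F" for x
  proof -
    have "x \<in> H <+>\<^bsub>?F\<^esub> K" using that sum by simp
    then obtain u k where "u \<in> H" "k \<in> K" "x = u \<oplus>\<^bsub>?F\<^esub> k"
      unfolding set_add_def' by auto
    moreover have "H = h ` I" using hbij unfolding bij_betw_def by simp
    ultimately show ?thesis by blast
  qed
  have uniq: "y = y'" if yy: "y \<in> I" "y' \<in> I" "k \<in> K" "k' \<in> K" "h y \<oplus>\<^bsub>?F\<^esub> k = h y' \<oplus>\<^bsub>?F\<^esub> k'" for y y' k k'
  proof -
    have c: "h y \<in> carrier ?F" "h y' \<in> carrier ?F" "k \<in> carrier ?F" "k' \<in> carrier ?F" using yy hF KF by auto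
    have "h y \<ominus>\<^bsub>?F\<^esub> h y' = (h y \<oplus>\<^bsub>?F\<^esub> k) \<ominus>\<^bsub>?F\<^esub> (h y' \<oplus>\<^bsub>?F\<^esub> k)"
      using c by (simp add: F.minus_eq F.minus_add F.add.m_assoc F.add.m_lcomm[of k] F.r_neg)
    also have "\<dots> = (h y' \<oplus>\<^bsub>?F\<^esub> k') \<ominus>\<^bsub>?F\<^esub> (h y' \<oplus>\<^bsub>?F\<^esub> k)" unfolding yy(5) ..
    also have "\<dots> = (k' \<oplus>\<^bsub>?F\<^esub> h y') \<ominus>\<^bsub>?F\<^esub> (k \<oplus>\<^bsub>?F\<^esub> h y')"
      using c by (simp add: F.add.m_comm)
    also have "\<dots> = k' \<ominus>\<^bsub>?F\<^esub> k"
      using c by (simp add: F.minus_eq F.minus_add F.add.m_assoc F.add.m_lcomm[of "h y'"] F.r_neg)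
    finally have "h y \<ominus>\<^bsub>?F\<^esub> h y' = k' \<ominus>\<^bsub>?F\<^esub> k" .
    moreover have "h y \<ominus>\<^bsub>?F\<^esub> h y' \<in> H" using hH yy HE(3,5) unfolding a_minus_def by blast
    moreover have "k' \<ominus>\<^bsub>?F\<^esub> k \<in> K" using yy KE(3,5) unfolding a_minus_def by blast
    ultimately have "h y \<ominus>\<^bsub>?F\<^esub> h y' = \<zero>\<^bsub>?F\<^esub>" using HK by auto
    then have "h y = h y'" using c by (metis F.add.inv_closed F.add.inv_equality F.minus_eq F.minus_minus)
    then show ?thesis using hbij yy unfolding bij_betw_def inj_on_def by blast
  qed
  define \<pi> where "\<pi> x = (SOME y. y \<in> I \<and> (\<exists>k\<in>K. x = h y \<oplus>\<^bsub>?F\<^esub> k))" for x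
  have \<pi>: "\<pi> x \<in> I \<and> (\<exists>k\<in>K. x = h (\<pi> x) \<oplus>\<^bsub>?F\<^esub> k)" if "x \<in> carrier ?F" for x
    unfolding \<pi>_def by (rule someI_ex) (use dec[OF that] in blast)
  have \<pi>I: "\<pi> x = y" if "y \<in> I" "k \<in> K" "x = h y \<oplus>\<^bsub>?F\<^esub> k" for x y k
  proof -
    have "x \<in> carrier ?F" using that hF KF by simp
    then obtain k' where "\<pi> x \<in> I" "k' \<in> K" "x = h (\<pi> x) \<oplus>\<^bsub>?F\<^esub> k'" using \<pi> by blast
    then show ?thesis using uniq[of "\<pi> x" y k' k] that by simp
  qed
  have Kz: "\<zero>\<^bsub>?F\<^esub> \<in> K" using HK by blast
  have \<pi>h: "\<pi> (h y) = y" if "y \<in> I" for y using \<pi>I[OF that Kz, of "h y"] hF[OF that] by simp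
  have \<pi>add: "\<pi> (x \<oplus>\<^bsub>?F\<^esub> r \<odot>\<^bsub>?F\<^esub> z) = \<pi> x \<oplus> r \<otimes> \<pi> z" if x: "x \<in> carrier ?F" and z: "z \<in> carrier ?F" and r: "r \<in> carrier R" for x z r
  proof -
    obtain k where k: "k \<in> K" "x = h (\<pi> x) \<oplus>\<^bsub>?F\<^esub> k" using \<pi>[OF x] by blast
    obtain k' where k': "k' \<in> K" "z = h (\<pi> z) \<oplus>\<^bsub>?F\<^esub> k'" using \<pi>[OF z] by blast
    have I: "\<pi> x \<in> I" "\<pi> z \<in> I" "r \<otimes> \<pi> z \<in> I" using \<pi>[OF x] \<pi>[OF z] I.I_l_closed r by auto
    note c = hF[OF I(1)] hF[OF I(2)] KF[OF k(1)] KF[OF k'(1)]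
    have "x \<oplus>\<^bsub>?F\<^esub> r \<odot>\<^bsub>?F\<^esub> z = (h (\<pi> x) \<oplus>\<^bsub>?F\<^esub> k) \<oplus>\<^bsub>?F\<^esub> r \<odot>\<^bsub>?F\<^esub> (h (\<pi> z) \<oplus>\<^bsub>?F\<^esub> k')"
      using k(2) k'(2) by simp
    also have "\<dots> = h (\<pi> x \<oplus> r \<otimes> \<pi> z) \<oplus>\<^bsub>?F\<^esub> (k \<oplus>\<^bsub>?F\<^esub> r \<odot>\<^bsub>?F\<^esub> k')"
      using c r hadd[OF I(1,3)] hsm[OF r I(2)] by (simp add: F.smult_r_distr F.add.m_assoc F.add.m_lcomm)
    finally show ?thesis
      using \<pi>I[of "\<pi> x \<oplus> r \<otimes> \<pi> z" "k \<oplus>\<^bsub>?F\<^esub> r \<odot>\<^bsub>?F\<^esub> k'"] Iadd[OF I(1,3)] KE(4)[OF r k'(1)] KE(5) k(1) by blast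
  qed
  define e where "e i = (\<lambda>j\<in>S. if j = i then \<one> else \<zero>)" for i
  have eF: "e i \<in> carrier ?F" for i
  proof -
    have "{j \<in> S. e i j \<noteq> \<zero>} \<subseteq> {i}" unfolding e_def by auto
    then have "finite {j \<in> S. e i j \<noteq> \<zero>}" by (rule finite_subset) simp
    then show ?thesis unfolding free_module_simps by (auto simp: e_def)
  qed
  have expand: "\<pi> x = finsum R (\<lambda>i. x i \<otimes> \<pi> (e i)) T"
    if "finite T" "T \<subseteq> S" "x \<in> carrier ?F" "\<And>i. i \<in> S - T \<Longrightarrow> x i = \<zero>" for T x
    using that
  proof (induction T arbitrary: x rule: finite_induct)
    case empty
    then have "x = \<zero>\<^bsub>?F\<^esub>" unfolding free_module_simps by (intro PiE_ext[of x S]) auto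
    moreover have "\<zero>\<^bsub>?F\<^esub> = h \<zero> \<oplus>\<^bsub>?F\<^esub> \<zero>\<^bsub>?F\<^esub>"
      using hsm[of \<zero> a] aI a hF[OF aI] by simp
    ultimately have "\<pi> x = \<zero>" using \<pi>I[OF _ Kz, of \<zero> x] I.zero_closed by simp
    then show ?case by simp
  next
    case (insert t T)
    have xc: "x i \<in> carrier R" if "i \<in> S" for i using insert.prems(2) that unfolding free_module_simps by auto
    have tS: "t \<in> S" using insert.prems by simp
    define x' where "x' = (\<lambda>i\<in>S. if i = t then \<zero> else x i)"
    have "{i \<in> S. x' i \<noteq> \<zero>} \<subseteq> {i \<in> S. x i \<noteq> \<zero>}" unfolding x'_def by auto
    moreover have "finite {i \<in> S. x i \<noteq> \<zero>}" using insert.prems(2) unfolding free_module_simps by simp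
    ultimately have "finite {i \<in> S. x' i \<noteq> \<zero>}" by (rule finite_subset)
    then have x': "x' \<in> carrier ?F" using xc unfolding free_module_simps by (auto simp: x'_def)
    have xx: "x = x' \<oplus>\<^bsub>?F\<^esub> x t \<odot>\<^bsub>?F\<^esub> e t"
    proof
      fix i
      show "x i = (x' \<oplus>\<^bsub>?F\<^esub> x t \<odot>\<^bsub>?F\<^esub> e t) i"
      proof (cases "i \<in> S")
        case True
        then show ?thesis using xc tS by (simp add: free_module_simps x'_def e_def)
      next
        case False
        then show ?thesis using insert.prems(2) by (simp add: free_module_simps PiE_def extensional_def)
      qed
    qed
    have "\<pi> x = \<pi> x' \<oplus> x t \<otimes> \<pi> (e t)" by (subst xx) (rule \<pi>add[OF x' eF xc[OF tS]])
    also have "\<pi> x' = finsum R (\<lambda>i. x' i \<otimes> \<pi> (e i)) T"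
      using insert.prems by (intro insert.IH x') (auto simp: x'_def)
    also have "\<dots> = finsum R (\<lambda>i. x i \<otimes> \<pi> (e i)) T"
      using insert.hyps insert.prems xc \<pi>[OF eF] IR by (intro finsum_cong') (auto simp: x'_def)
    also have "finsum R (\<lambda>i. x i \<otimes> \<pi> (e i)) T \<oplus> x t \<otimes> \<pi> (e t) = finsum R (\<lambda>i. x i \<otimes> \<pi> (e i)) (insert t T)"
    proof -
      have m: "x i \<otimes> \<pi> (e i) \<in> carrier R" if "i \<in> insert t T" for i
        using that insert.prems xc \<pi>[OF eF] IR by auto
      then have "finsum R (\<lambda>i. x i \<otimes> \<pi> (e i)) (insert t T) = x t \<otimes> \<pi> (e t) \<oplus> finsum R (\<lambda>i. x i \<otimes> \<pi> (e i)) T"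
        using insert.hyps by (intro finsum_insert) auto
      then show ?thesis using m by (simp add: a_comm)
    qed
    finally show ?case .
  qed
  \<comment> \<open>The basis may be infinite, but finitely many coordinates matter for \<open>a\<close> and \<open>b\<close>.\<close>
  define T where "T = {i \<in> S. h a i \<noteq> \<zero>} \<union> {i \<in> S. h b i \<noteq> \<zero>}"
  have T: "finite T" "T \<subseteq> S" using hF[OF aI] hF[OF bI] unfolding T_def free_module_simps by auto
  have lc: "h y i \<in> carrier R" if "y \<in> I" "i \<in> S" for y i using hF[OF that(1)] that(2) unfolding free_module_simps by auto
  have aexp: "a = finsum R (\<lambda>i. h a i \<otimes> \<pi> (e i)) T"
    using expand[OF T hF[OF aI]] \<pi>h[OF aI] unfolding T_def by auto
  have "\<exists>p q. \<pi> (e i) = p \<otimes> a \<oplus> q \<otimes> b \<and> p \<in> carrier R \<and> q \<in> carrier R" for i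
    using genideal_pair[OF a b] \<pi>[OF eF, of i] unfolding I_def by blast
  then obtain p q where pq: "\<And>i. \<pi> (e i) = p i \<otimes> a \<oplus> q i \<otimes> b" "\<And>i. p i \<in> carrier R" "\<And>i. q i \<in> carrier R" by metis
  have sym: "a \<otimes> h b i = b \<otimes> h a i" if "i \<in> S" for i
  proof -
    have "h (a \<otimes> b) = a \<odot>\<^bsub>?F\<^esub> h b" "h (b \<otimes> a) = b \<odot>\<^bsub>?F\<^esub> h a" using hsm a b aI bI by auto
    then have "(a \<odot>\<^bsub>?F\<^esub> h b) i = (b \<odot>\<^bsub>?F\<^esub> h a) i" using m_comm a b by metis
    then show ?thesis using that unfolding free_module_simps by simp
  qed
  have la: "h a i \<in> carrier R" and lb: "h b i \<in> carrier R" if "i \<in> T" for i using lc aI bI T that by auto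
  define s where "s = finsum R (\<lambda>i. h a i \<otimes> p i) T"
  define t where "t = finsum R (\<lambda>i. h b i \<otimes> q i) T"
  define u where "u = finsum R (\<lambda>i. h b i \<otimes> p i) T"
  define v where "v = finsum R (\<lambda>i. h a i \<otimes> q i) T"
  have c: "s \<in> carrier R" "t \<in> carrier R" "u \<in> carrier R" "v \<in> carrier R"
    unfolding s_def t_def u_def v_def using la lb pq by (auto intro!: finsum_closed)
  have swap: "b \<otimes> (h a i \<otimes> r) = a \<otimes> (h b i \<otimes> r)" if "i \<in> T" "r \<in> carrier R" for i r
    using sym[of i] that T la[OF that(1)] lb[OF that(1)] a b by (metis m_assoc subsetD)
  have "b \<otimes> s = a \<otimes> u"
  proof -
    have "b \<otimes> s = finsum R (\<lambda>i. b \<otimes> (h a i \<otimes> p i)) T"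
      unfolding s_def using T la pq b by (intro finsum_rdistr) auto
    also have "\<dots> = finsum R (\<lambda>i. a \<otimes> (h b i \<otimes> p i)) T"
      using swap pq lb a by (intro finsum_cong') auto
    also have "\<dots> = a \<otimes> u" unfolding u_def using T lb pq a by (intro finsum_rdistr[symmetric]) auto
    finally show ?thesis .
  qed
  moreover have bv: "b \<otimes> v = a \<otimes> t"
  proof -
    have "b \<otimes> v = finsum R (\<lambda>i. b \<otimes> (h a i \<otimes> q i)) T"
      unfolding v_def using T la pq b by (intro finsum_rdistr) auto
    also have "\<dots> = finsum R (\<lambda>i. a \<otimes> (h b i \<otimes> q i)) T"
      using swap pq lb a by (intro finsum_cong') auto
    also have "\<dots> = a \<otimes> t" unfolding t_def using T lb pq a by (intro finsum_rdistr[symmetric]) auto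
    finally show ?thesis .
  qed
  moreover have "s \<oplus> t = \<one>"
  proof -
    have "a = finsum R (\<lambda>i. a \<otimes> (h a i \<otimes> p i) \<oplus> b \<otimes> (h a i \<otimes> q i)) T"
    proof -
      have "h a i \<otimes> \<pi> (e i) = a \<otimes> (h a i \<otimes> p i) \<oplus> b \<otimes> (h a i \<otimes> q i)" if "i \<in> T" for i
        unfolding pq(1) using la[OF that] pq(2,3)[of i] a b by algebra
      then have "finsum R (\<lambda>i. h a i \<otimes> \<pi> (e i)) T = finsum R (\<lambda>i. a \<otimes> (h a i \<otimes> p i) \<oplus> b \<otimes> (h a i \<otimes> q i)) T"
        using la pq a b by (intro finsum_cong') auto
      then show ?thesis using aexp by simp
    qed
    also have "\<dots> = finsum R (\<lambda>i. a \<otimes> (h a i \<otimes> p i)) T \<oplus> finsum R (\<lambda>i. b \<otimes> (h a i \<otimes> q i)) T"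
      using la pq a b by (intro finsum_addf) auto
    also have "finsum R (\<lambda>i. a \<otimes> (h a i \<otimes> p i)) T = a \<otimes> s"
      unfolding s_def using T la pq a by (intro finsum_rdistr[symmetric]) auto
    also have "finsum R (\<lambda>i. b \<otimes> (h a i \<otimes> q i)) T = b \<otimes> v"
      unfolding v_def using T la pq b by (intro finsum_rdistr[symmetric]) auto
    finally have "a \<otimes> \<one> = a \<otimes> (s \<oplus> t)" using bv a c by (simp add: r_distr)
    then show ?thesis using a0 a c m_lcancel by (metis a_closed one_closed)
  qed
  ultimately show ?thesis using c a b by (metis m_comm)
qed

lemma prufer_domain_arithmetical:
  assumes "prufer_domain R"
  shows "ring.arithmetical R"
proof -
  interpret domain R using assms unfolding prufer_domain_def by simp
  show ?thesis
    unfolding arithmetical_def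
  proof (intro ballI)
    fix a b assume a: "a \<in> carrier R" and b: "b \<in> carrier R"
    show "\<exists>s\<in>carrier R. \<exists>t\<in>carrier R. \<exists>u\<in>carrier R. \<exists>v\<in>carrier R.
        s \<oplus>\<^bsub>R\<^esub> t = \<one>\<^bsub>R\<^esub> \<and> s \<otimes>\<^bsub>R\<^esub> b = u \<otimes>\<^bsub>R\<^esub> a \<and> t \<otimes>\<^bsub>R\<^esub> a = v \<otimes>\<^bsub>R\<^esub> b"
    proof (cases "a = \<zero>\<^bsub>R\<^esub>")
      case True
      have "\<zero>\<^bsub>R\<^esub> \<oplus>\<^bsub>R\<^esub> \<one>\<^bsub>R\<^esub> = \<one>\<^bsub>R\<^esub> \<and> \<zero>\<^bsub>R\<^esub> \<otimes>\<^bsub>R\<^esub> b = \<zero>\<^bsub>R\<^esub> \<otimes>\<^bsub>R\<^esub> a \<and> \<one>\<^bsub>R\<^esub> \<otimes>\<^bsub>R\<^esub> a = \<zero>\<^bsub>R\<^esub> \<otimes>\<^bsub>R\<^esub> b"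
        using True b by simp
      then show ?thesis using zero_closed one_closed by blast
    next
      case False
      have "projective_module R (ideal_module R (Idl\<^bsub>R\<^esub> {a, b}))"
        using assms a b unfolding prufer_domain_def by simp
      then show ?thesis by (rule projective_pair_arithmetical[OF a b False])
    qed
  qed
qed

text \<open>
  A partition of unity for finitely many elements: where \<open>s\<^sub>j\<close> is a unit, the element \<open>j\<close> divides
  the others. A new element \<open>x\<close> is compared with each \<open>j\<close> separately, which splits \<open>s\<^sub>j\<close> into the
  part where \<open>j\<close> divides \<open>x\<close> and the part where \<open>x\<close> divides \<open>j\<close>.
\<close>

lemma (in cring) arithmetical_localization:
  assumes ar: "arithmetical" and A: "finite A" "A \<noteq> {}" "A \<subseteq> carrier R"
  shows "\<exists>s. (\<forall>j\<in>A. s j \<in> carrier R) \<and> finsum R s A = \<one> \<and> (\<forall>i\<in>A. \<forall>j\<in>A. \<exists>c\<in>carrier R. s j \<otimes> i = c \<otimes> j)"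
  using A
proof (induction A rule: finite_ne_induct)
  case (singleton x)
  have "finsum R (\<lambda>_. \<one>) {x} = \<one>" by (simp add: finsum_insert)
  moreover have "\<one> \<otimes> x = \<one> \<otimes> x" ..
  ultimately show ?case by (intro exI[of _ "\<lambda>_. \<one>"]) (use one_closed in blast)
next
  case (insert x A)
  then have "A \<subseteq> carrier R" by simp
  then obtain s where s0: "(\<forall>j\<in>A. s j \<in> carrier R) \<and> finsum R s A = \<one> \<and> (\<forall>i\<in>A. \<forall>j\<in>A. \<exists>c\<in>carrier R. s j \<otimes> i = c \<otimes> j)"
    using insert.IH by blast
  have s: "\<And>j. j \<in> A \<Longrightarrow> s j \<in> carrier R" "finsum R s A = \<one>"
    "\<And>i j. i \<in> A \<Longrightarrow> j \<in> A \<Longrightarrow> \<exists>c\<in>carrier R. s j \<otimes> i = c \<otimes> j" using s0 by simp_all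
  have x: "x \<in> carrier R" and AR: "\<And>j. j \<in> A \<Longrightarrow> j \<in> carrier R" using insert.prems by auto
  define P where "P j \<sigma> \<tau> u v \<longleftrightarrow> \<sigma> \<in> carrier R \<and> \<tau> \<in> carrier R \<and> u \<in> carrier R \<and> v \<in> carrier R \<and>
      \<sigma> \<oplus> \<tau> = \<one> \<and> \<sigma> \<otimes> x = u \<otimes> j \<and> \<tau> \<otimes> j = v \<otimes> x" for j \<sigma> \<tau> u v
  have "\<forall>j\<in>A. \<exists>\<sigma> \<tau> u v. P j \<sigma> \<tau> u v"
  proof
    fix j assume j: "j \<in> A"
    show "\<exists>\<sigma> \<tau> u v. P j \<sigma> \<tau> u v"
      using ar[unfolded arithmetical_def, rule_format, OF AR[OF j] x] unfolding P_def
      by (elim bexE conjE) (intro exI conjI, assumption+)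
  qed
  from bchoice[OF this] obtain \<sigma> where "\<forall>j\<in>A. \<exists>\<tau> u v. P j (\<sigma> j) \<tau> u v" by (elim exE)
  from bchoice[OF this] obtain \<tau> where "\<forall>j\<in>A. \<exists>u v. P j (\<sigma> j) (\<tau> j) u v" by (elim exE)
  from bchoice[OF this] obtain u where "\<forall>j\<in>A. \<exists>v. P j (\<sigma> j) (\<tau> j) (u j) v" by (elim exE)
  from bchoice[OF this] obtain v where P: "\<forall>j\<in>A. P j (\<sigma> j) (\<tau> j) (u j) (v j)" by (elim exE)
  have c: "\<And>j. j \<in> A \<Longrightarrow> \<sigma> j \<in> carrier R" "\<And>j. j \<in> A \<Longrightarrow> \<tau> j \<in> carrier R"
      "\<And>j. j \<in> A \<Longrightarrow> u j \<in> carrier R" "\<And>j. j \<in> A \<Longrightarrow> v j \<in> carrier R"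
    and st: "\<And>j. j \<in> A \<Longrightarrow> \<sigma> j \<oplus> \<tau> j = \<one>" and su: "\<And>j. j \<in> A \<Longrightarrow> \<sigma> j \<otimes> x = u j \<otimes> j"
    and tv: "\<And>j. j \<in> A \<Longrightarrow> \<tau> j \<otimes> j = v j \<otimes> x" using P unfolding P_def by simp_all
  define z where "z = finsum R (\<lambda>j. s j \<otimes> \<tau> j) A"
  have zR: "z \<in> carrier R" unfolding z_def using s c by (auto intro!: finsum_closed)
  define s' where "s' j = (if j = x then z else s j \<otimes> \<sigma> j)" for j
  have s'A: "s' j = s j \<otimes> \<sigma> j" if "j \<in> A" for j using that insert.hyps unfolding s'_def by auto
  have s'R: "s' j \<in> carrier R" if "j \<in> insert x A" for j using that zR s c unfolding s'_def by auto
  have "finsum R s' (insert x A) = z \<oplus> finsum R s' A"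
    using finsum_insert[OF insert.hyps(1,3), of s'] s'R zR by (simp add: s'_def Pi_def)
  also have "finsum R s' A = finsum R (\<lambda>j. s j \<otimes> \<sigma> j) A"
    using s'A s c by (intro finsum_cong') auto
  also have "z \<oplus> finsum R (\<lambda>j. s j \<otimes> \<sigma> j) A = finsum R (\<lambda>j. s j \<otimes> \<tau> j \<oplus> s j \<otimes> \<sigma> j) A"
    unfolding z_def using s c by (intro finsum_addf[symmetric]) auto
  also have "\<dots> = finsum R s A"
  proof (rule finsum_cong')
    show "s \<in> A \<rightarrow> carrier R" using s by auto
    fix j assume j: "j \<in> A"
    have "s j \<otimes> \<tau> j \<oplus> s j \<otimes> \<sigma> j = s j \<otimes> (\<sigma> j \<oplus> \<tau> j)" using s(1)[OF j] c(1,2)[OF j] by algebra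
    then show "s j \<otimes> \<tau> j \<oplus> s j \<otimes> \<sigma> j = s j" using st[OF j] s(1)[OF j] by simp
  qed simp
  finally have one: "finsum R s' (insert x A) = \<one>" using s(2) by simp
  have "\<exists>k\<in>carrier R. s' j \<otimes> i = k \<otimes> j" if i: "i \<in> insert x A" and j: "j \<in> insert x A" for i j
  proof (cases "j = x")
    case True
    show ?thesis
    proof (cases "i = x")
      case True then show ?thesis using \<open>j = x\<close> s'R[OF j] by blast
    next
      case False
      then have iA: "i \<in> A" using i by simp
      obtain k where k: "\<And>j. j \<in> A \<Longrightarrow> k j \<in> carrier R \<and> s j \<otimes> i = k j \<otimes> j" using s(3)[OF iA] by metis
      have "s j \<otimes> \<tau> j \<otimes> i = (k j \<otimes> v j) \<otimes> x" if j: "j \<in> A" for j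
      proof -
        have "s j \<otimes> \<tau> j \<otimes> i = \<tau> j \<otimes> (s j \<otimes> i)" using s(1)[OF j] c[OF j] AR[OF iA] by algebra
        also have "\<dots> = k j \<otimes> (\<tau> j \<otimes> j)" using k[OF j] c[OF j] AR[OF j] by (simp add: m_lcomm)
        also have "\<dots> = (k j \<otimes> v j) \<otimes> x" using k[OF j] c[OF j] x tv[OF j] by (simp add: m_assoc)
        finally show ?thesis .
      qed
      moreover have "z \<otimes> i = finsum R (\<lambda>j. s j \<otimes> \<tau> j \<otimes> i) A"
        unfolding z_def using insert.hyps s c AR iA by (intro finsum_ldistr) auto
      ultimately have "z \<otimes> i = finsum R (\<lambda>j. (k j \<otimes> v j) \<otimes> x) A"
        using k c x by (simp cong: finsum_cong add: Pi_def)
      also have "\<dots> = finsum R (\<lambda>j. k j \<otimes> v j) A \<otimes> x"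
        using insert.hyps k c x by (intro finsum_ldistr[symmetric]) auto
      finally have "s' j \<otimes> i = finsum R (\<lambda>j. k j \<otimes> v j) A \<otimes> j" using True by (simp add: s'_def)
      moreover have "finsum R (\<lambda>j. k j \<otimes> v j) A \<in> carrier R" using k c by (auto intro!: finsum_closed)
      ultimately show ?thesis by blast
    qed
  next
    case False
    then have jA: "j \<in> A" using j by simp
    show ?thesis
    proof (cases "i = x")
      case True
      have "s' j \<otimes> x = s j \<otimes> (\<sigma> j \<otimes> x)" unfolding s'A[OF jA] using s(1)[OF jA] c[OF jA] x by (simp add: m_assoc)
      also have "\<dots> = (s j \<otimes> u j) \<otimes> j" unfolding su[OF jA] using s(1)[OF jA] c[OF jA] AR[OF jA] by (simp add: m_assoc)
      finally show ?thesis using True s(1)[OF jA] c[OF jA] by blast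
    next
      case False
      then have iA: "i \<in> A" using i by simp
      obtain k where k: "k \<in> carrier R" "s j \<otimes> i = k \<otimes> j" using s(3)[OF iA jA] by blast
      have "s' j \<otimes> i = \<sigma> j \<otimes> (s j \<otimes> i)" unfolding s'A[OF jA] using s(1)[OF jA] c[OF jA] AR[OF iA] by algebra
      also have "\<dots> = (\<sigma> j \<otimes> k) \<otimes> j" unfolding k(2) using k(1) c[OF jA] AR[OF jA] by (simp add: m_assoc)
      finally show ?thesis using k c[OF jA] by blast
    qed
  qed
  then show ?case using s'R one by blast
qed

lemma (in cring) ideal_module_is_module:
  assumes "ideal I R"
  shows "module R (ideal_module R I)"
proof (rule moduleI)
  interpret I: ideal I R by fact
  note sub = I.Icarr
  show "cring R" by (rule is_cring)
  show "abelian_group (ideal_module R I)"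
  proof (rule abelian_groupI)
    fix x assume x: "x \<in> carrier (ideal_module R I)"
    then show "\<exists>y\<in>carrier (ideal_module R I). y \<oplus>\<^bsub>ideal_module R I\<^esub> x = \<zero>\<^bsub>ideal_module R I\<^esub>"
      unfolding ideal_module_simps using I.a_inv_closed[OF _] sub l_neg by blast
  qed (use sub in \<open>auto simp: ideal_module_simps a_ac\<close>)
qed (use ideal.Icarr[OF assms] in \<open>auto simp: ideal_module_simps l_distr r_distr m_assoc ideal.I_l_closed[OF assms]\<close>)

text \<open>
  With a partition of unity \<open>s\<close> for the nonzero generators, \<open>y \<mapsto> (s\<^sub>j y / j)\<^sub>j\<close> embeds the ideal
  in the free module on these generators, and \<open>x \<mapsto> \<Sum>\<^sub>j x\<^sub>j j\<close> is a left inverse. So the ideal is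
  the direct summand \<open>H\<close> with complement \<open>K\<close>.
\<close>

lemma (in domain) arithmetical_projective:
  assumes ar: "arithmetical" and S0: "finite S0" "S0 \<subseteq> carrier R"
  shows "projective_module R (ideal_module R (Idl S0))"
proof -
  define S where "S = S0 - {\<zero>}"
  have S: "finite S" "S \<subseteq> carrier R" "\<zero> \<notin> S" unfolding S_def using S0 by auto
  define I where "I = Idl S0"
  interpret I: ideal I R unfolding I_def by (rule genideal_ideal[OF S0(2)])
  note IR = I.Icarr
  have SI: "S \<subseteq> I" unfolding S_def I_def using genideal_self[OF S0(2)] by auto
  have least: "I \<subseteq> J" if "ideal J R" "S \<subseteq> J" for J
  proof -
    have "\<zero> \<in> J" using additive_subgroup.zero_closed[OF ideal.axioms(1)[OF that(1)]] .
    then have "S0 \<subseteq> J" using that(2) unfolding S_def by blast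
    then show ?thesis unfolding I_def by (rule genideal_minimal[OF that(1)])
  qed
  have "\<exists>s. (\<forall>j\<in>S. s j \<in> carrier R) \<and> (\<forall>y\<in>I. finsum R s S \<otimes> y = y) \<and>
      (\<forall>i\<in>S. \<forall>j\<in>S. \<exists>c\<in>carrier R. s j \<otimes> i = c \<otimes> j)"
  proof (cases "S = {}")
    case True
    then have "I \<subseteq> {\<zero>}" using least[OF zero_ideal] by simp
    then show ?thesis using True by auto
  next
    case False
    then show ?thesis using arithmetical_localization[OF ar S(1) False S(2)] IR by auto
  qed
  then obtain s where s: "\<And>j. j \<in> S \<Longrightarrow> s j \<in> carrier R" "\<And>y. y \<in> I \<Longrightarrow> finsum R s S \<otimes> y = y"
    "\<And>i j. i \<in> S \<Longrightarrow> j \<in> S \<Longrightarrow> \<exists>c\<in>carrier R. s j \<otimes> i = c \<otimes> j" by blast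
  have SR: "j \<in> carrier R" "j \<noteq> \<zero>" if "j \<in> S" for j using that S by auto
  have ex: "\<exists>c\<in>carrier R. s j \<otimes> y = c \<otimes> j" if "y \<in> I" "j \<in> S" for y j
  proof -
    let ?J = "{y \<in> carrier R. \<exists>c\<in>carrier R. s j \<otimes> y = c \<otimes> j}"
    note sj = s(1)[OF that(2)] and jR = SR(1)[OF that(2)]
    have "ideal ?J R"
    proof (rule ideal_by_closure)
      show "?J \<subseteq> carrier R" by blast
      have "s j \<otimes> \<zero> = \<zero> \<otimes> j" using sj jR by simp
      then show "\<zero> \<in> ?J" using zero_closed by blast
    next
      fix x y assume "x \<in> ?J" "y \<in> ?J"
      then obtain c c' where c: "x \<in> carrier R" "c \<in> carrier R" "s j \<otimes> x = c \<otimes> j"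
        "y \<in> carrier R" "c' \<in> carrier R" "s j \<otimes> y = c' \<otimes> j" by blast
      then have "s j \<otimes> (x \<oplus> y) = (c \<oplus> c') \<otimes> j" using sj jR by (simp add: r_distr l_distr)
      then show "x \<oplus> y \<in> ?J" using c by blast
    next
      fix x r assume "x \<in> ?J" and r: "r \<in> carrier R"
      then obtain c where c: "x \<in> carrier R" "c \<in> carrier R" "s j \<otimes> x = c \<otimes> j" by blast
      have "s j \<otimes> (r \<otimes> x) = r \<otimes> (s j \<otimes> x)" using c r sj by (simp add: m_lcomm)
      also have "\<dots> = (r \<otimes> c) \<otimes> j" unfolding c(3) using c r jR by (simp add: m_assoc)
      finally show "r \<otimes> x \<in> ?J" using c r by blast
    qed
    moreover have "S \<subseteq> ?J" using s(3) that(2) SR by blast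
    ultimately show ?thesis using least that(1) by blast
  qed
  then obtain \<gamma> where \<gamma>: "\<And>y j. y \<in> I \<Longrightarrow> j \<in> S \<Longrightarrow> \<gamma> y j \<in> carrier R \<and> s j \<otimes> y = \<gamma> y j \<otimes> j" by metis
  have \<gamma>u: "\<gamma> y j = c" if "y \<in> I" "j \<in> S" "c \<in> carrier R" "s j \<otimes> y = c \<otimes> j" for y j c
    using \<gamma>[OF that(1,2)] that SR[OF that(2)] m_rcancel by metis
  let ?M = "ideal_module R I" and ?F = "free_module R S"
  interpret F: module R ?F by (rule free_module_is_module)
  interpret M: module R ?M by (rule ideal_module_is_module[OF I.is_ideal])
  have Fc: "x \<in> carrier ?F \<longleftrightarrow> x \<in> S \<rightarrow>\<^sub>E carrier R" for x unfolding free_module_simps using S(1) by auto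
  have FE: "x i \<in> carrier R" if "x \<in> carrier ?F" "i \<in> S" for x i using that unfolding Fc by auto
  have Feq: "x = y" if "x \<in> carrier ?F" "y \<in> carrier ?F" "\<And>i. i \<in> S \<Longrightarrow> x i = y i" for x y
    using that unfolding Fc by (auto intro: PiE_ext)
  define h where "h y = (\<lambda>j\<in>S. \<gamma> y j)" for y
  define g where "g x = finsum R (\<lambda>j. x j \<otimes> j) S" for x
  have hF: "h y \<in> carrier ?F" if "y \<in> I" for y unfolding Fc h_def using \<gamma>[OF that] by auto
  have hadd: "h (x \<oplus> y) = h x \<oplus>\<^bsub>?F\<^esub> h y" if x: "x \<in> I" and y: "y \<in> I" for x y
  proof (rule Feq)
    fix j assume j: "j \<in> S"
    have "\<gamma> (x \<oplus> y) j = \<gamma> x j \<oplus> \<gamma> y j"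
      using \<gamma>[OF x j] \<gamma>[OF y j] s(1)[OF j] IR x y SR(1)[OF j] j
      by (intro \<gamma>u) (auto simp: l_distr r_distr)
    then show "h (x \<oplus> y) j = (h x \<oplus>\<^bsub>?F\<^esub> h y) j" unfolding h_def free_module_simps using j by simp
  qed (use hF x y in auto)
  have hsm: "h (r \<otimes> x) = r \<odot>\<^bsub>?F\<^esub> h x" if x: "x \<in> I" and r: "r \<in> carrier R" for x r
  proof (rule Feq)
    fix j assume j: "j \<in> S"
    have "s j \<otimes> (r \<otimes> x) = r \<otimes> (s j \<otimes> x)" using s(1)[OF j] IR[OF x] r by (simp add: m_lcomm)
    also have "\<dots> = (r \<otimes> \<gamma> x j) \<otimes> j" using \<gamma>[OF x j] r SR(1)[OF j] by (simp add: m_assoc)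
    finally have "\<gamma> (r \<otimes> x) j = r \<otimes> \<gamma> x j"
      using \<gamma>[OF x j] x r j by (intro \<gamma>u) (auto intro: I.I_l_closed)
    then show "h (r \<otimes> x) j = (r \<odot>\<^bsub>?F\<^esub> h x) j" unfolding h_def free_module_simps using j by simp
  qed (use hF x r I.I_l_closed in auto)
  have gI: "g x \<in> I" if "x \<in> carrier ?F" for x
  proof -
    have "x j \<otimes> j \<in> I" if "j \<in> S" for j using SI FE[OF \<open>x \<in> carrier ?F\<close> that] that by (intro I.I_l_closed) auto
    moreover have "finsum R k A \<in> I" if "finite A" "\<And>j. j \<in> A \<Longrightarrow> k j \<in> I" for k and A :: "'a set"
      using that
    proof (induction A rule: finite_induct)
      case (insert j A)
      then have "finsum R k (insert j A) = k j \<oplus> finsum R k A" using IR by (intro finsum_insert) auto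
      then show ?case using insert by simp
    qed simp
    ultimately show ?thesis unfolding g_def using S(1) by simp
  qed
  have gh: "g (h y) = y" if y: "y \<in> I" for y
  proof -
    have "g (h y) = finsum R (\<lambda>j. s j \<otimes> y) S"
      unfolding g_def h_def using \<gamma>[OF y] s(1) IR[OF y] SR by (intro finsum_cong') auto
    also have "\<dots> = finsum R s S \<otimes> y" using S(1) s(1) IR[OF y] by (intro finsum_ldistr[symmetric]) auto
    also have "\<dots> = y" by (rule s(2)[OF y])
    finally show ?thesis .
  qed
  have gadd: "g (x \<oplus>\<^bsub>?F\<^esub> y) = g x \<oplus> g y" if x: "x \<in> carrier ?F" and y: "y \<in> carrier ?F" for x y
  proof -
    have "g (x \<oplus>\<^bsub>?F\<^esub> y) = finsum R (\<lambda>j. x j \<otimes> j \<oplus> y j \<otimes> j) S"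
      unfolding g_def free_module_simps using FE[OF x] FE[OF y] SR by (intro finsum_cong') (auto simp: l_distr)
    also have "\<dots> = g x \<oplus> g y" unfolding g_def using FE[OF x] FE[OF y] SR by (intro finsum_addf) auto
    finally show ?thesis .
  qed
  have gsm: "g (r \<odot>\<^bsub>?F\<^esub> x) = r \<otimes> g x" if x: "x \<in> carrier ?F" and r: "r \<in> carrier R" for x r
  proof -
    have "g (r \<odot>\<^bsub>?F\<^esub> x) = finsum R (\<lambda>j. r \<otimes> (x j \<otimes> j)) S"
      unfolding g_def free_module_simps using FE[OF x] r SR by (intro finsum_cong') (auto simp: m_assoc)
    also have "\<dots> = r \<otimes> g x" unfolding g_def using FE[OF x] r SR S(1) by (intro finsum_rdistr[symmetric]) auto
    finally show ?thesis .
  qed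
  have minus: "\<ominus>\<^bsub>?F\<^esub> x = (\<ominus> \<one>) \<odot>\<^bsub>?F\<^esub> x" if "x \<in> carrier ?F" for x
    using F.smult_l_minus[of \<one> x] that by simp
  define H where "H = h ` I"
  define K where "K = {x \<in> carrier ?F. g x = \<zero>}"
  have h0: "h \<zero> = \<zero>\<^bsub>?F\<^esub>" using hsm[of \<zero> \<zero>] F.smult_l_null[OF hF[of \<zero>]] by simp
  have H: "submodule H R ?F"
  proof (rule F.submodule_by_closure)
    show "H \<subseteq> carrier ?F" unfolding H_def using hF by blast
    show "\<zero>\<^bsub>?F\<^esub> \<in> H" unfolding H_def h0[symmetric] by simp
  next
    fix a b assume "a \<in> H" "b \<in> H"
    then obtain y z where "y \<in> I" "a = h y" "z \<in> I" "b = h z" unfolding H_def by blast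
    then show "a \<oplus>\<^bsub>?F\<^esub> b \<in> H" unfolding H_def using hadd[of y z] by (metis I.a_closed image_eqI)
  next
    fix a x assume a: "a \<in> carrier R" and "x \<in> H"
    then obtain y where y: "y \<in> I" "x = h y" unfolding H_def by blast
    have "a \<odot>\<^bsub>?F\<^esub> x = h (a \<otimes> y)" using hsm[OF y(1) a] y by simp
    then show "a \<odot>\<^bsub>?F\<^esub> x \<in> H" unfolding H_def using I.I_l_closed[OF y(1) a] by blast
  qed
  have g0: "g \<zero>\<^bsub>?F\<^esub> = \<zero>" using gsm[OF F.zero_closed zero_closed] gI[OF F.zero_closed] IR by simp
  have K: "submodule K R ?F"
    by (rule F.submodule_by_closure) (use g0 gadd gsm in \<open>auto simp: K_def\<close>)
  have "H \<inter> K = {\<zero>\<^bsub>?F\<^esub>}"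
  proof
    show "H \<inter> K \<subseteq> {\<zero>\<^bsub>?F\<^esub>}"
    proof
      fix x assume "x \<in> H \<inter> K"
      then obtain y where y: "y \<in> I" "x = h y" "g x = \<zero>" unfolding H_def K_def by blast
      then have "y = \<zero>" using gh by simp
      then show "x \<in> {\<zero>\<^bsub>?F\<^esub>}" using y h0 by simp
    qed
    show "{\<zero>\<^bsub>?F\<^esub>} \<subseteq> H \<inter> K"
      using subgroup.one_closed[OF submodule.axioms(1)[OF H]] subgroup.one_closed[OF submodule.axioms(1)[OF K]] by simp
  qed
  moreover have "H <+>\<^bsub>?F\<^esub> K = carrier ?F"
  proof
    have HF: "x \<in> carrier ?F" if "x \<in> H" for x using that hF unfolding H_def by blast
    then show "H <+>\<^bsub>?F\<^esub> K \<subseteq> carrier ?F" unfolding set_add_def' K_def by auto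
    show "carrier ?F \<subseteq> H <+>\<^bsub>?F\<^esub> K"
    proof
      fix x assume x: "x \<in> carrier ?F"
      define k where "k = x \<oplus>\<^bsub>?F\<^esub> (\<ominus> \<one>) \<odot>\<^bsub>?F\<^esub> h (g x)"
      have hg: "h (g x) \<in> carrier ?F" using hF gI x by blast
      have "g k = g x \<oplus> (\<ominus> \<one>) \<otimes> g (h (g x))" unfolding k_def using gadd gsm x hg by simp
      also have "\<dots> = \<zero>" using gh[OF gI[OF x]] IR[OF gI[OF x]] by (simp add: l_minus r_neg)
      finally have kK: "k \<in> K" unfolding K_def k_def using x hg by simp
      have "k = x \<oplus>\<^bsub>?F\<^esub> \<ominus>\<^bsub>?F\<^esub> h (g x)" unfolding k_def minus[OF hg] ..
      then have "h (g x) \<oplus>\<^bsub>?F\<^esub> k = x" using x hg by (simp add: F.add.m_lcomm F.r_neg)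
      moreover have "h (g x) \<in> H" unfolding H_def using gI[OF x] by blast
      ultimately show "x \<in> H <+>\<^bsub>?F\<^esub> K" unfolding set_add_def' using kK by blast
    qed
  qed
  moreover have "h \<in> module_iso R ?M (?F\<lparr>carrier := H\<rparr>)"
  proof -
    have "inj_on h I" using gh by (metis inj_onI)
    then have "bij_betw h I H" unfolding bij_betw_def H_def by simp
    then show ?thesis
      unfolding module_iso_def iso_def hom_def using hadd hsm
      by (auto simp: ideal_module_simps bij_betwE)
  qed
  ultimately show ?thesis
    unfolding projective_module_def I_def[symmetric] using M.module_axioms H K by blast
qed

lemma (in domain) arithmetical_prufer:
  assumes "arithmetical"
  shows "prufer_domain R"
  unfolding prufer_domain_def using arithmetical_projective[OF assms] domain_axioms by blast

section \<open>Reduction to countable rings\<close>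

text \<open>
  The number \<open>D\<close> of \<open>uniform_generation_bound\<close> is chosen before the ring, with \<open>h\<close> the number of
  unknown coefficients in each degree.
\<close>

lemma prufer_degree_bound:
  "\<exists>D. \<forall>(R :: ('a, 'm) ring_scheme) f. prufer_domain R \<longrightarrow> f \<in> {1..n} \<rightarrow> carrier (mpoly_ring R N) \<longrightarrow>
     (\<forall>j\<in>{1..n}. total_degree R (f j) \<le> ereal (real d)) \<longrightarrow> generated_in_degree R N n f D"
proof -
  obtain D where D: "\<And>Z. monomial_submodule N n Z \<Longrightarrow> gap_property d Z \<Longrightarrow>
      (\<And>s. card (layer Z {1..n} s) + card (layer Z {0} (s + d)) = n * card (monoms N s)) \<Longrightarrow>
      (\<forall>j b. (j, b) \<in> Z \<longrightarrow> 1 \<le> j \<longrightarrow> D < size b \<longrightarrow> decomposable Z j b)"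
    using uniform_generation_bound[of N n d "\<lambda>s. n * card (monoms N s)"] by metis
  have "generated_in_degree R N n f D"
    if R: "prufer_domain R" and f: "f \<in> {1..n} \<rightarrow> carrier (mpoly_ring R N)"
      and d: "\<forall>j\<in>{1..n}. total_degree R (f j) \<le> ereal (real d)" for R :: "('a, 'm) ring_scheme" and f
  proof -
    interpret domain R using R unfolding prufer_domain_def by simp
    interpret homogeneous_equation R N n d f
    proof
      show "f \<in> {1..n} \<rightarrow> carrier (mpoly_ring R N)" by (rule f)
      fix j m assume "j \<in> {1..n}" "f j m \<noteq> \<zero>\<^bsub>R\<^esub>"
      then show "size m \<le> d" using d total_degree_le_iff by blast
    qed
    show ?thesis by (rule generated_in_bounded_degree[OF prufer_domain_arithmetical[OF R] D])
  qed
  then show ?thesis by blast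
qed

lemma \<beta>_bounds_countable:
  fixes R :: "nat ring"
  assumes "prufer_domain R" "f \<in> {1..n} \<rightarrow> carrier (mpoly_ring R N)"
    "\<forall>j\<in>{1..n}. total_degree R (f j) \<le> ereal (real d)"
  shows "generated_in_degree R N n f (\<beta> N d n)"
proof -
  let ?P = "\<lambda>b. \<forall>(R :: nat ring) f. prufer_domain R \<longrightarrow> f \<in> {1..n} \<rightarrow> carrier (mpoly_ring R N) \<longrightarrow>
        (\<forall>j\<in>{1..n}. total_degree R (f j) \<le> ereal (real d)) \<longrightarrow> generated_in_degree R N n f b"
  have "?P (LEAST b. ?P b)" by (rule LeastI_ex) (rule prufer_degree_bound)
  then show ?thesis using assms unfolding \<beta>_def by blast
qed

lemma countable_closure:
  fixes C :: "'a set" and ops :: "('a \<Rightarrow> 'a \<Rightarrow> 'a) set"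
  assumes C: "countable C" "C \<subseteq> B" and ops: "countable ops" and B: "\<And>g x y. g \<in> ops \<Longrightarrow> x \<in> B \<Longrightarrow> y \<in> B \<Longrightarrow> g x y \<in> B"
  shows "\<exists>A. countable A \<and> C \<subseteq> A \<and> A \<subseteq> B \<and> (\<forall>g\<in>ops. \<forall>x\<in>A. \<forall>y\<in>A. g x y \<in> A)"
proof -
  define step where "step A = A \<union> (\<Union>g\<in>ops. (\<lambda>(x, y). g x y) ` (A \<times> A))" for A
  define A where "A k = (step ^^ k) C" for k
  have AS: "A (Suc k) = step (A k)" for k unfolding A_def by simp
  have cnt: "countable (A k)" for k
  proof (induction k)
    case 0 then show ?case using C unfolding A_def by simp
  next
    case (Suc k)
    then show ?case unfolding AS step_def using ops by simp
  qed
  have sub: "A k \<subseteq> B" for k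
  proof (induction k)
    case 0 then show ?case using C unfolding A_def by simp
  next
    case (Suc k)
    show ?case
      unfolding AS step_def
    proof (intro Un_least UN_least)
      fix g assume "g \<in> ops"
      then show "(\<lambda>(x, y). g x y) ` (A k \<times> A k) \<subseteq> B" using B[of g] subsetD[OF Suc] by auto
    qed (rule Suc)
  qed
  have mono: "A k \<subseteq> A l" if "k \<le> l" for k l
    using that by (rule lift_Suc_mono_le[rotated]) (auto simp: AS step_def)
  have "g x y \<in> (\<Union>k. A k)" if g: "g \<in> ops" and xy: "x \<in> (\<Union>k. A k)" "y \<in> (\<Union>k. A k)" for g x y
  proof -
    obtain k l where "x \<in> A k" "y \<in> A l" using xy by blast
    then have "x \<in> A (max k l)" "y \<in> A (max k l)" using mono[of k "max k l"] mono[of l "max k l"] by auto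
    then have "g x y \<in> A (Suc (max k l))" unfolding AS step_def using g by auto
    then show ?thesis by blast
  qed
  moreover have "C \<subseteq> (\<Union>k. A k)" unfolding A_def by (metis UN_upper UNIV_I funpow_0)
  moreover have "countable (\<Union>k. A k)" using cnt by simp
  moreover have "(\<Union>k. A k) \<subseteq> B" using sub by (rule UN_least)
  ultimately show ?thesis by (intro exI[of _ "\<Union>k. A k"]) simp
qed

text \<open>
  The downward Loewenheim-Skolem argument: the given elements are closed under the ring operations
  and under choice functions for the elementwise condition of \<open>arithmetical\<close>, and the resulting
  countable domain is copied to the natural numbers.
\<close>

lemma countable_prufer_subdomain:
  fixes R :: "('a, 'm) ring_scheme"
  assumes R: "prufer_domain R" and C: "countable C" "C \<subseteq> carrier R"
  shows "\<exists>(Q :: nat ring) h. prufer_domain Q \<and> h \<in> ring_hom Q R \<and> inj_on h (carrier Q) \<and> C \<subseteq> h ` carrier Q"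
proof -
  interpret domain R using R unfolding prufer_domain_def by simp
  have ar: arithmetical by (rule prufer_domain_arithmetical[OF R])
  define E where "E a b s t u v \<longleftrightarrow> s \<in> carrier R \<and> t \<in> carrier R \<and> u \<in> carrier R \<and> v \<in> carrier R \<and>
      s \<oplus>\<^bsub>R\<^esub> t = \<one>\<^bsub>R\<^esub> \<and> s \<otimes>\<^bsub>R\<^esub> b = u \<otimes>\<^bsub>R\<^esub> a \<and> t \<otimes>\<^bsub>R\<^esub> a = v \<otimes>\<^bsub>R\<^esub> b" for a b s t u v
  have "\<exists>s t u v. E a b s t u v" if "a \<in> carrier R" "b \<in> carrier R" for a b
    using ar[unfolded arithmetical_def, rule_format, OF that] unfolding E_def
    by (elim bexE conjE) (intro exI conjI, assumption+)
  then have "\<forall>p\<in>carrier R \<times> carrier R. \<exists>s t u v. E (fst p) (snd p) s t u v" by auto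
  from bchoice[OF this] obtain s where "\<forall>p\<in>carrier R \<times> carrier R. \<exists>t u v. E (fst p) (snd p) (s p) t u v" by (elim exE)
  from bchoice[OF this] obtain t where "\<forall>p\<in>carrier R \<times> carrier R. \<exists>u v. E (fst p) (snd p) (s p) (t p) u v" by (elim exE)
  from bchoice[OF this] obtain u where "\<forall>p\<in>carrier R \<times> carrier R. \<exists>v. E (fst p) (snd p) (s p) (t p) (u p) v" by (elim exE)
  from bchoice[OF this] obtain v where "\<forall>p\<in>carrier R \<times> carrier R. E (fst p) (snd p) (s p) (t p) (u p) (v p)" by (elim exE)
  then have E: "E a b (s (a, b)) (t (a, b)) (u (a, b)) (v (a, b))" if "a \<in> carrier R" "b \<in> carrier R" for a b
    using that by auto
  define ops where "ops = {(\<lambda>x y. x \<oplus>\<^bsub>R\<^esub> y), (\<lambda>x y. x \<otimes>\<^bsub>R\<^esub> y), (\<lambda>x y. \<ominus>\<^bsub>R\<^esub> x),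
      curry s, curry t, curry u, curry v}"
  have "countable ops" unfolding ops_def by simp
  moreover have "g x y \<in> carrier R" if "g \<in> ops" "x \<in> carrier R" "y \<in> carrier R" for g x y
    using that E[of x y] unfolding ops_def E_def by auto
  moreover have "countable (insert \<zero>\<^bsub>R\<^esub> (insert \<one>\<^bsub>R\<^esub> C))" "insert \<zero>\<^bsub>R\<^esub> (insert \<one>\<^bsub>R\<^esub> C) \<subseteq> carrier R" using C by auto
  ultimately obtain A where A: "countable A" "insert \<zero>\<^bsub>R\<^esub> (insert \<one>\<^bsub>R\<^esub> C) \<subseteq> A" "A \<subseteq> carrier R"
    and cl: "\<And>g x y. g \<in> ops \<Longrightarrow> x \<in> A \<Longrightarrow> y \<in> A \<Longrightarrow> g x y \<in> A"
    using countable_closure[of "insert \<zero>\<^bsub>R\<^esub> (insert \<one>\<^bsub>R\<^esub> C)" "carrier R" ops] by (metis (no_types, lifting))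
  have ops: "x \<oplus>\<^bsub>R\<^esub> y \<in> A" "x \<otimes>\<^bsub>R\<^esub> y \<in> A" "\<ominus>\<^bsub>R\<^esub> x \<in> A" "s (x, y) \<in> A" "t (x, y) \<in> A" "u (x, y) \<in> A" "v (x, y) \<in> A"
    if "x \<in> A" "y \<in> A" for x y
    using cl[of "\<lambda>x y. x \<oplus>\<^bsub>R\<^esub> y" x y] cl[of "\<lambda>x y. x \<otimes>\<^bsub>R\<^esub> y" x y] cl[of "\<lambda>x y. \<ominus>\<^bsub>R\<^esub> x" x y]
      cl[of "curry s" x y] cl[of "curry t" x y] cl[of "curry u" x y] cl[of "curry v" x y] that
    unfolding ops_def by simp_all
  have "subring A R" using A ops by (intro subringI) auto
  then have dom: "domain (R\<lparr>carrier := A\<rparr>)"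
    by (intro subring_is_domain)
  let ?R0 = "R\<lparr>carrier := A\<rparr>"
  interpret R0: domain ?R0 by (rule dom)
  define e where "e = to_nat_on A"
  have inj: "inj_on e (carrier ?R0)" unfolding e_def using inj_on_to_nat_on[OF A(1)] by simp
  define Q where "Q = image_ring e ?R0"
  have domQ: "domain Q" unfolding Q_def by (rule R0.inj_imp_image_ring_is_domain[OF inj])
  have iso: "e \<in> ring_iso ?R0 Q" unfolding Q_def by (rule inj_imp_image_ring_iso[OF inj])
  define h where "h = inv_into A e"
  have hiso: "h \<in> ring_iso Q ?R0" using ring_iso_set_sym[OF R0.ring_axioms iso] unfolding h_def by simp
  have hhom: "h \<in> ring_hom Q R" using hiso A(3) unfolding ring_iso_def ring_hom_def by auto
  have hbij: "bij_betw h (carrier Q) A" using hiso unfolding ring_iso_def by simp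
  have ehom: "e \<in> ring_hom ?R0 Q" using iso unfolding ring_iso_def by simp
  interpret Q: domain Q by (rule domQ)
  have eh: "e (h x) = x" if "x \<in> carrier Q" for x
  proof -
    have "x \<in> e ` A" using that unfolding Q_def image_ring_carrier by simp
    then show ?thesis unfolding h_def by (rule f_inv_into_f)
  qed
  have eA: "e x \<in> carrier Q" if "x \<in> A" for x using that unfolding Q_def image_ring_carrier by simp
  have eadd: "e (x \<oplus>\<^bsub>R\<^esub> y) = e x \<oplus>\<^bsub>Q\<^esub> e y" and emult: "e (x \<otimes>\<^bsub>R\<^esub> y) = e x \<otimes>\<^bsub>Q\<^esub> e y" if "x \<in> A" "y \<in> A" for x y
    using ring_hom_add[OF ehom, of x y] ring_hom_mult[OF ehom, of x y] that by simp_all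
  have eone: "e \<one>\<^bsub>R\<^esub> = \<one>\<^bsub>Q\<^esub>" using ring_hom_one[OF ehom] by simp
  have "Q.arithmetical"
    unfolding Q.arithmetical_def
  proof (intro ballI)
    fix a b assume a: "a \<in> carrier Q" and b: "b \<in> carrier Q"
    let ?a = "h a" and ?b = "h b"
    have ab: "?a \<in> A" "?b \<in> A" using hbij a b bij_betwE by blast+
    note o = ops[OF ab]
    have "E ?a ?b (s (?a, ?b)) (t (?a, ?b)) (u (?a, ?b)) (v (?a, ?b))" using E ab A(3) by blast
    then have "e (s (?a, ?b)) \<oplus>\<^bsub>Q\<^esub> e (t (?a, ?b)) = \<one>\<^bsub>Q\<^esub>"
      "e (s (?a, ?b)) \<otimes>\<^bsub>Q\<^esub> b = e (u (?a, ?b)) \<otimes>\<^bsub>Q\<^esub> a"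
      "e (t (?a, ?b)) \<otimes>\<^bsub>Q\<^esub> a = e (v (?a, ?b)) \<otimes>\<^bsub>Q\<^esub> b"
      unfolding E_def using o ab eadd[OF o(4,5)] eone emult[OF o(4) ab(2)] emult[OF o(6) ab(1)]
        emult[OF o(5) ab(1)] emult[OF o(7) ab(2)] eh[OF a] eh[OF b] by simp_all
    then show "\<exists>s\<in>carrier Q. \<exists>t\<in>carrier Q. \<exists>u\<in>carrier Q. \<exists>v\<in>carrier Q.
        s \<oplus>\<^bsub>Q\<^esub> t = \<one>\<^bsub>Q\<^esub> \<and> s \<otimes>\<^bsub>Q\<^esub> b = u \<otimes>\<^bsub>Q\<^esub> a \<and> t \<otimes>\<^bsub>Q\<^esub> a = v \<otimes>\<^bsub>Q\<^esub> b"
      using eA o(4-7) by blast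
  qed
  then have "prufer_domain Q" by (rule Q.arithmetical_prufer)
  moreover have "inj_on h (carrier Q)" "C \<subseteq> h ` carrier Q"
    using hbij A(2) unfolding bij_betw_def by auto
  ultimately show ?thesis using hhom by blast
qed

text \<open>
  An embedding of rings, extended to the coefficients of polynomials and of tuples of polynomials.
\<close>

locale injective_ring_hom = Q: cring Q + R: cring R
  for Q :: "('b, 'k) ring_scheme" and R :: "('a, 'm) ring_scheme" +
  fixes h :: "'b \<Rightarrow> 'a" and N n :: nat
  assumes hom: "h \<in> ring_hom Q R" and inj: "inj_on h (carrier Q)"
begin

sublocale hom: ring_hom_cring Q R h
  using hom by unfold_locales

abbreviation "PQ \<equiv> mpoly_ring Q N"
abbreviation "PR \<equiv> mpoly_ring R N"

sublocale PQ: cring PQ by (rule Q.mpoly_cring)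
sublocale PR: cring PR by (rule R.mpoly_cring)

definition push :: "(nat \<Rightarrow> nat multiset \<Rightarrow> 'b) \<Rightarrow> nat \<Rightarrow> nat multiset \<Rightarrow> 'a" where
  "push y = (\<lambda>j\<in>{1..n}. h \<circ> y j)"

lemma h_zero_iff: "x \<in> carrier Q \<Longrightarrow> h x = \<zero>\<^bsub>R\<^esub> \<longleftrightarrow> x = \<zero>\<^bsub>Q\<^esub>"
  using inj hom.hom_zero unfolding inj_on_def by (metis Q.zero_closed)

lemma poly_closed:
  assumes "p \<in> carrier PQ"
  shows "h \<circ> p \<in> carrier PR"
proof (rule R.mpolyI[OF Q.mpoly_finite_support[OF assms]])
  fix m
  { assume "m \<in> {m. p m \<noteq> \<zero>\<^bsub>Q\<^esub>}" then show "set_mset m \<subseteq> {1..N}" using Q.mpoly_support[OF assms] by blast }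
  { assume "m \<notin> {m. p m \<noteq> \<zero>\<^bsub>Q\<^esub>}" then show "(h \<circ> p) m = \<zero>\<^bsub>R\<^esub>" by simp }
  show "(h \<circ> p) m \<in> carrier R" using Q.mpoly_coeff[OF assms] by simp
qed

lemma poly_add:
  assumes "p \<in> carrier PQ" "q \<in> carrier PQ"
  shows "h \<circ> (p \<oplus>\<^bsub>PQ\<^esub> q) = (h \<circ> p) \<oplus>\<^bsub>PR\<^esub> (h \<circ> q)"
  using Q.mpoly_coeff[OF assms(1)] Q.mpoly_coeff[OF assms(2)]
  by (auto simp: Q.mpoly_simps(5) R.mpoly_simps(5))

lemma poly_mult:
  assumes "p \<in> carrier PQ" "q \<in> carrier PQ"
  shows "h \<circ> (p \<otimes>\<^bsub>PQ\<^esub> q) = (h \<circ> p) \<otimes>\<^bsub>PR\<^esub> (h \<circ> q)"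
proof
  fix m
  note c = Q.mpoly_coeff[OF assms(1)] Q.mpoly_coeff[OF assms(2)]
  have "h (finsum Q (\<lambda>k. p k \<otimes>\<^bsub>Q\<^esub> q (m - k)) {k. k \<subseteq># m}) =
      finsum R (h \<circ> (\<lambda>k. p k \<otimes>\<^bsub>Q\<^esub> q (m - k))) {k. k \<subseteq># m}"
    using c by (intro hom.hom_finsum) auto
  also have "\<dots> = finsum R (\<lambda>k. h (p k) \<otimes>\<^bsub>R\<^esub> h (q (m - k))) {k. k \<subseteq># m}"
    using c by (intro R.finsum_cong') auto
  finally show "(h \<circ> (p \<otimes>\<^bsub>PQ\<^esub> q)) m = ((h \<circ> p) \<otimes>\<^bsub>PR\<^esub> (h \<circ> q)) m"
    unfolding Q.mpoly_simps R.mpoly_simps by simp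
qed

lemma poly_finsum:
  assumes "finite A" "F \<in> A \<rightarrow> carrier PQ"
  shows "h \<circ> finsum PQ F A = finsum PR (\<lambda>j. h \<circ> F j) A"
proof
  fix m
  have c: "F j m \<in> carrier Q" if "j \<in> A" for j using assms(2) that Q.mpoly_coeff by blast
  have "h (finsum PQ F A m) = finsum R (h \<circ> (\<lambda>j. F j m)) A"
    unfolding Q.mpoly_finsum[OF assms] using c by (intro hom.hom_finsum) auto
  also have "\<dots> = finsum PR (\<lambda>j. h \<circ> F j) A m"
    using assms poly_closed by (subst R.mpoly_finsum) (auto simp: comp_def)
  finally show "(h \<circ> finsum PQ F A) m = finsum PR (\<lambda>j. h \<circ> F j) A m" by simp
qed

lemma poly_lift:
  assumes "p \<in> carrier PR" "range p \<subseteq> h ` carrier Q"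
  shows "\<exists>q\<in>carrier PQ. h \<circ> q = p"
proof -
  define q where "q m = inv_into (carrier Q) h (p m)" for m
  have q: "q m \<in> carrier Q" "h (q m) = p m" for m
    unfolding q_def using assms(2) by (auto intro!: inv_into_into f_inv_into_f)
  have "q \<in> carrier PQ"
  proof (rule Q.mpolyI[OF R.mpoly_finite_support[OF assms(1)]])
    fix m
    { assume "m \<in> {m. p m \<noteq> \<zero>\<^bsub>R\<^esub>}" then show "set_mset m \<subseteq> {1..N}" using R.mpoly_support[OF assms(1)] by blast }
    { assume "m \<notin> {m. p m \<noteq> \<zero>\<^bsub>R\<^esub>}" then show "q m = \<zero>\<^bsub>Q\<^esub>" using q h_zero_iff by fastforce }
    show "q m \<in> carrier Q" by (rule q)
  qed
  moreover have "h \<circ> q = p" using q by auto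
  ultimately show ?thesis by blast
qed

lemma poly_degree:
  assumes "p \<in> carrier PQ"
  shows "total_degree R (h \<circ> p) = total_degree Q p"
  unfolding total_degree_def using h_zero_iff Q.mpoly_coeff[OF assms] by simp

lemma push_solution_iff:
  assumes g: "g \<in> {1..n} \<rightarrow> carrier PQ" and y: "y \<in> {1..n} \<rightarrow>\<^sub>E carrier PQ"
    and f: "\<And>j. j \<in> {1..n} \<Longrightarrow> f j = h \<circ> g j"
  shows "push y \<in> solutions R N n f \<longleftrightarrow> y \<in> solutions Q N n g"
proof -
  have gc: "g j \<in> carrier PQ" and yc: "y j \<in> carrier PQ" if "j \<in> {1..n}" for j using g y that by auto
  let ?S = "finsum PQ (\<lambda>j. g j \<otimes>\<^bsub>PQ\<^esub> y j) {1..n}"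
  have S: "?S \<in> carrier PQ" using gc yc by (intro PQ.finsum_closed) auto
  have "finsum PR (\<lambda>j. f j \<otimes>\<^bsub>PR\<^esub> push y j) {1..n} = finsum PR (\<lambda>j. h \<circ> (g j \<otimes>\<^bsub>PQ\<^esub> y j)) {1..n}"
  proof (rule PR.finsum_cong')
    show "(\<lambda>j. h \<circ> (g j \<otimes>\<^bsub>PQ\<^esub> y j)) \<in> {1..n} \<rightarrow> carrier PR" using gc yc by (auto intro!: poly_closed)
    fix j assume j: "j \<in> {1..n}"
    then show "f j \<otimes>\<^bsub>PR\<^esub> push y j = h \<circ> (g j \<otimes>\<^bsub>PQ\<^esub> y j)"
      unfolding f[OF j] poly_mult[OF gc[OF j] yc[OF j]] push_def by simp
  qed simp
  also have "\<dots> = h \<circ> ?S" using gc yc by (intro poly_finsum[symmetric]) auto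
  finally have e: "finsum PR (\<lambda>j. f j \<otimes>\<^bsub>PR\<^esub> push y j) {1..n} = h \<circ> ?S" .
  have "h \<circ> ?S = \<zero>\<^bsub>PR\<^esub> \<longleftrightarrow> ?S = \<zero>\<^bsub>PQ\<^esub>"
    using h_zero_iff[OF Q.mpoly_coeff[OF S]] by (simp add: R.mpoly_simps(4) Q.mpoly_simps(4) fun_eq_iff)
  moreover have "push y \<in> {1..n} \<rightarrow>\<^sub>E carrier PR" unfolding push_def using poly_closed yc by auto
  ultimately show ?thesis unfolding R.solutions_iff Q.solutions_iff e using y by simp
qed

text \<open>
  By this, a submodule over \<open>R\<close> that contains the images of generators over \<open>Q\<close> contains the
  images of everything they generate over \<open>Q\<close>.
\<close>

lemma push_preimage_submodule:
  assumes H: "submodule H PR (free_module PR {1..n})"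
  shows "submodule {y \<in> carrier (free_module PQ {1..n}). push y \<in> H} PQ (free_module PQ {1..n})"
proof -
  let ?FQ = "free_module PQ {1..n}" and ?FR = "free_module PR {1..n}"
  interpret FQ: module PQ ?FQ by (rule PQ.free_module_is_module)
  interpret FR: module PR ?FR by (rule PR.free_module_is_module)
  note HE = FR.submoduleE[OF H]
  have val: "y j \<in> carrier PQ" if "y \<in> carrier ?FQ" "j \<in> {1..n}" for y j
    using that unfolding PQ.free_module_simps by auto
  have sm: "push (a \<odot>\<^bsub>?FQ\<^esub> y) \<in> H" if a: "a \<in> carrier PQ" and y: "y \<in> carrier ?FQ" "push y \<in> H" for a y
  proof -
    have "push (a \<odot>\<^bsub>?FQ\<^esub> y) = (h \<circ> a) \<odot>\<^bsub>?FR\<^esub> push y"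
      unfolding push_def PQ.free_module_simps PR.free_module_simps using poly_mult[OF a val[OF y(1)]] by auto
    then show ?thesis using HE(4)[OF poly_closed[OF a] y(2)] by simp
  qed
  have ad: "push (x \<oplus>\<^bsub>?FQ\<^esub> y) \<in> H" if x: "x \<in> carrier ?FQ" "push x \<in> H" and y: "y \<in> carrier ?FQ" "push y \<in> H" for x y
  proof -
    have "push (x \<oplus>\<^bsub>?FQ\<^esub> y) = push x \<oplus>\<^bsub>?FR\<^esub> push y"
      unfolding push_def PQ.free_module_simps PR.free_module_simps using poly_add[OF val[OF x(1)] val[OF y(1)]] by auto
    then show ?thesis using HE(5)[OF x(2) y(2)] by simp
  qed
  have "push \<zero>\<^bsub>?FQ\<^esub> = \<zero>\<^bsub>?FR\<^esub>"
    unfolding push_def PQ.free_module_simps PR.free_module_simps Q.mpoly_simps R.mpoly_simps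
    by (rule restrict_ext) (simp add: fun_eq_iff)
  moreover have "\<zero>\<^bsub>?FR\<^esub> \<in> H" using subgroup.one_closed[OF submodule.axioms(1)[OF H]] by simp
  ultimately have z: "push \<zero>\<^bsub>?FQ\<^esub> \<in> H" by simp
  show ?thesis
    by (rule FQ.submodule_by_closure)
      (use z sm ad FQ.zero_closed FQ.smult_closed FQ.a_closed in auto)
qed

end

text \<open>
  Some finite set \<open>G\<close> generates the solutions over \<open>R\<close>. A countable Pruefer subdomain \<open>Q\<close> that
  contains the coefficients of the \<open>f\<^sub>j\<close> and of \<open>G\<close> has \<open>G\<close> among its own solutions. Those are
  generated in degree \<open>\<beta> N d n\<close> by the definition of \<open>\<beta>\<close>, so the same generators serve over \<open>R\<close>.
\<close>

theorem theoremA: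
  fixes R :: "('a, 'm) ring_scheme"
    and N d n :: nat
    and f :: "nat \<Rightarrow> nat multiset \<Rightarrow> 'a"
  assumes "prufer_domain R"
    and "f \<in> {1..n} \<rightarrow> carrier (mpoly_ring R N)"
    and "\<forall>j\<in>{1..n}. total_degree R (f j) \<le> ereal (real d)"
  shows "generated_in_degree R N n f (\<beta> N d n)"
proof -
  interpret R: domain R using assms(1) unfolding prufer_domain_def by simp
  let ?F = "free_module (mpoly_ring R N) {1..n}"
  obtain D where "generated_in_degree R N n f D" using prufer_degree_bound assms by blast
  then obtain G where G: "finite G" "G \<subseteq> solutions R N n f"
    "generated_submodule (mpoly_ring R N) ?F G = solutions R N n f"
    unfolding generated_in_degree_def by (elim exE conjE) (rule that)
  have GP: "g j \<in> carrier (mpoly_ring R N)" if "g \<in> G" "j \<in> {1..n}" for g j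
  proof -
    have "g \<in> solutions R N n f" using G(2) that(1) by (rule subsetD)
    then show ?thesis using that(2) unfolding R.solutions_iff by auto
  qed
  have fP: "f j \<in> carrier (mpoly_ring R N)" if "j \<in> {1..n}" for j using assms(2) that by auto
  define C where "C = (\<Union>j\<in>{1..n}. range (f j) \<union> (\<Union>g\<in>G. range (g j)))"
  have cr: "finite (range p)" if "p \<in> carrier (mpoly_ring R N)" for p
  proof -
    have "range p \<subseteq> insert \<zero>\<^bsub>R\<^esub> (p ` {m. p m \<noteq> \<zero>\<^bsub>R\<^esub>})" by auto
    moreover have "finite (insert \<zero>\<^bsub>R\<^esub> (p ` {m. p m \<noteq> \<zero>\<^bsub>R\<^esub>}))" using R.mpoly_finite_support[OF that] by simp
    ultimately show ?thesis by (rule finite_subset)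
  qed
  have "finite C" unfolding C_def using cr[OF fP] cr[OF GP] G(1) by auto
  then have "countable C" by (rule countable_finite)
  moreover have "C \<subseteq> carrier R" unfolding C_def using R.mpoly_coeff[OF fP] R.mpoly_coeff[OF GP] by auto
  ultimately have "\<exists>(Q :: nat ring) h. prufer_domain Q \<and> h \<in> ring_hom Q R \<and> inj_on h (carrier Q) \<and> C \<subseteq> h ` carrier Q"
    by (rule countable_prufer_subdomain[OF assms(1)])
  then obtain Q :: "nat ring" and h where Q: "prufer_domain Q \<and> h \<in> ring_hom Q R \<and> inj_on h (carrier Q) \<and> C \<subseteq> h ` carrier Q"
    by (elim exE) (rule that)
  have CQ: "C \<subseteq> h ` carrier Q" using Q by simp
  interpret Q: domain Q using Q unfolding prufer_domain_def by simp
  interpret injective_ring_hom Q R h N n using Q by unfold_locales simp_all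
  have "\<exists>q\<in>carrier PQ. h \<circ> q = f j" if "j \<in> {1..n}" for j
  proof (rule poly_lift[OF fP[OF that]])
    have "range (f j) \<subseteq> C" unfolding C_def using that by blast
    then show "range (f j) \<subseteq> h ` carrier Q" using CQ by (rule order.trans)
  qed
  then obtain f' where f': "\<And>j. j \<in> {1..n} \<Longrightarrow> f' j \<in> carrier PQ \<and> h \<circ> f' j = f j" by metis
  have f'P: "f' \<in> {1..n} \<rightarrow> carrier PQ" using f' by auto
  have feq: "f j = h \<circ> f' j" if "j \<in> {1..n}" for j using f'[OF that] by simp
  have "\<forall>j\<in>{1..n}. total_degree Q (f' j) \<le> ereal (real d)"
  proof
    fix j assume j: "j \<in> {1..n}"
    then have "total_degree Q (f' j) = total_degree R (f j)" using poly_degree[of "f' j"] f'[OF j] by simp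
    then show "total_degree Q (f' j) \<le> ereal (real d)" using assms(3) j by simp
  qed
  then have "generated_in_degree Q N n f' (\<beta> N d n)" using \<beta>_bounds_countable[OF _ f'P] Q by blast
  then obtain G' where G': "finite G'" "G' \<subseteq> solutions Q N n f'"
    "\<forall>y\<in>G'. \<forall>j\<in>{1..n}. total_degree Q (y j) \<le> ereal (real (\<beta> N d n))"
    "generated_submodule PQ (free_module PQ {1..n}) G' = solutions Q N n f'"
    unfolding generated_in_degree_def by (elim exE conjE) (rule that)
  have G'P: "y \<in> {1..n} \<rightarrow>\<^sub>E carrier PQ" if "y \<in> G'" for y
    using subsetD[OF G'(2) that] unfolding Q.solutions_iff by simp
  show ?thesis
  proof (rule R.generated_in_degreeI[OF assms(2), of "push ` G'"])
    show "finite (push ` G')" using G'(1) by simp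
    show "push ` G' \<subseteq> solutions R N n f"
    proof (rule image_subsetI)
      fix y assume y: "y \<in> G'"
      show "push y \<in> solutions R N n f"
        using push_solution_iff[OF f'P G'P[OF y] feq] subsetD[OF G'(2) y] by simp
    qed
    fix y j assume "y \<in> push ` G'" and j: "j \<in> {1..n}"
    then obtain y' where y': "y' \<in> G'" "y = push y'" by auto
    have "y' j \<in> carrier PQ" using G'P[OF y'(1)] j by auto
    then have "total_degree R (y j) = total_degree Q (y' j)" using poly_degree j y'(2) by (simp add: push_def)
    then show "total_degree R (y j) \<le> ereal (real (\<beta> N d n))" using G'(3) y'(1) j by simp
  next
    fix H assume H: "submodule H PR ?F" and GH: "push ` G' \<subseteq> H"
    let ?H' = "{y \<in> carrier (free_module PQ {1..n}). push y \<in> H}"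
    have "submodule ?H' PQ (free_module PQ {1..n})" by (rule push_preimage_submodule[OF H])
    moreover have "G' \<subseteq> ?H'" using G'(2) GH unfolding solutions_def by auto
    ultimately have sol: "solutions Q N n f' \<subseteq> ?H'"
      unfolding G'(4)[symmetric] generated_submodule_def by (intro hull_minimal)
    have "G \<subseteq> H"
    proof
      fix g assume g: "g \<in> G"
      have "\<exists>q\<in>carrier PQ. h \<circ> q = g j" if "j \<in> {1..n}" for j
      proof (rule poly_lift[OF GP[OF g that]])
        have "range (g j) \<subseteq> C" unfolding C_def using that g by blast
        then show "range (g j) \<subseteq> h ` carrier Q" using CQ by (rule order.trans)
      qed
      then obtain g' where g': "\<And>j. j \<in> {1..n} \<Longrightarrow> g' j \<in> carrier PQ \<and> h \<circ> g' j = g j" by metis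
      define y where "y = (\<lambda>j\<in>{1..n}. g' j)"
      have y: "y \<in> {1..n} \<rightarrow>\<^sub>E carrier PQ" unfolding y_def using g' by auto
      have gs: "g \<in> solutions R N n f" using G(2) g by (rule subsetD)
      have "push y = g"
        using gs g' unfolding R.solutions_iff push_def y_def
        by (intro extensionalityI[of _ "{1..n}"]) (auto simp: PiE_iff)
      moreover have "y \<in> solutions Q N n f'"
        using push_solution_iff[OF f'P y feq] gs \<open>push y = g\<close> by simp
      ultimately show "g \<in> H" using sol by auto
    qed
    then show "solutions R N n f \<subseteq> H"
      unfolding G(3)[symmetric] generated_submodule_def using H by (intro hull_minimal)
  qed
qed

end
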